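(* For every $(c_v,c_h)$, every $1\le d\le r$ and every $K_0>0$, there exists $K_1\ge1$ such that for every $C^r$-family of diffeomorphisms $(f_p)_p$ of $\mathbb R^2$, every $m\ge1$ and every sequence of hyperbolic pieces $(\mathfrak d_j)_{1\le j\le N}$, with $\mathfrak d:=\mathfrak d_1\star\mathfrak d_2\star\cdots\star\mathfrak d_N$, it holds: (1) if $\mathcal B_0^{d,r}(\mathfrak d_j)\le K_0$ for every $j$, then $\mathcal B_0^{d,r}(\mathfrak d)\le K_1$; (2) if $\mathcal B_0^{d,r}(\mathfrak d_j),\ \mathcal B_1^{d,r}(\mathfrak d_j)\le K_0$ for every $j$, then $\mathcal B_1^{d,r}(\mathfrak d)\le K_1$; (3) if $\mathcal B_0^{d,r}(\mathfrak d_j),\ \mathcal B_1^{d,r}(\mathfrak d_j),\ \mathcal B_m^d(\mathfrak d_j)\le K_0$ for every $j$, then $\mathcal B_m^d(\mathfrak d)\le K_1$.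
   Context: Here $c_v,c_h>0$, $c_vc_h<1$ and $r<\infty$. A family $(g_p)_p$ is of class $C^{d,r}$ if all $\partial_p^iD^jg_p(x)$ with $i+j\le r$, $i\le d$ exist and are continuous; its $C^{d,r}$-norm is the maximum over such $i,j$ of $\sup_{p,x}\|\partial_p^iD^jg_p(x)\|$. "$C^r$-family" means $C^{r,r}$-family. Let $C_h=\{(u_x,u_y):|u_y|\le c_h|u_x|\}$, $C_v=\{(u_x,u_y):|u_x|\le c_v|u_y|\}$. A tame box is a set $Y\subset\mathbb R^2$ diffeomorphic to $[-1,1]^2$ of the form $\{(x,y):\psi^-(x)\le y\le\psi^+(x),\ \phi^-(y)\le x\le\phi^+(y)\}$ with $\psi^\pm,\phi^\pm$ of class $C^r$, $|D\phi^\pm|\le c_v$, $|D\psi^\pm|\le c_h$; $\partial^uY$ is the part where $y\in\{\psi^\pm(x)\}$, $\partial^sY$ the part where $x\in\{\phi^\pm(y)\}$. A piece $\mathfrak d=(Y_{\mathfrak d},n_{\mathfrak d})$ of a diffeomorphism $f$ is a tame box $Y_{\mathfrak d}$ and an integer $n_{\mathfrak d}$ such that $Y^{\mathfrak d}:=f^{n_{\mathfrak d}}(Y_{\mathfrak d})$ is a tame box and $Df^{n_{\mathfrak d}}(\mathbb R^2\setminus C_v)\subset C_h$ at points of $Y_{\mathfrak d}$. It is hyperbolic if, with $c:=\sqrt{c_vc_h}$, for every $z\in Y_{\mathfrak d}$ and all $(X_1,Y_1)=D_zf^{n_{\mathfrak d}}(X_0,Y_0)$ one has $|X_0|\le c|X_1|$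 and $|Y_1|\le c|Y_0|$. All pieces here are persistent pieces of $(f_p)_p$: pieces of $f_p$ for each $p$, with $\partial^sY_{\mathfrak d},\partial^uY_{\mathfrak d}$ made of $C^r$-curves depending continuously on $p$. The product is $Y_{\mathfrak d\star\mathfrak d'}=Y_{\mathfrak d}\cap f^{-n_{\mathfrak d}}(Y_{\mathfrak d'})$, $n_{\mathfrak d\star\mathfrak d'}=n_{\mathfrak d}+n_{\mathfrak d'}$; it is assumed that the products considered are well defined, i.e. are pieces. The affine-like representation $(A_p,B_p)$ of $\mathfrak d$ is the pair of functions such that for $(x_0,y_0)\in Y_{\mathfrak d}$, $(x_1,y_1)\in Y^{\mathfrak d}$: $f_p^{n_{\mathfrak d}}(x_0,y_0)=(x_1,y_1)$ iff $x_0=A_p(x_1,y_0)$, $y_1=B_p(x_1,y_0)$. Distortions ($D$ = differential in $(x,y)$): $$\mathcal B_0^{d,r}(\mathfrak d):=\|(A_p,B_p)_p\|_{C^{d,r}},\qquad\mathcal B_1^{d,r}(\mathfrak d):=\|(D\log|\partial_xA_p|,D\log|\partial_yB_p|)_p\|_{C^{d',r-2}},\ d'=\min(d,r-2),$$ $$\mathcal B_m^d(\mathfrak d):=\frac1{n_{\mathfrak d}}\max_{1\le k\le\min(d,r-1)}\left\|\partial_p^k\log|\partial_xA_p|,\ \partial_p^k\log\left|\partial_yB_p/b^{m\,n_{\mathfrak d}}\right|\right\|_{C^0},$$ where $b$ is the last coordinate of the parameter $p=(a,b)$. *)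

theory Defs
  imports "HOL-Analysis.Analysis"
begin

section \<open>Iterated derivatives, classes and norms\<close>

type_synonym plane = "real \<times> real"

text \<open>\<open>iter_deriv [w\<^sub>1, \<dots>, w\<^sub>j] g x\<close> is the value \<open>D\<^sup>j g(x)(w\<^sub>1, \<dots>, w\<^sub>j)\<close> of the
  \<open>j\<close>-th differential, a \<open>j\<close>-linear map, on \<open>j\<close> vectors. (The type of a map with values in
  \<open>j\<close>-linear maps would depend on \<open>j\<close>.)\<close>

primrec iter_deriv ::
  "'a::euclidean_space list \<Rightarrow> ('a \<Rightarrow> 'b::real_normed_vector) \<Rightarrow> 'a \<Rightarrow> 'b" where
  "iter_deriv [] g = g"
| "iter_deriv (w # ws) g = (\<lambda>x. frechet_derivative (iter_deriv ws g) (at x) w)"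

text \<open>Class \<open>C\<^sup>r\<close> on a set \<open>U\<close>, which is always open below.\<close>

definition C_on ::
  "nat \<Rightarrow> 'a::euclidean_space set \<Rightarrow> ('a \<Rightarrow> 'b::real_normed_vector) \<Rightarrow> bool" where
  "C_on r U g \<longleftrightarrow>
     (\<forall>ws. length ws < r \<longrightarrow> (\<forall>x\<in>U. iter_deriv ws g differentiable (at x))) \<and>
     (\<forall>ws. length ws \<le> r \<longrightarrow> continuous_on U (iter_deriv ws g))"

text \<open>\<open>\<partial>\<^sub>p\<^sup>i D\<^sup>j g\<^sub>p(x)\<close> evaluated on \<open>i\<close> parameter vectors \<open>vs\<close> and \<open>j\<close> phase vectors \<open>ws\<close>.\<close>

definition fam_deriv ::
  "'p::euclidean_space list \<Rightarrow> 'a::euclidean_space list \<Rightarrow>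
   ('p \<Rightarrow> 'a \<Rightarrow> 'b::real_normed_vector) \<Rightarrow> 'p \<Rightarrow> 'a \<Rightarrow> 'b" where
  "fam_deriv vs ws g p x = iter_deriv vs (\<lambda>q. iter_deriv ws (g q) x) p"

text \<open>Families of class \<open>C\<^sup>d\<^sup>,\<^sup>r\<close>, for open \<open>P\<close> and \<open>U\<close>.\<close>

definition C_family ::
  "nat \<Rightarrow> nat \<Rightarrow> 'p::euclidean_space set \<Rightarrow> 'a::euclidean_space set \<Rightarrow>
   ('p \<Rightarrow> 'a \<Rightarrow> 'b::real_normed_vector) \<Rightarrow> bool" where
  "C_family d r P U g \<longleftrightarrow>
     (\<forall>ws. length ws < r \<longrightarrow>
        (\<forall>p\<in>P. \<forall>x\<in>U. iter_deriv ws (g p) differentiable (at x))) \<and>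
     (\<forall>vs ws. length vs < d \<and> length vs + length ws < r \<longrightarrow>
        (\<forall>p\<in>P. \<forall>x\<in>U. (\<lambda>q. fam_deriv vs ws g q x) differentiable (at p))) \<and>
     (\<forall>vs ws. length vs \<le> d \<and> length vs + length ws \<le> r \<longrightarrow>
        continuous_on (P \<times> U) (\<lambda>(p, x). fam_deriv vs ws g p x))"

text \<open>The norm of the multilinear map \<open>\<partial>\<^sub>p\<^sup>i D\<^sup>j g\<^sub>p(x)\<close>.\<close>

definition deriv_norm ::
  "nat \<Rightarrow> nat \<Rightarrow> ('p::euclidean_space \<Rightarrow> 'a::euclidean_space \<Rightarrow> 'b::real_normed_vector) \<Rightarrow>
   'p \<Rightarrow> 'a \<Rightarrow> ennreal" where
  "deriv_norm i j g p x =
     (SUP (vs, ws) \<in> {(vs, ws). length vs = i \<and> length ws = j \<and>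
                         (\<forall>v\<in>set vs. norm v \<le> 1) \<and> (\<forall>w\<in>set ws. norm w \<le> 1)}.
        ennreal (norm (fam_deriv vs ws g p x)))"

text \<open>The \<open>C\<^sup>d\<^sup>,\<^sup>s\<close>-norm (possibly infinite) of a family defined on \<open>\<Omega>\<close>, a set of pairs \<open>(p, x)\<close>:
  the domain of \<open>g\<^sub>p\<close> may depend on \<open>p\<close>. The supremum runs over the interior, where the
  derivatives do not depend on values of \<open>g\<close> off \<open>\<Omega>\<close>; in the situation below the interior is
  dense in \<open>\<Omega>\<close>, so that by continuity of the derivatives up to the boundary the supremum over
  \<open>\<Omega>\<close> is the same. The orders are integers because \<open>s = r - 2\<close> is negative for \<open>r = 1\<close>: no
  \<open>(i, j)\<close> is then admissible and the norm is \<open>0\<close>.\<close>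

definition C_norm ::
  "int \<Rightarrow> int \<Rightarrow> ('p::euclidean_space \<times> 'a::euclidean_space) set \<Rightarrow>
   ('p \<Rightarrow> 'a \<Rightarrow> 'b::real_normed_vector) \<Rightarrow> ennreal" where
  "C_norm d s \<Omega> g =
     (SUP (i, j) \<in> {(i, j). int i \<le> d \<and> int (i + j) \<le> s}.
        SUP (p, x) \<in> interior \<Omega>. deriv_norm i j g p x)"

definition C_diffeo ::
  "nat \<Rightarrow> 'a::euclidean_space set \<Rightarrow> 'a set \<Rightarrow> ('a \<Rightarrow> 'a) \<Rightarrow> bool" where
  "C_diffeo r U V h \<longleftrightarrow>
     (\<exists>k. homeomorphism U V h k \<and> C_on r U h \<and> C_on r V k)"

definition diffeo_family ::
  "nat \<Rightarrow> 'p::euclidean_space set \<Rightarrow> ('p \<Rightarrow> plane \<Rightarrow> plane) \<Rightarrow> bool" where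
  "diffeo_family r P f \<longleftrightarrow>
     C_family r r P UNIV f \<and> (\<forall>p\<in>P. C_diffeo r UNIV UNIV (f p))"


section \<open>Tame boxes\<close>

definition cone_h :: "real \<Rightarrow> plane set" where
  "cone_h c\<^sub>h = {(u\<^sub>x, u\<^sub>y). \<bar>u\<^sub>y\<bar> \<le> c\<^sub>h * \<bar>u\<^sub>x\<bar>}"

definition cone_v :: "real \<Rightarrow> plane set" where
  "cone_v c\<^sub>v = {(u\<^sub>x, u\<^sub>y). \<bar>u\<^sub>x\<bar> \<le> c\<^sub>v * \<bar>u\<^sub>y\<bar>}"

definition slope_le :: "nat \<Rightarrow> real \<Rightarrow> (real \<Rightarrow> real) \<Rightarrow> bool" where
  "slope_le r c \<psi> \<longleftrightarrow> C_on r UNIV \<psi> \<and> (\<forall>x. \<bar>deriv \<psi> x\<bar> \<le> c)"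

text \<open>\<open>Y\<close> is a tame box with boundary functions \<open>\<psi>\<^sup>-, \<psi>\<^sup>+, \<phi>\<^sup>-, \<phi>\<^sup>+\<close> (in this order). A
  diffeomorphism from the closed square is the restriction of one between open neighbourhoods.\<close>

definition tame_box_with ::
  "real \<Rightarrow> real \<Rightarrow> nat \<Rightarrow> plane set \<Rightarrow> (real \<Rightarrow> real) \<Rightarrow> (real \<Rightarrow> real) \<Rightarrow>
   (real \<Rightarrow> real) \<Rightarrow> (real \<Rightarrow> real) \<Rightarrow> bool" where
  "tame_box_with c\<^sub>v c\<^sub>h r Y \<psi>m \<psi>p \<phi>m \<phi>p \<longleftrightarrow>
     slope_le r c\<^sub>h \<psi>m \<and> slope_le r c\<^sub>h \<psi>p \<and> slope_le r c\<^sub>v \<phi>m \<and> slope_le r c\<^sub>v \<phi>p \<and>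
     Y = {(x, y). \<psi>m x \<le> y \<and> y \<le> \<psi>p x \<and> \<phi>m y \<le> x \<and> x \<le> \<phi>p y} \<and>
     (\<exists>U V h. open U \<and> open V \<and> {-1..1} \<times> {-1..1} \<subseteq> U \<and> C_diffeo r U V h \<and>
        h ` ({-1..1} \<times> {-1..1}) = Y)"

definition tame_box :: "real \<Rightarrow> real \<Rightarrow> nat \<Rightarrow> plane set \<Rightarrow> bool" where
  "tame_box c\<^sub>v c\<^sub>h r Y \<longleftrightarrow> (\<exists>\<psi>m \<psi>p \<phi>m \<phi>p. tame_box_with c\<^sub>v c\<^sub>h r Y \<psi>m \<psi>p \<phi>m \<phi>p)"

definition bd_u :: "plane set \<Rightarrow> (real \<Rightarrow> real) \<Rightarrow> (real \<Rightarrow> real) \<Rightarrow> plane set" where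
  "bd_u Y \<psi>m \<psi>p = {(x, y) \<in> Y. y \<in> {\<psi>m x, \<psi>p x}}"

definition bd_s :: "plane set \<Rightarrow> (real \<Rightarrow> real) \<Rightarrow> (real \<Rightarrow> real) \<Rightarrow> plane set" where
  "bd_s Y \<phi>m \<phi>p = {(x, y) \<in> Y. x \<in> {\<phi>m y, \<phi>p y}}"

text \<open>Only the restriction to \<open>[-1,1]\<close> of the parametrization of an arc matters.\<close>

definition C_arc :: "nat \<Rightarrow> (real \<Rightarrow> plane) \<Rightarrow> bool" where
  "C_arc r \<gamma> \<longleftrightarrow> C_on r UNIV \<gamma> \<and> inj_on \<gamma> {-1..1} \<and>
     (\<forall>t\<in>{-1..1}. vector_derivative \<gamma> (at t) \<noteq> 0)"

definition arc_family ::
  "nat \<Rightarrow> 'p::euclidean_space set \<Rightarrow> ('p \<Rightarrow> real \<Rightarrow> plane) \<Rightarrow> bool" where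
  "arc_family r P \<gamma> \<longleftrightarrow> (\<forall>p\<in>P. C_arc r (\<gamma> p)) \<and>
     continuous_on (P \<times> {-1..1}) (\<lambda>(p, t). \<gamma> p t)"


section \<open>Pieces\<close>

text \<open>A family of pieces consists of a family of boxes \<open>p \<mapsto> Y p\<close> and an integer \<open>n\<close>, the same
  for all parameters. Being a number of iterates (and a divisor below), \<open>n\<close> is positive.\<close>

type_synonym 'p piece = "('p \<Rightarrow> plane set) \<times> nat"

definition is_piece ::
  "real \<Rightarrow> real \<Rightarrow> nat \<Rightarrow> (plane \<Rightarrow> plane) \<Rightarrow> plane set \<Rightarrow> nat \<Rightarrow> bool" where
  "is_piece c\<^sub>v c\<^sub>h r F Y n \<longleftrightarrow>
     1 \<le> n \<and> tame_box c\<^sub>v c\<^sub>h r Y \<and> tame_box c\<^sub>v c\<^sub>h r ((F ^^ n) ` Y) \<and>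
     (\<forall>z\<in>Y. frechet_derivative (F ^^ n) (at z) ` (UNIV - cone_v c\<^sub>v) \<subseteq> cone_h c\<^sub>h)"

text \<open>The inequalities are required of all tangent vectors, not only of those in a cone. In
  particular they force the differential of \<open>F\<^sup>n\<close> to be diagonal at the points of \<open>Y\<close>.\<close>

definition is_hyperbolic ::
  "real \<Rightarrow> real \<Rightarrow> (plane \<Rightarrow> plane) \<Rightarrow> plane set \<Rightarrow> nat \<Rightarrow> bool" where
  "is_hyperbolic c\<^sub>v c\<^sub>h F Y n \<longleftrightarrow>
     (\<forall>z\<in>Y. \<forall>X\<^sub>0 Y\<^sub>0 X\<^sub>1 Y\<^sub>1. (X\<^sub>1, Y\<^sub>1) = frechet_derivative (F ^^ n) (at z) (X\<^sub>0, Y\<^sub>0) \<longrightarrow>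
        \<bar>X\<^sub>0\<bar> \<le> sqrt (c\<^sub>v * c\<^sub>h) * \<bar>X\<^sub>1\<bar> \<and> \<bar>Y\<^sub>1\<bar> \<le> sqrt (c\<^sub>v * c\<^sub>h) * \<bar>Y\<^sub>0\<bar>)"

definition persistent_piece ::
  "real \<Rightarrow> real \<Rightarrow> nat \<Rightarrow> 'p::euclidean_space set \<Rightarrow> ('p \<Rightarrow> plane \<Rightarrow> plane) \<Rightarrow>
   'p piece \<Rightarrow> bool" where
  "persistent_piece c\<^sub>v c\<^sub>h r P f = (\<lambda>(Y, n).
     (\<forall>p\<in>P. is_piece c\<^sub>v c\<^sub>h r (f p) (Y p) n) \<and>
     (\<exists>\<gamma>\<^sub>1 \<gamma>\<^sub>2 \<delta>\<^sub>1 \<delta>\<^sub>2.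
        arc_family r P \<gamma>\<^sub>1 \<and> arc_family r P \<gamma>\<^sub>2 \<and> arc_family r P \<delta>\<^sub>1 \<and> arc_family r P \<delta>\<^sub>2 \<and>
        (\<forall>p\<in>P. \<exists>\<psi>m \<psi>p \<phi>m \<phi>p. tame_box_with c\<^sub>v c\<^sub>h r (Y p) \<psi>m \<psi>p \<phi>m \<phi>p \<and>
           bd_u (Y p) \<psi>m \<psi>p = \<gamma>\<^sub>1 p ` {-1..1} \<union> \<gamma>\<^sub>2 p ` {-1..1} \<and>
           bd_s (Y p) \<phi>m \<phi>p = \<delta>\<^sub>1 p ` {-1..1} \<union> \<delta>\<^sub>2 p ` {-1..1})))"

definition hyperbolic_piece ::
  "real \<Rightarrow> real \<Rightarrow> nat \<Rightarrow> 'p::euclidean_space set \<Rightarrow> ('p \<Rightarrow> plane \<Rightarrow> plane) \<Rightarrow>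
   'p piece \<Rightarrow> bool" where
  "hyperbolic_piece c\<^sub>v c\<^sub>h r P f = (\<lambda>(Y, n).
     persistent_piece c\<^sub>v c\<^sub>h r P f (Y, n) \<and> (\<forall>p\<in>P. is_hyperbolic c\<^sub>v c\<^sub>h (f p) (Y p) n))"

definition star :: "('p \<Rightarrow> plane \<Rightarrow> plane) \<Rightarrow> 'p piece \<Rightarrow> 'p piece \<Rightarrow> 'p piece" where
  "star f = (\<lambda>(Y, n) (Y', n'). (\<lambda>p. Y p \<inter> (f p ^^ n) -` Y' p, n + n'))"

definition star_seq :: "('p \<Rightarrow> plane \<Rightarrow> plane) \<Rightarrow> (nat \<Rightarrow> 'p piece) \<Rightarrow> nat \<Rightarrow> 'p piece" where
  "star_seq f D N = foldl (star f) (D 1) (map D [2..<Suc N])"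


section \<open>Affine-like representation and distortions\<close>

definition is_affine_rep ::
  "(plane \<Rightarrow> plane) \<Rightarrow> plane set \<Rightarrow> nat \<Rightarrow> (plane \<Rightarrow> real) \<Rightarrow> (plane \<Rightarrow> real) \<Rightarrow> bool" where
  "is_affine_rep F Y n A B \<longleftrightarrow>
     (\<forall>x\<^sub>0 y\<^sub>0 x\<^sub>1 y\<^sub>1. (x\<^sub>0, y\<^sub>0) \<in> Y \<and> (x\<^sub>1, y\<^sub>1) \<in> (F ^^ n) ` Y \<longrightarrow>
        ((F ^^ n) (x\<^sub>0, y\<^sub>0) = (x\<^sub>1, y\<^sub>1) \<longleftrightarrow> x\<^sub>0 = A (x\<^sub>1, y\<^sub>0) \<and> y\<^sub>1 = B (x\<^sub>1, y\<^sub>0)))"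

text \<open>The representation is uniquely determined on \<open>rep_domain\<close> below, and is only used there.\<close>

definition affine_rep ::
  "(plane \<Rightarrow> plane) \<Rightarrow> plane set \<Rightarrow> nat \<Rightarrow> (plane \<Rightarrow> real) \<times> (plane \<Rightarrow> real)" where
  "affine_rep F Y n = (SOME (A, B). is_affine_rep F Y n A B)"

definition rep_A :: "('p \<Rightarrow> plane \<Rightarrow> plane) \<Rightarrow> 'p piece \<Rightarrow> 'p \<Rightarrow> plane \<Rightarrow> real" where
  "rep_A f = (\<lambda>(Y, n) p. fst (affine_rep (f p) (Y p) n))"

definition rep_B :: "('p \<Rightarrow> plane \<Rightarrow> plane) \<Rightarrow> 'p piece \<Rightarrow> 'p \<Rightarrow> plane \<Rightarrow> real" where
  "rep_B f = (\<lambda>(Y, n) p. snd (affine_rep (f p) (Y p) n))"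

definition rep_domain ::
  "'p set \<Rightarrow> ('p \<Rightarrow> plane \<Rightarrow> plane) \<Rightarrow> 'p piece \<Rightarrow> ('p \<times> plane) set" where
  "rep_domain P f = (\<lambda>(Y, n).
     {(p, (x\<^sub>1, y\<^sub>0)) | p x\<^sub>1 y\<^sub>0. p \<in> P \<and>
        (\<exists>x\<^sub>0 y\<^sub>1. (x\<^sub>0, y\<^sub>0) \<in> Y p \<and> (f p ^^ n) (x\<^sub>0, y\<^sub>0) = (x\<^sub>1, y\<^sub>1))})"

definition partial_x :: "(plane \<Rightarrow> real) \<Rightarrow> plane \<Rightarrow> real" where
  "partial_x g = (\<lambda>(x, y). deriv (\<lambda>s. g (s, y)) x)"

definition partial_y :: "(plane \<Rightarrow> real) \<Rightarrow> plane \<Rightarrow> real" where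
  "partial_y g = (\<lambda>(x, y). deriv (\<lambda>s. g (x, s)) y)"

text \<open>The differential of a real function on the plane as an element of the plane; the operator
  norm of the former is the Euclidean norm of the latter.\<close>

definition differential :: "(plane \<Rightarrow> real) \<Rightarrow> plane \<Rightarrow> plane" where
  "differential g z =
     (frechet_derivative g (at z) (1, 0), frechet_derivative g (at z) (0, 1))"

definition distortion_0 ::
  "nat \<Rightarrow> nat \<Rightarrow> 'p::euclidean_space set \<Rightarrow> ('p \<Rightarrow> plane \<Rightarrow> plane) \<Rightarrow> 'p piece \<Rightarrow> ennreal" where
  "distortion_0 d r P f D =
     C_norm (int d) (int r) (rep_domain P f D) (\<lambda>p z. (rep_A f D p z, rep_B f D p z))"

definition distortion_1 ::
  "nat \<Rightarrow> nat \<Rightarrow> 'p::euclidean_space set \<Rightarrow> ('p \<Rightarrow> plane \<Rightarrow> plane) \<Rightarrow> 'p piece \<Rightarrow> ennreal" where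
  "distortion_1 d r P f D =
     C_norm (min (int d) (int r - 2)) (int r - 2) (rep_domain P f D)
       (\<lambda>p z. (differential (\<lambda>w. ln \<bar>partial_x (rep_A f D p) w\<bar>) z,
               differential (\<lambda>w. ln \<bar>partial_y (rep_B f D p) w\<bar>) z))"

text \<open>Parameters are \<open>p = (a, b)\<close>; this is meaningful for parameters with \<open>b \<noteq> 0\<close>.\<close>

definition distortion_m ::
  "nat \<Rightarrow> nat \<Rightarrow> nat \<Rightarrow> ('a::euclidean_space \<times> real) set \<Rightarrow>
   ('a \<times> real \<Rightarrow> plane \<Rightarrow> plane) \<Rightarrow> ('a \<times> real) piece \<Rightarrow> ennreal" where
  "distortion_m m d r P f D =
     (SUP k \<in> {1..min d (r - 1)}. SUP (p, z) \<in> interior (rep_domain P f D).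
        deriv_norm k 0
          (\<lambda>p z. (ln \<bar>partial_x (rep_A f D p) z\<bar>,
                  ln \<bar>partial_y (rep_B f D p) z / snd p ^ (m * snd D)\<bar>)) p z)
     / ennreal (real (snd D))"

end

theory Submission
  imports Defs
begin

text \<open>
  The inequalities defining hyperbolicity hold for all tangent vectors and thus force
  \<open>Df\<^sup>n\<close> to be diagonal along the piece, so that infinitesimally \<open>A\<close> depends only on \<open>(p, x\<^sub>1)\<close>, \<open>B\<close>
  only on \<open>(p, y\<^sub>0)\<close>, and both contract by \<open>c = sqrt (c\<^sub>v c\<^sub>h) < 1\<close>. The representation of a product is
  therefore a tower of compositions \<open>T\<^sub>k\<^sub>+\<^sub>1 = \<phi>\<^sub>k(p, T\<^sub>k)\<close> with \<open>|\<partial>\<^sub>x \<phi>\<^sub>k| \<le> c\<close>. In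
  \<open>\<partial>\<^sup>u T\<^sub>k\<^sub>+\<^sub>1\<close> the derivative \<open>\<partial>\<^sup>u T\<^sub>k\<close> of top order appears with the factor \<open>\<partial>\<^sub>x \<phi>\<^sub>k\<close>, and the
  other terms involve derivatives of \<open>T\<^sub>k\<close> of lower order only. By induction on the order, all
  derivatives of \<open>T\<^sub>k\<close> are bounded, and those involving a phase direction are
  \<open>O(\<theta>\<^sup>k)\<close> with \<open>\<theta> = (1 + c) / 2\<close>. As \<open>log |\<partial>\<^sub>x T\<^sub>N|\<close> is the sum of the
  \<open>log |\<partial>\<^sub>x \<phi>\<^sub>k|\<close> along the tower, the geometric decay bounds its phase derivatives; in its parameter
  derivatives each piece contributes \<open>K n\<^sub>k + O(1)\<close>.

  That \<open>A\<close> and \<open>B\<close> are well defined and of class \<open>C\<^sup>r\<close> in \<open>(p, x\<^sub>1, y\<^sub>0)\<close> comes from the injectivity of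
  \<open>(x\<^sub>0, y\<^sub>0) \<mapsto> (x\<^sub>1, y\<^sub>0)\<close> on tame boxes, the compactness of a persistent piece over a compact set
  of parameters, and the inverse function theorem.
\<close>

section \<open>Differentiation along words of directions and the classes \<open>C_on\<close>\<close>

section \<open>Calculus of iterated derivatives\<close>

text \<open>The bounds must not depend on \<open>N\<close>, so each contraction step has to absorb
  the lower-order terms it creates. Between \<open>c\<close> and \<theta> there is a gap
  \<open>(1 - c) / 2\<close>, and each order takes a constant so large that these terms fit in the
  gap. Purely parametric derivatives do not decay, because \<open>T k\<close> depends on p through
  all earlier steps; words of directions therefore carry a weight, \<open>\<theta> ^ k\<close> if a
  phase letter occurs and 1 otherwise. The norms differentiate first in phase and then in the
  parameter, whereas the Leibniz and chain rules produce words in arbitrary order. Families are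
  therefore turned into jointly smooth functions of (p, z), whose derivatives commute. Two towers
  run along one orbit in opposite directions: y is pushed forward by the maps B, x is pulled back by
  the maps A. A vanishing derivative does not make a function independent of a coordinate when
  slices of its domain are disconnected. Hence each step keeps both phase coordinates of its
  argument, and this argument has to stay in the interior of the domain of its piece.\<close>

definition dir_deriv ::
  "'a::euclidean_space \<Rightarrow> ('a \<Rightarrow> 'b::real_normed_vector) \<Rightarrow> 'a \<Rightarrow> 'b" where
  "dir_deriv w g = (\<lambda>x. frechet_derivative g (at x) w)"

lemma iter_deriv_Cons: "iter_deriv (w # ws) g = dir_deriv w (iter_deriv ws g)"
  by (simp add: dir_deriv_def)

declare iter_deriv.simps(2) [simp del]

lemma iter_deriv_append: "iter_deriv (us @ ws) g = iter_deriv us (iter_deriv ws g)"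
  by (induction us) (simp_all add: iter_deriv_Cons)

lemma iter_deriv_snoc: "iter_deriv (us @ [w]) g = iter_deriv us (dir_deriv w g)"
  by (simp add: iter_deriv_append iter_deriv_Cons)

lemma dir_deriv_eq: "(g has_derivative g') (at x) \<Longrightarrow> dir_deriv w g x = g' w"
  by (metis dir_deriv_def frechet_derivative_at)

lemma has_derivative_dir_deriv:
  "g differentiable (at x) \<Longrightarrow> (g has_derivative (\<lambda>w. dir_deriv w g x)) (at x)"
  unfolding dir_deriv_def frechet_derivative_works by simp

lemma has_derivative_cong_open:
  assumes "open U" "x \<in> U" "\<And>y. y \<in> U \<Longrightarrow> g y = h y"
  shows "(g has_derivative D) (at x) \<longleftrightarrow> (h has_derivative D) (at x)"
proof
  show "(h has_derivative D) (at x)" if "(g has_derivative D) (at x)"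
    using that assms by (rule has_derivative_transform_within_open)
  show "(g has_derivative D) (at x)" if "(h has_derivative D) (at x)"
    using that assms(1,2) assms(3)[symmetric] by (rule has_derivative_transform_within_open)
qed

lemma frechet_derivative_cong_open:
  assumes "open U" "x \<in> U" "\<And>y. y \<in> U \<Longrightarrow> g y = h y"
  shows "frechet_derivative g (at x) = frechet_derivative h (at x)"
  by (simp add: frechet_derivative_def has_derivative_cong_open[OF assms])

lemma differentiable_cong_open:
  assumes "open U" "x \<in> U" "\<And>y. y \<in> U \<Longrightarrow> g y = h y"
  shows "g differentiable (at x) \<longleftrightarrow> h differentiable (at x)"
  by (simp add: differentiable_def has_derivative_cong_open[OF assms])

lemma iter_deriv_cong_open:
  assumes "open U" "x \<in> U" "\<And>y. y \<in> U \<Longrightarrow> g y = h y"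
  shows "iter_deriv ws g x = iter_deriv ws h x"
  using assms(2)
proof (induction ws arbitrary: x)
  case (Cons w ws)
  show ?case
    using frechet_derivative_cong_open[OF assms(1) Cons.prems Cons.IH]
    by (simp add: iter_deriv_Cons dir_deriv_def)
qed (use assms in auto)

lemma dir_deriv_cong_open:
  assumes "open U" "x \<in> U" "\<And>y. y \<in> U \<Longrightarrow> g y = h y"
  shows "dir_deriv w g x = dir_deriv w h x"
  using iter_deriv_cong_open[OF assms, where ws = "[w]"] by (simp add: iter_deriv_Cons)

lemma iter_deriv_zero: "iter_deriv ws (\<lambda>_. 0) = (\<lambda>_. 0)"
  by (induction ws) (auto simp: iter_deriv_Cons dir_deriv_def)

lemma C_on_cong:
  assumes "open U" "\<And>y. y \<in> U \<Longrightarrow> g y = h y"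
  shows "C_on n U g \<longleftrightarrow> C_on n U h"
proof -
  have eq: "iter_deriv ws g y = iter_deriv ws h y" if "y \<in> U" for ws y
    by (rule iter_deriv_cong_open[OF assms(1) that assms(2)])
  have "continuous_on U (iter_deriv ws g) \<longleftrightarrow> continuous_on U (iter_deriv ws h)" for ws
    by (rule continuous_on_cong[OF refl eq])
  moreover have "(\<forall>y\<in>U. iter_deriv ws g differentiable (at y)) \<longleftrightarrow>
      (\<forall>y\<in>U. iter_deriv ws h differentiable (at y))" for ws
    by (intro ball_cong refl differentiable_cong_open[OF assms(1) _ eq])
  ultimately show ?thesis
    by (simp only: C_on_def)
qed

lemma C_on_0: "C_on 0 U g \<longleftrightarrow> continuous_on U g"
  by (simp add: C_on_def)

text \<open>The letter peeled off is the innermost one, the last of the word, so the rest of the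
  word acts on \<open>dir_deriv w g\<close>. With \<open>C_on_SucI\<close> the closure properties
  below become inductions on n.\<close>

lemma C_on_Suc:
  "C_on (Suc n) U g \<longleftrightarrow>
     (\<forall>x\<in>U. g differentiable (at x)) \<and> (\<forall>w. C_on n U (dir_deriv w g))"
proof
  assume L: "C_on (Suc n) U g"
  have "C_on n U (dir_deriv w g)" for w
    using L by (simp add: C_on_def iter_deriv_snoc[symmetric])
  moreover have "\<forall>x\<in>U. g differentiable (at x)"
    using L[unfolded C_on_def, THEN conjunct1, rule_format, of "[]"] by simp
  ultimately show "(\<forall>x\<in>U. g differentiable (at x)) \<and> (\<forall>w. C_on n U (dir_deriv w g))"
    by blast
next
  assume R: "(\<forall>x\<in>U. g differentiable (at x)) \<and> (\<forall>w. C_on n U (dir_deriv w g))"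
  have c: "continuous_on U g"
    using R by (meson continuous_at_imp_continuous_on differentiable_imp_continuous_within)
  show "C_on (Suc n) U g"
    unfolding C_on_def
  proof (intro conjI allI impI)
    fix ws :: "'a list" assume "length ws < Suc n"
    then show "\<forall>x\<in>U. iter_deriv ws g differentiable (at x)"
      using R by (cases ws rule: rev_cases) (auto simp: iter_deriv_snoc C_on_def)
  next
    fix ws :: "'a list" assume "length ws \<le> Suc n"
    then show "continuous_on U (iter_deriv ws g)"
      using R c by (cases ws rule: rev_cases) (auto simp: iter_deriv_snoc C_on_def)
  qed
qed

lemma C_on_SucI:
  assumes "open U" "\<And>x. x \<in> U \<Longrightarrow> (g has_derivative D x) (at x)"
    and "\<And>w. C_on n U (\<lambda>x. D x w)"
  shows "C_on (Suc n) U g"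
  unfolding C_on_Suc
proof (intro conjI allI ballI)
  show "g differentiable (at x)" if "x \<in> U" for x
    using assms(2)[OF that] by (auto simp: differentiable_def)
  show "C_on n U (dir_deriv w g)" for w
  proof -
    have "dir_deriv w g x = D x w" if "x \<in> U" for x
      by (rule dir_deriv_eq[OF assms(2)[OF that]])
    then have "C_on n U (dir_deriv w g) \<longleftrightarrow> C_on n U (\<lambda>x. D x w)"
      by (rule C_on_cong[OF assms(1)])
    with assms(3) show ?thesis
      by simp
  qed
qed

lemma C_on_mono: "C_on n U g \<Longrightarrow> m \<le> n \<Longrightarrow> C_on m U g"
  unfolding C_on_def by auto

lemma C_on_imp_continuous: "C_on n U g \<Longrightarrow> continuous_on U g"
  unfolding C_on_def by (drule conjunct2, drule spec[of _ "[]"]) simp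

lemma C_on_imp_differentiable: "C_on n U g \<Longrightarrow> 0 < n \<Longrightarrow> x \<in> U \<Longrightarrow> g differentiable (at x)"
  unfolding C_on_def by (drule conjunct1, drule spec[of _ "[]"]) simp

lemma C_on_dir_deriv: "C_on (Suc n) U g \<Longrightarrow> C_on n U (dir_deriv w g)"
  by (simp add: C_on_Suc)

lemma C_on_iter_deriv: "C_on (n + length ws) U g \<Longrightarrow> C_on n U (iter_deriv ws g)"
proof (induction ws arbitrary: g rule: rev_induct)
  case (snoc w ws)
  then show ?case
    by (auto simp: iter_deriv_snoc intro: C_on_dir_deriv)
qed simp

lemma C_on_linear_compose:
  assumes "open U" "bounded_linear L" "C_on n U g"
  shows "C_on n U (\<lambda>x. L (g x))"
  using assms(3)
proof (induction n arbitrary: g)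
  case 0
  then show ?case
    by (simp add: C_on_0 bounded_linear.continuous_on[OF assms(2)])
next
  case (Suc n)
  show ?case
  proof (rule C_on_SucI[OF assms(1)])
    show "((\<lambda>x. L (g x)) has_derivative (\<lambda>w. L (dir_deriv w g x))) (at x)" if "x \<in> U" for x
      using Suc.prems that
      by (intro bounded_linear.has_derivative[OF assms(2)] has_derivative_dir_deriv) (simp add: C_on_Suc)
    show "C_on n U (\<lambda>x. L (dir_deriv w g x))" for w
      using Suc by (simp add: C_on_Suc)
  qed
qed

lemma iter_deriv_linear_compose:
  assumes "open U" "bounded_linear L" "C_on n U g" "length ws \<le> n" "x \<in> U"
  shows "iter_deriv ws (\<lambda>x. L (g x)) x = L (iter_deriv ws g x)"
  using assms(4,5)
proof (induction ws arbitrary: x)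
  case (Cons w ws)
  have "iter_deriv ws g differentiable (at x)"
    using assms(3) Cons.prems by (auto simp: C_on_def)
  then have "((\<lambda>x. L (iter_deriv ws g x)) has_derivative
      (\<lambda>w. L (dir_deriv w (iter_deriv ws g) x))) (at x)"
    by (intro bounded_linear.has_derivative[OF assms(2)] has_derivative_dir_deriv)
  then have "dir_deriv w (\<lambda>x. L (iter_deriv ws g x)) x = L (dir_deriv w (iter_deriv ws g) x)"
    by (rule dir_deriv_eq)
  moreover have "dir_deriv w (iter_deriv ws (\<lambda>x. L (g x))) x
      = dir_deriv w (\<lambda>x. L (iter_deriv ws g x)) x"
    using Cons by (intro dir_deriv_cong_open[OF assms(1)]) auto
  ultimately show ?case
    by (simp add: iter_deriv_Cons)
qed simp

lemma C_on_const: "C_on n U (\<lambda>_. c)"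
proof (induction n arbitrary: c)
  case (Suc n)
  have "dir_deriv w (\<lambda>_::'a. c) = (\<lambda>_. 0)" for w
    by (auto simp: dir_deriv_def)
  with Suc show ?case
    by (simp add: C_on_Suc)
qed (simp add: C_on_0)

lemma C_on_bounded_linear:
  assumes "bounded_linear L"
  shows "C_on n U L"
proof (cases n)
  case 0
  then show ?thesis
    using assms by (simp add: C_on_0 linear_continuous_on)
next
  case (Suc m)
  have "(L has_derivative L) (at x)" for x
    using assms by (rule bounded_linear_imp_has_derivative)
  then have "dir_deriv w L = (\<lambda>_. L w)" "L differentiable (at x)" for w x
    by (auto simp: dir_deriv_eq fun_eq_iff differentiable_def)
  then show ?thesis
    using Suc by (simp add: C_on_Suc C_on_const)
qed

lemma C_on_add:
  assumes "open U" "C_on n U g" "C_on n U h"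
  shows "C_on n U (\<lambda>x. g x + h x)"
  using assms(2,3)
proof (induction n arbitrary: g h)
  case 0
  then show ?case by (auto simp: C_on_0 intro: continuous_intros)
next
  case (Suc n)
  show ?case
  proof (rule C_on_SucI[OF assms(1)])
    show "((\<lambda>x. g x + h x) has_derivative (\<lambda>w. dir_deriv w g x + dir_deriv w h x)) (at x)"
      if "x \<in> U" for x
      using Suc.prems that
      by (intro has_derivative_add has_derivative_dir_deriv) (simp_all add: C_on_Suc)
    show "C_on n U (\<lambda>x. dir_deriv w g x + dir_deriv w h x)" for w
      using Suc by (simp add: C_on_Suc)
  qed
qed

lemma iter_deriv_add:
  assumes "open U" "C_on n U g" "C_on n U h" "length ws \<le> n" "x \<in> U"
  shows "iter_deriv ws (\<lambda>x. g x + h x) x = iter_deriv ws g x + iter_deriv ws h x"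
  using assms(4,5)
proof (induction ws arbitrary: x)
  case (Cons w ws)
  have "iter_deriv ws g differentiable (at x)" "iter_deriv ws h differentiable (at x)"
    using assms Cons.prems by (auto simp: C_on_def)
  then have "((\<lambda>x. iter_deriv ws g x + iter_deriv ws h x) has_derivative
      (\<lambda>w. dir_deriv w (iter_deriv ws g) x + dir_deriv w (iter_deriv ws h) x)) (at x)"
    by (intro has_derivative_add has_derivative_dir_deriv)
  then have "dir_deriv w (\<lambda>x. iter_deriv ws g x + iter_deriv ws h x) x
      = dir_deriv w (iter_deriv ws g) x + dir_deriv w (iter_deriv ws h) x"
    by (rule dir_deriv_eq)
  moreover have "dir_deriv w (iter_deriv ws (\<lambda>x. g x + h x)) x
      = dir_deriv w (\<lambda>x. iter_deriv ws g x + iter_deriv ws h x) x"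
    using Cons by (intro dir_deriv_cong_open[OF assms(1)]) auto
  ultimately show ?case
    by (simp add: iter_deriv_Cons)
qed simp

lemma C_on_sum:
  assumes "open U" "\<And>i. i \<in> I \<Longrightarrow> C_on n U (g i)"
  shows "C_on n U (\<lambda>x. \<Sum>i\<in>I. g i x)"
  using assms(2)
proof (induction I rule: infinite_finite_induct)
  case (insert i I)
  then show ?case
    by (simp add: C_on_add[OF assms(1)])
qed (simp_all add: C_on_const)

lemma iter_deriv_sum:
  assumes "open U" "\<And>i. i \<in> I \<Longrightarrow> C_on n U (g i)" "length ws \<le> n" "x \<in> U"
  shows "iter_deriv ws (\<lambda>x. \<Sum>i\<in>I. g i x) x = (\<Sum>i\<in>I. iter_deriv ws (g i) x)"
  using assms(2)
proof (induction I rule: infinite_finite_induct)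
  case (insert i I)
  have "iter_deriv ws (\<lambda>x. g i x + (\<Sum>i\<in>I. g i x)) x
      = iter_deriv ws (g i) x + iter_deriv ws (\<lambda>x. \<Sum>i\<in>I. g i x) x"
    using insert by (intro iter_deriv_add[OF assms(1) _ _ assms(3,4)] C_on_sum[OF assms(1)]) auto
  with insert show ?case
    by simp
qed (simp_all add: iter_deriv_zero)

lemma C_on_bilinear:
  assumes "bounded_bilinear B" "open U" "C_on n U g" "C_on n U h"
  shows "C_on n U (\<lambda>x. B (g x) (h x))"
  using assms(3,4)
proof (induction n arbitrary: g h)
  case 0
  then show ?case
    by (simp add: C_on_0 bounded_bilinear.continuous_on[OF assms(1)])
next
  case (Suc n)
  show ?case
  proof (rule C_on_SucI[OF assms(2)])
    show "((\<lambda>x. B (g x) (h x)) has_derivative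
        (\<lambda>w. B (g x) (dir_deriv w h x) + B (dir_deriv w g x) (h x))) (at x)" if "x \<in> U" for x
      using Suc.prems that
      by (intro bounded_bilinear.FDERIV[OF assms(1)] has_derivative_dir_deriv) (auto simp: C_on_Suc)
    show "C_on n U (\<lambda>x. B (g x) (dir_deriv w h x) + B (dir_deriv w g x) (h x))" for w
    proof (rule C_on_add[OF assms(2)])
      show "C_on n U (\<lambda>x. B (g x) (dir_deriv w h x))"
        by (rule Suc.IH[OF C_on_mono[OF Suc.prems(1)] C_on_dir_deriv[OF Suc.prems(2)]]) simp
      show "C_on n U (\<lambda>x. B (dir_deriv w g x) (h x))"
        by (rule Suc.IH[OF C_on_dir_deriv[OF Suc.prems(1)] C_on_mono[OF Suc.prems(2)]]) simp
    qed
  qed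
qed

lemmas C_on_mult = C_on_bilinear[OF bounded_bilinear_mult]
lemmas C_on_scaleR = C_on_bilinear[OF bounded_bilinear_scaleR]

lemma C_on_diff:
  assumes "open U" "C_on n U g" "C_on n U h"
  shows "C_on n U (\<lambda>x. g x - h x)"
  using C_on_add[OF assms(1,2) C_on_linear_compose[OF assms(1) bounded_linear_minus[OF bounded_linear_ident] assms(3)]]
  by simp

lemma C_on_Pair:
  assumes "open U" "C_on n U g" "C_on n U h"
  shows "C_on n U (\<lambda>x. (g x, h x))"
proof -
  have "bounded_linear (\<lambda>x. (x::'b, 0::'c))" "bounded_linear (\<lambda>x. (0::'b, x::'c))"
    by (auto intro!: bounded_linear_Pair bounded_linear_ident bounded_linear_zero)
  then have "C_on n U (\<lambda>x. (g x, 0::'c))" "C_on n U (\<lambda>x. (0::'b, h x))"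
    using C_on_linear_compose[OF assms(1)] assms by auto
  from C_on_add[OF assms(1) this] show ?thesis
    by simp
qed

lemma C_on_fst: "open U \<Longrightarrow> C_on n U g \<Longrightarrow> C_on n U (\<lambda>x. fst (g x))"
  by (rule C_on_linear_compose[OF _ bounded_linear_fst])

lemma C_on_snd: "open U \<Longrightarrow> C_on n U g \<Longrightarrow> C_on n U (\<lambda>x. snd (g x))"
  by (rule C_on_linear_compose[OF _ bounded_linear_snd])

lemma dir_deriv_compose:
  fixes g :: "'a::euclidean_space \<Rightarrow> 'b::euclidean_space"
  assumes "\<phi> differentiable (at (g x))" "g differentiable (at x)"
  shows "dir_deriv w (\<lambda>x. \<phi> (g x)) x = dir_deriv (dir_deriv w g x) \<phi> (g x)"
  by (intro dir_deriv_eq has_derivative_compose[where f = g and g = \<phi>] has_derivative_dir_deriv assms)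

lemma dir_deriv_linear:
  "g differentiable (at x) \<Longrightarrow> linear (\<lambda>w. dir_deriv w g x)"
  using has_derivative_dir_deriv has_derivative_linear by blast

lemma dir_deriv_basis:
  fixes w :: "'a::euclidean_space"
  assumes "g differentiable (at x)"
  shows "dir_deriv w g x = (\<Sum>b\<in>Basis. (w \<bullet> b) *\<^sub>R dir_deriv b g x)"
proof -
  interpret linear "\<lambda>w. dir_deriv w g x"
    using assms by (rule dir_deriv_linear)
  have "dir_deriv w g x = dir_deriv (\<Sum>b\<in>Basis. (w \<bullet> b) *\<^sub>R b) g x"
    by (simp add: euclidean_representation)
  also have "\<dots> = (\<Sum>b\<in>Basis. (w \<bullet> b) *\<^sub>R dir_deriv b g x)"
    by (simp add: sum scaleR)
  finally show ?thesis .
qed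

text \<open>In the chain rule the direction \<open>dir_deriv w g x\<close> moves with x. Expanding
  it in the basis separates moving coefficients from fixed directions, so that the induction
  hypothesis applies to \<open>dir_deriv b \<phi>\<close>.\<close>

lemma C_on_compose:
  fixes g :: "'a::euclidean_space \<Rightarrow> 'b::euclidean_space"
  assumes "open U" "open V" "C_on n V \<phi>" "C_on n U g" "g ` U \<subseteq> V"
  shows "C_on n U (\<lambda>x. \<phi> (g x))"
  using assms(3,4)
proof (induction n arbitrary: \<phi>)
  case 0
  then show ?case
    using assms(5) by (auto simp: C_on_0 intro: continuous_on_compose2)
next
  case (Suc n)
  show ?case
  proof (rule C_on_SucI[OF assms(1)])
    fix x assume "x \<in> U"
    then have df: "\<phi> differentiable (at (g x))" "g differentiable (at x)"
      using Suc.prems assms(5) by (auto simp: C_on_Suc)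
    have "((\<lambda>x. \<phi> (g x)) has_derivative (\<lambda>w. dir_deriv (dir_deriv w g x) \<phi> (g x))) (at x)"
      using df by (intro has_derivative_compose[where f = g and g = \<phi>] has_derivative_dir_deriv)
    then show "((\<lambda>x. \<phi> (g x)) has_derivative
        (\<lambda>w. \<Sum>b\<in>Basis. (dir_deriv w g x \<bullet> b) *\<^sub>R dir_deriv b \<phi> (g x))) (at x)"
      using df by (simp add: dir_deriv_basis[symmetric])
  next
    fix w
    show "C_on n U (\<lambda>x. \<Sum>b\<in>Basis. (dir_deriv w g x \<bullet> b) *\<^sub>R dir_deriv b \<phi> (g x))"
    proof (intro C_on_sum[OF assms(1)] C_on_scaleR[OF assms(1)])
      fix b :: 'b
      show "C_on n U (\<lambda>x. dir_deriv w g x \<bullet> b)"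
        by (rule C_on_linear_compose[OF assms(1) bounded_linear_inner_left C_on_dir_deriv[OF Suc.prems(2)]])
      show "C_on n U (\<lambda>x. dir_deriv b \<phi> (g x))"
        by (rule Suc.IH[OF C_on_dir_deriv[OF Suc.prems(1)] C_on_mono[OF Suc.prems(2)]]) simp
    qed
  qed
qed

lemma C_on_inverse:
  fixes g :: "'a::euclidean_space \<Rightarrow> real"
  assumes "open U" "C_on n U g" "\<And>x. x \<in> U \<Longrightarrow> g x \<noteq> 0"
  shows "C_on n U (\<lambda>x. inverse (g x))"
  using assms(2)
proof (induction n)
  case 0
  then show ?case
    using assms(3) by (auto simp: C_on_0 intro: continuous_intros)
next
  case (Suc n)
  show ?case
  proof (rule C_on_SucI[OF assms(1)])
    show "((\<lambda>x. inverse (g x)) has_derivative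
        (\<lambda>w. - (inverse (g x) * dir_deriv w g x * inverse (g x)))) (at x)" if "x \<in> U" for x
      using Suc.prems that assms(3)[OF that]
      by (intro Deriv.has_derivative_inverse has_derivative_dir_deriv) (simp_all add: C_on_Suc)
    show "C_on n U (\<lambda>x. - (inverse (g x) * dir_deriv w g x * inverse (g x)))" for w
      using Suc.IH C_on_mono[OF Suc.prems, of n]
      by (intro C_on_linear_compose[OF assms(1) bounded_linear_minus[OF bounded_linear_ident]]
          C_on_mult[OF assms(1)] C_on_dir_deriv[OF Suc.prems]) auto
  qed
qed

lemma has_derivative_ln_abs:
  fixes g :: "'a::real_normed_vector \<Rightarrow> real"
  assumes "(g has_derivative g') (at x)" "g x \<noteq> 0"
  shows "((\<lambda>x. ln \<bar>g x\<bar>) has_derivative (\<lambda>w. g' w * inverse (g x))) (at x)"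
proof -
  have "((\<lambda>y. ln \<bar>y\<bar>) has_real_derivative inverse (g x)) (at (g x))"
  proof (cases "g x > 0")
    case True
    have "((\<lambda>y. ln y) has_real_derivative inverse (g x)) (at (g x))"
      using True by (auto intro!: derivative_eq_intros simp: inverse_eq_divide)
    then show ?thesis
      by (rule DERIV_cong_ev[THEN iffD1, rotated 3])
        (use True in \<open>auto intro!: eventually_mono[OF eventually_nhds_in_open[of "{0<..}"]]\<close>)
  next
    case False
    then have neg: "g x < 0" using assms(2) by simp
    have "((\<lambda>y. ln (- y)) has_real_derivative inverse (g x)) (at (g x))"
      using neg by (auto intro!: derivative_eq_intros simp: inverse_eq_divide divide_simps)
    then show ?thesis
      by (rule DERIV_cong_ev[THEN iffD1, rotated 3])
        (use neg in \<open>auto intro!: eventually_mono[OF eventually_nhds_in_open[of "{..<0}"]]\<close>)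
  qed
  then have "((\<lambda>y. ln \<bar>y\<bar>) has_derivative (\<lambda>h. inverse (g x) * h)) (at (g x))"
    by (simp add: has_field_derivative_def)
  from has_derivative_compose[OF assms(1) this] show ?thesis
    by (simp add: mult.commute)
qed

lemma C_on_ln_abs:
  fixes g :: "'a::euclidean_space \<Rightarrow> real"
  assumes "open U" "C_on n U g" "\<And>x. x \<in> U \<Longrightarrow> g x \<noteq> 0"
  shows "C_on n U (\<lambda>x. ln \<bar>g x\<bar>)"
proof (cases n)
  case 0
  then show ?thesis
    using assms(2,3) by (auto simp: C_on_0 intro!: continuous_intros)
next
  case (Suc m)
  show ?thesis
    unfolding Suc
  proof (rule C_on_SucI[OF assms(1)])
    show "((\<lambda>x. ln \<bar>g x\<bar>) has_derivative (\<lambda>w. dir_deriv w g x * inverse (g x))) (at x)"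
      if "x \<in> U" for x
      using assms that Suc
      by (intro has_derivative_ln_abs has_derivative_dir_deriv) (simp_all add: C_on_Suc)
    show "C_on m U (\<lambda>x. dir_deriv w g x * inverse (g x))" for w
      using assms(2) C_on_mono[OF assms(2), of m] Suc
      by (intro C_on_mult[OF assms(1)] C_on_inverse assms C_on_dir_deriv) auto
  qed
qed


subsection \<open>Symmetry of higher derivatives\<close>

text \<open>A Schwarz theorem for a one-parameter family: \<open>k\<close> is the space derivative
  of \<open>h\<close>, \<open>l\<close> the time derivative of \<open>k\<close>, \<open>m\<close>
  the time derivative of \<open>h\<close> at 0. Continuity of \<open>l\<close> makes the mixed
  derivative in the other order exist. Later t moves either the point
  (\<open>dir_deriv_commute\<close>) or the parameter
  (\<open>has_derivative_fam_deriv\<close>).\<close>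

lemma has_derivative_swap:
  fixes h :: "real \<Rightarrow> 'a::euclidean_space \<Rightarrow> 'b::real_normed_vector"
  assumes \<delta>: "0 < \<delta>" and U: "open U" "x\<^sub>0 \<in> U"
    and hx: "\<And>t x. \<bar>t\<bar> < \<delta> \<Longrightarrow> x \<in> U \<Longrightarrow> (h t has_derivative k t x) (at x)"
    and ht: "\<And>t x w. \<bar>t\<bar> < \<delta> \<Longrightarrow> x \<in> U \<Longrightarrow>
      ((\<lambda>t. k t x w) has_vector_derivative l t x w) (at t)"
    and hm: "\<And>x. x \<in> U \<Longrightarrow> ((\<lambda>t. h t x) has_vector_derivative m x) (at 0)"
    and lc: "\<And>w. continuous_on ({-\<delta><..<\<delta>} \<times> U) (\<lambda>(t, x). l t x w)"
  shows "(m has_derivative l 0 x\<^sub>0) (at x\<^sub>0)"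
proof -
  \<comment> \<open>Linearity in w is inherited from \<open>k s x\<close>, by uniqueness of the time
    derivative.\<close>
  have lin: "linear (l t x)" if tx: "\<bar>t\<bar> < \<delta>" "x \<in> U" for t x
  proof (rule linearI)
    have lk: "linear (k s x)" if "\<bar>s\<bar> < \<delta>" for s
      using hx[OF that tx(2)] by (rule has_derivative_linear)
    have near: "open {-\<delta><..<\<delta>}" "t \<in> {-\<delta><..<\<delta>}"
      using tx by auto
    fix a b :: 'a and c :: real
    have "((\<lambda>t. k t x (a + b)) has_vector_derivative l t x a + l t x b) (at t)"
    proof (rule has_vector_derivative_transform_within_open[OF _ near])
      show "((\<lambda>t. k t x a + k t x b) has_vector_derivative l t x a + l t x b) (at t)"
        by (intro has_vector_derivative_add ht tx)
      show "k s x a + k s x b = k s x (a + b)" if "s \<in> {-\<delta><..<\<delta>}" for s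
        using linear_add[OF lk[of s]] that by auto
    qed
    then show "l t x (a + b) = l t x a + l t x b"
      using ht[OF tx] vector_derivative_unique_at by blast
    have "((\<lambda>t. k t x (c *\<^sub>R a)) has_vector_derivative c *\<^sub>R l t x a) (at t)"
    proof (rule has_vector_derivative_transform_within_open[OF _ near])
      show "((\<lambda>t. c *\<^sub>R k t x a) has_vector_derivative c *\<^sub>R l t x a) (at t)"
        using bounded_linear.has_vector_derivative[OF bounded_linear_scaleR_right ht[OF tx]] .
      show "c *\<^sub>R k s x a = k s x (c *\<^sub>R a)" if "s \<in> {-\<delta><..<\<delta>}" for s
        using linear_scale[OF lk[of s]] that by auto
    qed
    then show "l t x (c *\<^sub>R a) = c *\<^sub>R l t x a"
      using ht[OF tx] vector_derivative_unique_at by blast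
  qed
  have bl: "bounded_linear (l 0 x\<^sub>0)"
    using lin[of 0 x\<^sub>0] \<delta> U by (simp add: linear_conv_bounded_linear)
  have main: "\<exists>\<rho>>0. \<forall>x. norm (x - x\<^sub>0) < \<rho> \<longrightarrow> norm (m x - m x\<^sub>0 - l 0 x\<^sub>0 (x - x\<^sub>0)) \<le> \<epsilon> * norm (x - x\<^sub>0)"
    if "0 < \<epsilon>" for \<epsilon> :: real
  proof -
    \<comment> \<open>\<open>l\<close> is continuous for each fixed w only; a bound \<open>e\<close>
      on every basis vector adds up to \<epsilon> in operator norm.\<close>
    define e where "e = \<epsilon> / DIM('a)"
    have e: "0 < e"
      using that by (simp add: e_def)
    have "\<forall>\<^sub>F z in nhds (0, x\<^sub>0). dist (l (fst z) (snd z) b) (l 0 x\<^sub>0 b) < e" for b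
    proof -
      have "continuous (at (0, x\<^sub>0)) (\<lambda>(t, x). l t x b)"
        using lc[of b] U \<delta> by (subst (asm) continuous_on_eq_continuous_at) (auto intro: open_Times)
      then have "((\<lambda>(t, x). l t x b) \<longlongrightarrow> l 0 x\<^sub>0 b) (nhds (0, x\<^sub>0))"
        using tendsto_at_iff_tendsto_nhds[of "\<lambda>(t, x). l t x b" "(0, x\<^sub>0)"] by (simp add: isCont_def)
      from tendstoD[OF this e] show ?thesis
        by (simp add: case_prod_unfold)
    qed
    then have "\<forall>\<^sub>F z in nhds (0, x\<^sub>0). \<forall>b\<in>Basis. dist (l (fst z) (snd z) b) (l 0 x\<^sub>0 b) < e"
      by (simp add: eventually_ball_finite_distrib)
    moreover have "\<forall>\<^sub>F z in nhds (0::real, x\<^sub>0). z \<in> {-\<delta><..<\<delta>} \<times> U"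
      using U \<delta> by (intro eventually_nhds_in_open) (auto intro: open_Times)
    ultimately have "\<forall>\<^sub>F z in nhds (0, x\<^sub>0). z \<in> {-\<delta><..<\<delta>} \<times> U \<and>
        (\<forall>b\<in>Basis. dist (l (fst z) (snd z) b) (l 0 x\<^sub>0 b) < e)"
      by eventually_elim auto
    then obtain R where R: "R > 0" "\<And>z. dist z (0, x\<^sub>0) < R \<Longrightarrow> z \<in> {-\<delta><..<\<delta>} \<times> U \<and>
        (\<forall>b\<in>Basis. dist (l (fst z) (snd z) b) (l 0 x\<^sub>0 b) < e)"
      unfolding eventually_nhds_metric by blast
    define \<rho> where "\<rho> = R / 2"
    have \<rho>: "\<rho> > 0"
      using R by (simp add: \<rho>_def)
    have close: "\<bar>t\<bar> < \<delta> \<and> x \<in> U \<and> (\<forall>b\<in>Basis. norm (l t x b - l 0 x\<^sub>0 b) \<le> e)"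
      if "\<bar>t\<bar> < \<rho>" "x \<in> ball x\<^sub>0 \<rho>" for t x
    proof -
      have "dist (t, x) (0, x\<^sub>0) \<le> \<bar>t\<bar> + dist x x\<^sub>0"
        using sqrt_sum_squares_le_sum_abs[of t "dist x x\<^sub>0"]
        by (simp add: dist_Pair_Pair dist_real_def)
      also have "\<dots> < R"
        using that by (auto simp: \<rho>_def dist_commute)
      finally show ?thesis
        using R(2)[of "(t, x)"] by (auto simp: dist_norm less_imp_le)
    qed
    have lclose: "norm (l t x w - l 0 x\<^sub>0 w) \<le> \<epsilon> * norm w"
      if "\<bar>t\<bar> < \<rho>" "x \<in> ball x\<^sub>0 \<rho>" for t x w
    proof -
      interpret l1: linear "l t x" using lin close[OF that] by blast
      interpret l2: linear "l 0 x\<^sub>0" using lin \<delta> U by auto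
      have "l t x w - l 0 x\<^sub>0 w = l t x (\<Sum>b\<in>Basis. (w \<bullet> b) *\<^sub>R b) - l 0 x\<^sub>0 (\<Sum>b\<in>Basis. (w \<bullet> b) *\<^sub>R b)"
        by (simp add: euclidean_representation)
      also have "\<dots> = (\<Sum>b\<in>Basis. (w \<bullet> b) *\<^sub>R (l t x b - l 0 x\<^sub>0 b))"
        by (simp add: l1.sum l2.sum l1.scaleR l2.scaleR sum_subtractf algebra_simps)
      also have "norm \<dots> \<le> (\<Sum>b\<in>(Basis::'a set). norm w * e)"
        using close[OF that] by (intro sum_norm_le) (auto intro!: mult_mono Basis_le_norm)
      also have "\<dots> = \<epsilon> * norm w"
        by (simp add: e_def)
      finally show ?thesis .
    qed
    \<comment> \<open>The mean value inequality is used twice: in y for the difference quotient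
      minus \<open>l 0 x\<^sub>0\<close>, whose derivative is estimated by the same inequality in t
      on the segment from 0. Letting t tend to 0 then turns the quotients into
      \<open>m\<close>.\<close>
    have quot: "norm ((1 / t) *\<^sub>R (h t x - h 0 x) - (1 / t) *\<^sub>R (h t x\<^sub>0 - h 0 x\<^sub>0) - l 0 x\<^sub>0 (x - x\<^sub>0))
        \<le> \<epsilon> * norm (x - x\<^sub>0)"
      if t: "\<bar>t\<bar> < \<rho>" "t \<noteq> 0" and x: "x \<in> ball x\<^sub>0 \<rho>" for t x
    proof -
      let ?G = "\<lambda>y. (1 / t) *\<^sub>R (h t y - h 0 y) - l 0 x\<^sub>0 y"
      let ?G' = "\<lambda>y w. (1 / t) *\<^sub>R (k t y w - k 0 y w) - l 0 x\<^sub>0 w"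
      have "norm (?G x - ?G x\<^sub>0) \<le> \<epsilon> * norm (x - x\<^sub>0)"
      proof (rule differentiable_bound[of "ball x\<^sub>0 \<rho>" ?G ?G'])
        fix y assume y: "y \<in> ball x\<^sub>0 \<rho>"
        have "(?G has_derivative ?G' y) (at y)"
          using close[OF t(1) y] close[OF _ y, of 0] \<rho>
          by (intro has_derivative_diff has_derivative_scaleR_right hx
              bounded_linear_imp_has_derivative bl) auto
        then show "(?G has_derivative ?G' y) (at y within ball x\<^sub>0 \<rho>)"
          by (rule has_derivative_at_withinI)
        show "onorm (?G' y) \<le> \<epsilon>"
        proof (rule onorm_le)
          fix w
          let ?F = "\<lambda>s. k s y w - s *\<^sub>R l 0 x\<^sub>0 w"
          have "norm (?F t - ?F 0) \<le> (\<epsilon> * norm w) * norm (t - 0)"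
          proof (rule differentiable_bound[of "closed_segment 0 t" ?F "\<lambda>s h. h *\<^sub>R (l s y w - l 0 x\<^sub>0 w)"])
            fix s assume "s \<in> closed_segment 0 t"
            then have s: "\<bar>s\<bar> < \<rho>"
              using t(1) by (auto simp: closed_segment_eq_real_ivl split: if_splits)
            have "(?F has_vector_derivative l s y w - l 0 x\<^sub>0 w) (at s)"
              using close[OF s y] by (auto intro!: derivative_eq_intros ht)
            then show "(?F has_derivative (\<lambda>h. h *\<^sub>R (l s y w - l 0 x\<^sub>0 w))) (at s within closed_segment 0 t)"
              unfolding has_vector_derivative_def by (rule has_derivative_at_withinI)
            show "onorm (\<lambda>h. h *\<^sub>R (l s y w - l 0 x\<^sub>0 w)) \<le> \<epsilon> * norm w"
              using lclose[OF s y, of w] by (intro onorm_le) (auto simp: mult.commute intro: mult_left_mono)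
          qed auto
          then have "norm (k t y w - k 0 y w - t *\<^sub>R l 0 x\<^sub>0 w) \<le> \<epsilon> * norm w * \<bar>t\<bar>"
            by (simp add: algebra_simps)
          then have "(1 / \<bar>t\<bar>) * norm (k t y w - k 0 y w - t *\<^sub>R l 0 x\<^sub>0 w) \<le> (1 / \<bar>t\<bar>) * (\<epsilon> * norm w * \<bar>t\<bar>)"
            by (rule mult_left_mono) simp
          moreover have "?G' y w = (1 / t) *\<^sub>R (k t y w - k 0 y w - t *\<^sub>R l 0 x\<^sub>0 w)"
            using t(2) by (simp add: algebra_simps)
          then have "norm (?G' y w) = (1 / \<bar>t\<bar>) * norm (k t y w - k 0 y w - t *\<^sub>R l 0 x\<^sub>0 w)"
            by simp
          ultimately show "norm (?G' y w) \<le> \<epsilon> * norm w"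
            using t(2) by simp
        qed
      qed (use x \<rho> in auto)
      then show ?thesis
        by (simp add: linear_diff[OF lin[of 0 x\<^sub>0]] \<delta> U algebra_simps)
    qed
    have "norm (m x - m x\<^sub>0 - l 0 x\<^sub>0 (x - x\<^sub>0)) \<le> \<epsilon> * norm (x - x\<^sub>0)" if x: "norm (x - x\<^sub>0) < \<rho>" for x
    proof -
      have xb: "x \<in> ball x\<^sub>0 \<rho>" "x \<in> U"
        using x close[of 0 x] \<rho> by (auto simp: dist_norm norm_minus_commute)
      have lim: "((\<lambda>t. (1 / t) *\<^sub>R (h t y - h 0 y)) \<longlongrightarrow> m y) (at 0)" if "y \<in> U" for y
      proof -
        have "((\<lambda>t. norm (h t y - h 0 y - t *\<^sub>R m y) / norm t) \<longlongrightarrow> 0) (at 0)"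
          using hm[OF that] by (simp add: has_vector_derivative_def has_derivative_at)
        moreover have "\<forall>\<^sub>F t in at 0. norm (h t y - h 0 y - t *\<^sub>R m y) / norm t
            = norm ((1 / t) *\<^sub>R (h t y - h 0 y) - m y)"
        proof -
          have "norm (h t y - h 0 y - t *\<^sub>R m y) / norm t = norm ((1 / t) *\<^sub>R (h t y - h 0 y) - m y)"
            if "t \<noteq> 0" for t
          proof -
            have "(1 / t) *\<^sub>R (h t y - h 0 y) - m y = (1 / t) *\<^sub>R (h t y - h 0 y - t *\<^sub>R m y)"
              using that by (simp add: algebra_simps)
            then show ?thesis
              by simp
          qed
          then show ?thesis
            by (auto simp: eventually_at_filter)
        qed
        ultimately have "((\<lambda>t. norm ((1 / t) *\<^sub>R (h t y - h 0 y) - m y)) \<longlongrightarrow> 0) (at 0)"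
          by (rule Lim_transform_eventually)
        then show ?thesis
          by (rule LIM_zero_cancel[OF tendsto_norm_zero_cancel])
      qed
      have "((\<lambda>t. norm ((1 / t) *\<^sub>R (h t x - h 0 x) - (1 / t) *\<^sub>R (h t x\<^sub>0 - h 0 x\<^sub>0) - l 0 x\<^sub>0 (x - x\<^sub>0)))
          \<longlongrightarrow> norm (m x - m x\<^sub>0 - l 0 x\<^sub>0 (x - x\<^sub>0))) (at 0)"
        using lim[OF xb(2)] lim[OF U(2)] by (intro tendsto_intros)
      moreover have "\<forall>\<^sub>F t in at 0. norm ((1 / t) *\<^sub>R (h t x - h 0 x) - (1 / t) *\<^sub>R (h t x\<^sub>0 - h 0 x\<^sub>0) - l 0 x\<^sub>0 (x - x\<^sub>0))
          \<le> \<epsilon> * norm (x - x\<^sub>0)"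
        unfolding eventually_at using \<rho> quot[OF _ _ xb(1)] by (intro exI[of _ \<rho>]) auto
      ultimately show ?thesis
        by (intro tendsto_upperbound) auto
    qed
    with \<rho> show ?thesis
      by blast
  qed
  show ?thesis
    unfolding has_derivative_at_alt using bl main by blast
qed

lemma has_vector_derivative_line:
  assumes "g differentiable (at (x + t *\<^sub>R v))"
  shows "((\<lambda>t. g (x + t *\<^sub>R v)) has_vector_derivative dir_deriv v g (x + t *\<^sub>R v)) (at t)"
proof -
  have "((\<lambda>t. x + t *\<^sub>R v) has_derivative (\<lambda>h. h *\<^sub>R v)) (at t)"
    by (auto intro!: derivative_eq_intros)
  from has_derivative_compose[OF this has_derivative_dir_deriv[OF assms]]
  show ?thesis
    by (simp add: has_vector_derivative_def linear_scale[OF dir_deriv_linear[OF assms]])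
qed

lemma dir_deriv_commute:
  assumes "open U" "C_on 2 U g" "x \<in> U"
  shows "dir_deriv v (dir_deriv w g) x = dir_deriv w (dir_deriv v g) x"
proof -
  obtain R where R: "R > 0" "ball x R \<subseteq> U"
    using assms by (meson open_contains_ball)
  \<comment> \<open>\<open>1 + norm v\<close> keeps the denominator positive when v = 0; the other
    half of R is left for the motion of the base point.\<close>
  define \<delta> where "\<delta> = R / 2 / (1 + norm v)"
  have "1 + norm v > 0"
    by (simp add: add_pos_nonneg)
  then have \<delta>: "\<delta> > 0"
    using R(1) by (simp add: \<delta>_def)
  have inU: "y + t *\<^sub>R v \<in> U" if "\<bar>t\<bar> < \<delta>" "y \<in> ball x (R / 2)" for y t
  proof -
    have "\<bar>t\<bar> * norm v \<le> \<bar>t\<bar> * (1 + norm v)"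
      by (intro mult_left_mono) auto
    also have "\<dots> < R / 2"
      using that(1) \<open>1 + norm v > 0\<close> unfolding \<delta>_def by (simp only: pos_less_divide_eq)
    finally have "dist x (y + t *\<^sub>R v) < R"
      using that(2) norm_triangle_ineq4[of "x - y" "t *\<^sub>R v"] by (simp add: dist_norm algebra_simps)
    then show ?thesis
      using R(2) by auto
  qed
  have g: "g differentiable (at y)" "dir_deriv w g differentiable (at y)"
    "continuous_on U (dir_deriv v (dir_deriv w g))" if "y \<in> U" for y w
    using assms(2) that by (auto simp: numeral_2_eq_2 C_on_Suc C_on_0)
  have "((\<lambda>y. dir_deriv v g y) has_derivative (\<lambda>w. dir_deriv v (dir_deriv w g) (x + 0 *\<^sub>R v))) (at x)"
  proof (rule has_derivative_swap[where \<delta> = \<delta> and U = "ball x (R / 2)" and h = "\<lambda>t y. g (y + t *\<^sub>R v)"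
        and k = "\<lambda>t y w. dir_deriv w g (y + t *\<^sub>R v)"
        and l = "\<lambda>t y w. dir_deriv v (dir_deriv w g) (y + t *\<^sub>R v)"])
    fix t y assume ty: "\<bar>t\<bar> < \<delta>" "y \<in> ball x (R / 2)"
    have "((\<lambda>y. y + t *\<^sub>R v) has_derivative (\<lambda>h. h)) (at y)"
      by (auto intro!: derivative_eq_intros)
    from has_derivative_compose[OF this has_derivative_dir_deriv[OF g(1)[OF inU[OF ty]]]]
    show "((\<lambda>y. g (y + t *\<^sub>R v)) has_derivative (\<lambda>w. dir_deriv w g (y + t *\<^sub>R v))) (at y)" .
    show "((\<lambda>t. dir_deriv w g (y + t *\<^sub>R v)) has_vector_derivative
        dir_deriv v (dir_deriv w g) (y + t *\<^sub>R v)) (at t)" for w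
      by (rule has_vector_derivative_line[OF g(2)[OF inU[OF ty]]])
  next
    fix y assume "y \<in> ball x (R / 2)"
    then have "y + 0 *\<^sub>R v \<in> U"
      using inU[of 0 y] \<delta> by simp
    from has_vector_derivative_line[OF g(1)[OF this]]
    show "((\<lambda>t. g (y + t *\<^sub>R v)) has_vector_derivative dir_deriv v g y) (at 0)"
      by simp
  next
    fix w
    have "continuous_on ({-\<delta><..<\<delta>} \<times> ball x (R / 2))
        (\<lambda>z. dir_deriv v (dir_deriv w g) (snd z + fst z *\<^sub>R v))"
      by (rule continuous_on_compose2[OF g(3)[OF assms(3)]])
        (use inU in \<open>auto intro!: continuous_intros simp: abs_less_iff\<close>)
    then show "continuous_on ({-\<delta><..<\<delta>} \<times> ball x (R / 2))
        (\<lambda>(t, y). dir_deriv v (dir_deriv w g) (y + t *\<^sub>R v))"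
      by (simp add: case_prod_unfold)
  qed (use \<delta> R in auto)
  from dir_deriv_eq[OF this, of w] show ?thesis
    by simp
qed

lemma iter_deriv_rotate:
  assumes "open U" "C_on n U g" "x \<in> U" "length us < n"
  shows "iter_deriv (us @ [u]) g x = iter_deriv (u # us) g x"
  using assms(3,4)
proof (induction us arbitrary: x)
  case (Cons a us)
  have "C_on 2 U (iter_deriv us g)"
    using assms(2) Cons.prems by (intro C_on_iter_deriv C_on_mono[OF assms(2)]) auto
  then have "dir_deriv a (dir_deriv u (iter_deriv us g)) x = dir_deriv u (dir_deriv a (iter_deriv us g)) x"
    by (rule dir_deriv_commute[OF assms(1) _ Cons.prems(1)])
  moreover have "dir_deriv a (iter_deriv (us @ [u]) g) x = dir_deriv a (iter_deriv (u # us) g) x"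
    using Cons by (intro dir_deriv_cong_open[OF assms(1)]) auto
  ultimately show ?case
    by (simp add: iter_deriv_Cons)
qed simp

text \<open>A letter of the word can be brought to the front by \<open>iter_deriv_rotate\<close>,
  and induction treats the rest. This makes bounds on sorted words as good as bounds on all
  words.\<close>

lemma iter_deriv_perm:
  assumes "open U" "C_on n U g" "x \<in> U" "length us \<le> n" "mset us = mset us'"
  shows "iter_deriv us g x = iter_deriv us' g x"
  using assms(3-)
proof (induction us arbitrary: us' x)
  case (Cons a us)
  then have "a \<in> set us'"
    by (metis list.set_intros(1) mset_eq_setD)
  then obtain p q where us': "us' = p @ a # q"
    by (meson split_list)
  then have m: "mset us = mset (p @ q)"
    using Cons.prems(3) by simp
  then have len: "length us = length p + length q"
    by (metis length_append mset_eq_length)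
  have "iter_deriv us' g x = iter_deriv (p @ [a]) (iter_deriv q g) x"
    by (simp add: us' iter_deriv_append iter_deriv_Cons)
  also have "\<dots> = iter_deriv (a # p) (iter_deriv q g) x"
    using Cons.prems(2) len assms(2)
    by (intro iter_deriv_rotate[OF assms(1) C_on_iter_deriv[of "n - length q"] Cons.prems(1)])
      (auto intro: C_on_mono)
  also have "\<dots> = dir_deriv a (iter_deriv (p @ q) g) x"
    by (simp add: iter_deriv_append iter_deriv_Cons)
  also have "\<dots> = dir_deriv a (iter_deriv us g) x"
    using Cons.IH[OF _ _ m] Cons.prems(2) by (intro dir_deriv_cong_open[OF assms(1) Cons.prems(1)]) auto
  finally show ?case
    by (simp add: iter_deriv_Cons)
qed simp

section \<open>From separate regularity in parameter and phase to joint regularity\<close>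

subsection \<open>Families as functions on the product\<close>

lemma iter_deriv_slice_snd:
  assumes "open W" "C_on n W G" "length ws \<le> n" "(p, z) \<in> W"
  shows "iter_deriv ws (\<lambda>z. G (p, z)) z = iter_deriv (map (Pair 0) ws) G (p, z)"
  using assms(3,4)
proof (induction ws arbitrary: z)
  case (Cons w ws)
  have o: "open {z. (p, z) \<in> W}"
    using open_vimage[OF assms(1), of "Pair p"] by (simp add: vimage_def continuous_on_Pair)
  have "iter_deriv (map (Pair 0) ws) G differentiable (at (p, z))"
    using assms(2) Cons.prems by (auto simp: C_on_def)
  moreover have "((\<lambda>z. (p, z)) has_derivative (\<lambda>h. (0, h))) (at z)"
    by (auto intro!: derivative_eq_intros)
  ultimately have "((\<lambda>z. iter_deriv (map (Pair 0) ws) G (p, z)) has_derivative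
      (\<lambda>h. dir_deriv (0, h) (iter_deriv (map (Pair 0) ws) G) (p, z))) (at z)"
    using has_derivative_compose[OF _ has_derivative_dir_deriv] by fast
  then have "dir_deriv w (\<lambda>z. iter_deriv (map (Pair 0) ws) G (p, z)) z
      = dir_deriv (0, w) (iter_deriv (map (Pair 0) ws) G) (p, z)"
    by (rule dir_deriv_eq)
  moreover have "dir_deriv w (iter_deriv ws (\<lambda>z. G (p, z))) z
      = dir_deriv w (\<lambda>z. iter_deriv (map (Pair 0) ws) G (p, z)) z"
    using Cons by (intro dir_deriv_cong_open[OF o]) auto
  ultimately show ?case
    by (simp add: iter_deriv_Cons)
qed simp

lemma iter_deriv_slice_fst:
  assumes "open W" "C_on n W G" "length vs \<le> n" "(p, z) \<in> W"
  shows "iter_deriv vs (\<lambda>p. G (p, z)) p = iter_deriv (map (\<lambda>v. (v, 0)) vs) G (p, z)"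
  using assms(3,4)
proof (induction vs arbitrary: p)
  case (Cons v vs)
  let ?G = "iter_deriv (map (\<lambda>v. (v, 0)) vs) G"
  have o: "open {p. (p, z) \<in> W}"
    using open_vimage[OF assms(1), of "\<lambda>p. (p, z)"] by (simp add: vimage_def continuous_on_Pair)
  have "?G differentiable (at (p, z))"
    using assms(2) Cons.prems by (auto simp: C_on_def)
  moreover have "((\<lambda>p. (p, z)) has_derivative (\<lambda>h. (h, 0))) (at p)"
    by (auto intro!: derivative_eq_intros)
  ultimately have "((\<lambda>p. ?G (p, z)) has_derivative (\<lambda>h. dir_deriv (h, 0) ?G (p, z))) (at p)"
    using has_derivative_compose[OF _ has_derivative_dir_deriv] by fast
  then have "dir_deriv v (\<lambda>p. ?G (p, z)) p = dir_deriv (v, 0) ?G (p, z)"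
    by (rule dir_deriv_eq)
  moreover have "dir_deriv v (iter_deriv vs (\<lambda>p. G (p, z))) p = dir_deriv v (\<lambda>p. ?G (p, z)) p"
    using Cons by (intro dir_deriv_cong_open[OF o]) auto
  ultimately show ?case
    by (simp add: iter_deriv_Cons)
qed simp

text \<open>Reads a derivative of a family as one derivative on the product, phase letters
  innermost. Equality is asked for on W only, since \<open>rep_A\<close> and \<open>rep_B\<close>
  are arbitrary off their domain.\<close>

lemma fam_deriv_joint:
  assumes W: "open W" and C: "C_on n W G" and len: "length vs + length ws \<le> n" and pz: "(p, z) \<in> W"
    and eq: "\<And>q y. (q, y) \<in> W \<Longrightarrow> g q y = G (q, y)"
  shows "fam_deriv vs ws g p z = iter_deriv (map (\<lambda>v. (v, 0)) vs @ map (Pair 0) ws) G (p, z)"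
proof -
  have "iter_deriv ws (g q) z = iter_deriv (map (Pair 0) ws) G (q, z)" if "(q, z) \<in> W" for q
  proof -
    have "open {y. (q, y) \<in> W}"
      using open_vimage[OF W, of "Pair q"] by (simp add: vimage_def continuous_on_Pair)
    then have "iter_deriv ws (g q) z = iter_deriv ws (\<lambda>y. G (q, y)) z"
      by (rule iter_deriv_cong_open) (use that eq in auto)
    also have "\<dots> = iter_deriv (map (Pair 0) ws) G (q, z)"
      by (rule iter_deriv_slice_snd[OF W C _ that]) (use len in simp)
    finally show ?thesis .
  qed
  moreover have "open {q. (q, z) \<in> W}"
    using open_vimage[OF W, of "\<lambda>q. (q, z)"] by (simp add: vimage_def continuous_on_Pair)
  ultimately have "fam_deriv vs ws g p z = iter_deriv vs (\<lambda>q. iter_deriv (map (Pair 0) ws) G (q, z)) p"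
    unfolding fam_deriv_def by (intro iter_deriv_cong_open) (use pz in auto)
  also have "\<dots> = iter_deriv (map (\<lambda>v. (v, 0)) vs) (iter_deriv (map (Pair 0) ws) G) (p, z)"
    by (rule iter_deriv_slice_fst[OF W C_on_iter_deriv[of "n - length ws"]])
      (use len pz C in \<open>auto simp: C_on_mono\<close>)
  finally show ?thesis
    by (simp add: iter_deriv_append)
qed

lemma fam_deriv_Cons: "fam_deriv (v # vs) ws g p x = dir_deriv v (\<lambda>q. fam_deriv vs ws g q x) p"
  by (simp add: fam_deriv_def iter_deriv_Cons)

text \<open>\<open>C_family\<close> grants phase differentiability only before any parameter
  derivative is taken. Induction on \<open>vs\<close> pulls each parameter direction through it by
  \<open>has_derivative_swap\<close>, with t moving p along v.\<close>

lemma has_derivative_fam_deriv: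
  fixes g :: "'p::euclidean_space \<Rightarrow> 'a::euclidean_space \<Rightarrow> 'b::real_normed_vector"
  assumes F: "C_family d r P U g" and P: "open P" and U: "open U"
    and "length vs + length ws < r" "length vs \<le> d" "p \<in> P" "x \<in> U"
  shows "((\<lambda>x. fam_deriv vs ws g p x) has_derivative (\<lambda>w. fam_deriv vs (w # ws) g p x)) (at x)"
  using assms(4-)
proof (induction vs arbitrary: ws p x)
  case Nil
  then have "iter_deriv ws (g p) differentiable (at x)"
    using F by (auto simp: C_family_def)
  then show ?case
    using has_derivative_dir_deriv by (force simp: fam_deriv_def iter_deriv_Cons)
next
  case (Cons v vs)
  obtain R where R: "R > 0" "ball p R \<subseteq> P"
    using P Cons.prems by (meson open_contains_ball)
  define \<delta> where "\<delta> = R / (1 + norm v)"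
  have "1 + norm v > 0"
    by (simp add: add_pos_nonneg)
  then have \<delta>: "\<delta> > 0"
    using R(1) by (simp add: \<delta>_def)
  have inP: "p + t *\<^sub>R v \<in> P" if "\<bar>t\<bar> < \<delta>" for t
  proof -
    have "\<bar>t\<bar> * norm v \<le> \<bar>t\<bar> * (1 + norm v)"
      by (intro mult_left_mono) auto
    also have "\<dots> < R"
      using that \<open>1 + norm v > 0\<close> unfolding \<delta>_def by (simp only: pos_less_divide_eq)
    finally show ?thesis
      using R(2) by (auto simp: dist_norm subset_iff)
  qed
  have diff: "(\<lambda>q. fam_deriv vs ws' g q y) differentiable (at q)"
    if "q \<in> P" "y \<in> U" "length ws' \<le> Suc (length ws)" for q y ws'
    using F that Cons.prems by (auto simp: C_family_def)
  have "((\<lambda>x. fam_deriv (v # vs) ws g p x) has_derivative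
      (\<lambda>w. fam_deriv (v # vs) (w # ws) g (p + 0 *\<^sub>R v) x)) (at x)"
  proof (rule has_derivative_swap[where \<delta> = \<delta> and U = U and h = "\<lambda>t x. fam_deriv vs ws g (p + t *\<^sub>R v) x"
        and k = "\<lambda>t x w. fam_deriv vs (w # ws) g (p + t *\<^sub>R v) x"
        and l = "\<lambda>t x w. fam_deriv (v # vs) (w # ws) g (p + t *\<^sub>R v) x"])
    fix t y assume ty: "\<bar>t\<bar> < \<delta>" "y \<in> U"
    show "((\<lambda>y. fam_deriv vs ws g (p + t *\<^sub>R v) y) has_derivative
        (\<lambda>w. fam_deriv vs (w # ws) g (p + t *\<^sub>R v) y)) (at y)"
      using Cons.prems ty inP by (intro Cons.IH) auto
    show "((\<lambda>t. fam_deriv vs (w # ws) g (p + t *\<^sub>R v) y) has_vector_derivative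
        fam_deriv (v # vs) (w # ws) g (p + t *\<^sub>R v) y) (at t)" for w
      unfolding fam_deriv_Cons using ty inP by (intro has_vector_derivative_line diff) auto
  next
    fix y assume "y \<in> U"
    then show "((\<lambda>t. fam_deriv vs ws g (p + t *\<^sub>R v) y) has_vector_derivative
        fam_deriv (v # vs) ws g p y) (at 0)"
      using has_vector_derivative_line[of "\<lambda>q. fam_deriv vs ws g q y" p 0 v] diff[of p y ws] Cons.prems
      by (simp add: fam_deriv_Cons)
  next
    fix w
    have "continuous_on (P \<times> U) (\<lambda>(p, x). fam_deriv (v # vs) (w # ws) g p x)"
      using F Cons.prems unfolding C_family_def by simp
    moreover have "continuous_on ({-\<delta><..<\<delta>} \<times> U) (\<lambda>z. (p + fst z *\<^sub>R v, snd z))"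
      by (intro continuous_intros)
    ultimately have "continuous_on ({-\<delta><..<\<delta>} \<times> U)
        (\<lambda>z. (\<lambda>(p, x). fam_deriv (v # vs) (w # ws) g p x) (p + fst z *\<^sub>R v, snd z))"
      by (rule continuous_on_compose2) (use inP in \<open>auto simp: abs_less_iff\<close>)
    then show "continuous_on ({-\<delta><..<\<delta>} \<times> U)
        (\<lambda>(t, x). fam_deriv (v # vs) (w # ws) g (p + t *\<^sub>R v) x)"
      by (simp add: case_prod_unfold)
  qed (use \<delta> U Cons.prems in auto)
  then show ?case
    by simp
qed

lemma has_derivative_fam_deriv_joint:
  fixes g :: "'p::euclidean_space \<Rightarrow> 'a::euclidean_space \<Rightarrow> 'b::real_normed_vector"
  assumes F: "C_family d r P U g" and P: "open P" and U: "open U"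
    and len: "length vs + length ws < r" "length vs < d" and px: "p \<in> P" "x \<in> U"
  shows "((\<lambda>(p, x). fam_deriv vs ws g p x) has_derivative
    (\<lambda>(v, w). fam_deriv (v # vs) ws g p x + fam_deriv vs (w # ws) g p x)) (at (p, x))"
proof -
  obtain R where R: "R > 0" "ball x R \<subseteq> U"
    using U px by (meson open_contains_ball)
  \<comment> \<open>The theorem on partial derivatives wants the x-partial continuous in operator
    norm; in finite dimension continuity at each fixed w suffices. It also wants a convex set of x,
    hence the ball.\<close>
  define D where "D = (\<lambda>p x. Blinfun (\<lambda>w. fam_deriv vs (w # ws) g p x))"
  have D: "blinfun_apply (D q y) = (\<lambda>w. fam_deriv vs (w # ws) g q y)" if "q \<in> P" "y \<in> U" for q y
    using has_derivative_fam_deriv[OF F P U len(1) _ that] len(2)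
    by (simp add: D_def bounded_linear_Blinfun_apply has_derivative_bounded_linear)
  have o: "open (P \<times> ball x R)" "(p, x) \<in> P \<times> ball x R"
    using P px R by (auto intro: open_Times)
  have "((\<lambda>(p, x). fam_deriv vs ws g p x) has_derivative
      (\<lambda>(v, w). fam_deriv (v # vs) ws g p x + D p x w)) (at (p, x) within P \<times> ball x R)"
  proof (rule has_derivative_partialsI)
    have "(\<lambda>q. fam_deriv vs ws g q x) differentiable (at p)"
      using F px len by (auto simp: C_family_def)
    from has_derivative_dir_deriv[OF this]
    show "((\<lambda>q. fam_deriv vs ws g q x) has_derivative (\<lambda>v. fam_deriv (v # vs) ws g p x)) (at p within P)"
      by (simp add: fam_deriv_Cons has_derivative_at_withinI)
    show "((\<lambda>y. fam_deriv vs ws g q y) has_derivative blinfun_apply (D q y)) (at y within ball x R)"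
      if "q \<in> P" "y \<in> ball x R" for q y
    proof -
      have y: "y \<in> U"
        using R that by auto
      show ?thesis
        using has_derivative_at_withinI[OF has_derivative_fam_deriv[OF F P U len(1) _ that(1) y]] len(2)
        by (simp add: D[OF that(1) y])
    qed
    have "continuous_on (P \<times> ball x R) (\<lambda>z. D (fst z) (snd z))"
    proof (rule continuous_on_blinfun_componentwise)
      fix w :: 'a
      have "continuous_on (P \<times> U) (\<lambda>(p, x). fam_deriv vs (w # ws) g p x)"
        using F len unfolding C_family_def by simp
      then have "continuous_on (P \<times> ball x R) (\<lambda>(p, x). fam_deriv vs (w # ws) g p x)"
        by (rule continuous_on_subset) (use R in auto)
      then show "continuous_on (P \<times> ball x R) (\<lambda>z. blinfun_apply (D (fst z) (snd z)) w)"
        by (rule continuous_on_eq) (use D R in auto)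
    qed
    then show "continuous (at (p, x) within P \<times> ball x R) (\<lambda>(p, x). D p x)"
      using o(2) by (simp add: continuous_on_eq_continuous_within case_prod_unfold)
  qed (use R in auto)
  then show ?thesis
    using at_within_open[OF o(2,1)] px by (simp add: D)
qed

lemma C_on_fam_deriv:
  fixes P :: "'p::euclidean_space set"
  assumes F: "C_family r r P U g" and P: "open P" and U: "open U"
    and "length vs + length ws + n \<le> r"
  shows "C_on n (P \<times> U) (\<lambda>(p, x). fam_deriv vs ws g p x)"
  using assms(4)
proof (induction n arbitrary: vs ws)
  case 0
  then show ?case
    using F by (simp add: C_on_0 C_family_def)
next
  case (Suc n)
  have o: "open (P \<times> U)"
    using P U by (rule open_Times)
  show ?case
  proof (rule C_on_SucI[OF o])
    show "((\<lambda>(p, x). fam_deriv vs ws g p x) has_derivative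
        (\<lambda>u. fam_deriv (fst u # vs) ws g (fst z) (snd z) + fam_deriv vs (snd u # ws) g (fst z) (snd z)))
        (at z)" if "z \<in> P \<times> U" for z
      using has_derivative_fam_deriv_joint[OF F P U, of vs ws "fst z" "snd z"] that Suc.prems
      by (simp add: case_prod_unfold mem_Times_iff)
    show "C_on n (P \<times> U) (\<lambda>z. fam_deriv (fst u # vs) ws g (fst z) (snd z)
        + fam_deriv vs (snd u # ws) g (fst z) (snd z))" for u
      using Suc.IH[of "fst u # vs" ws] Suc.IH[of vs "snd u # ws"] Suc.prems
      by (intro C_on_add[OF o]) (auto simp: case_prod_unfold)
  qed
qed

lemma C_family_imp_C_on:
  fixes P :: "'p::euclidean_space set"
  assumes "C_family r r P U g" "open P" "open U"
  shows "C_on r (P \<times> U) (\<lambda>(p, x). g p x)"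
  using C_on_fam_deriv[OF assms, of "[]" "[]" r] by (simp add: fam_deriv_def)


section \<open>Leibniz and chain rules with explicit constants\<close>

section \<open>Estimates for compositions\<close>

subsection \<open>The Leibniz rule\<close>

text \<open>Distributes the letters over two factors by position, so that repeated directions are
  counted correctly and the order within each factor is kept.\<close>

primrec splits :: "'a list \<Rightarrow> ('a list \<times> 'a list) list" where
  "splits [] = [([], [])]"
| "splits (u # us) =
     map (\<lambda>(s, t). (u # s, t)) (splits us) @ map (\<lambda>(s, t). (s, u # t)) (splits us)"

lemma length_splits: "length (splits us) = 2 ^ length us"
  by (induction us) auto

lemma mset_splits: "(s, t) \<in> set (splits us) \<Longrightarrow> mset s + mset t = mset us"
  by (induction us arbitrary: s t) auto

lemma splits_last: "\<exists>L. splits us = L @ [([], us)] \<and> (\<forall>(s, t)\<in>set L. s \<noteq> [])"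
proof (induction us)
  case (Cons u us)
  then obtain L where L: "splits us = L @ [([], us)]" "\<forall>(s, t)\<in>set L. s \<noteq> []"
    by blast
  show ?case
    by (rule exI[of _ "map (\<lambda>(s, t). (u # s, t)) (splits us) @ map (\<lambda>(s, t). (s, u # t)) L"])
      (use L in auto)
qed simp

lemma has_derivative_sum_list:
  assumes "\<And>i. i \<in> set L \<Longrightarrow> (f i has_derivative f' i) F"
  shows "((\<lambda>x. \<Sum>i\<leftarrow>L. f i x) has_derivative (\<lambda>h. \<Sum>i\<leftarrow>L. f' i h)) F"
  using assms by (induction L) (auto intro!: has_derivative_add)

lemma iter_deriv_mult:
  fixes g h :: "'a::euclidean_space \<Rightarrow> real"
  assumes "open U" "C_on n U g" "C_on n U h" "length us \<le> n" "x \<in> U"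
  shows "iter_deriv us (\<lambda>x. g x * h x) x
    = (\<Sum>(s, t)\<leftarrow>splits us. iter_deriv s g x * iter_deriv t h x)"
  using assms(4,5)
proof (induction us arbitrary: x)
  case (Cons u us)
  have len: "length s + length t < n" if "(s, t) \<in> set (splits us)" for s t
    using mset_splits[OF that] Cons.prems(1) by (metis Suc_le_lessD length_Cons size_mset size_union)
  have "((\<lambda>x. \<Sum>i\<leftarrow>splits us. iter_deriv (fst i) g x * iter_deriv (snd i) h x) has_derivative
      (\<lambda>w. \<Sum>i\<leftarrow>splits us. iter_deriv (fst i) g x * dir_deriv w (iter_deriv (snd i) h) x
        + dir_deriv w (iter_deriv (fst i) g) x * iter_deriv (snd i) h x)) (at x)"
  proof (intro has_derivative_sum_list has_derivative_mult has_derivative_dir_deriv)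
    fix i assume "i \<in> set (splits us)"
    then have "length (fst i) < n" "length (snd i) < n"
      using len[of "fst i" "snd i"] by auto
    then show "iter_deriv (fst i) g differentiable (at x)" "iter_deriv (snd i) h differentiable (at x)"
      using assms(2,3) Cons.prems by (auto simp: C_on_def)
  qed
  from dir_deriv_eq[OF this]
  have "dir_deriv u (\<lambda>x. \<Sum>(s, t)\<leftarrow>splits us. iter_deriv s g x * iter_deriv t h x) x
      = (\<Sum>i\<leftarrow>splits us. iter_deriv (fst i) g x * dir_deriv u (iter_deriv (snd i) h) x
        + dir_deriv u (iter_deriv (fst i) g) x * iter_deriv (snd i) h x)"
    by (simp add: case_prod_unfold)
  also have "\<dots> = (\<Sum>(s, t)\<leftarrow>splits (u # us). iter_deriv s g x * iter_deriv t h x)"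
    by (simp add: case_prod_unfold o_def iter_deriv_Cons sum_list_addf)
  also have "dir_deriv u (\<lambda>x. \<Sum>(s, t)\<leftarrow>splits us. iter_deriv s g x * iter_deriv t h x) x
      = dir_deriv u (iter_deriv us (\<lambda>x. g x * h x)) x"
    using Cons by (intro dir_deriv_cong_open[OF assms(1)]) auto
  finally show ?case
    by (simp add: iter_deriv_Cons)
qed simp

lemma abs_sum_list_le:
  fixes f :: "'i \<Rightarrow> real"
  assumes "\<And>i. i \<in> set L \<Longrightarrow> \<bar>f i\<bar> \<le> M"
  shows "\<bar>\<Sum>i\<leftarrow>L. f i\<bar> \<le> real (length L) * M"
  using assms
proof (induction L)
  case (Cons a L)
  then have "\<bar>f a\<bar> \<le> M" "\<bar>\<Sum>i\<leftarrow>L. f i\<bar> \<le> real (length L) * M"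
    by auto
  then show ?case
    by (simp add: algebra_simps)
qed simp

lemma iter_deriv_mult_bound:
  fixes g h :: "'a::euclidean_space \<Rightarrow> real"
  assumes "open U" "C_on n U g" "C_on n U h" "length us \<le> n" "x \<in> U"
    and M: "\<And>s t. (s, t) \<in> set (splits us) \<Longrightarrow> \<bar>iter_deriv s g x * iter_deriv t h x\<bar> \<le> M"
  shows "\<bar>iter_deriv us (\<lambda>x. g x * h x) x\<bar> \<le> 2 ^ length us * M"
  unfolding iter_deriv_mult[OF assms(1-5)]
  using abs_sum_list_le[of "splits us" "\<lambda>(s, t). iter_deriv s g x * iter_deriv t h x" M] M
  by (auto simp: length_splits)

text \<open>The subtracted term, the last one in \<open>splits us\<close>, has the whole word on
  \<open>h\<close>. Every other term leaves a letter on \<open>g\<close>, hence fewer on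
  \<open>h\<close>.\<close>

lemma iter_deriv_mult_remainder:
  fixes g h :: "'a::euclidean_space \<Rightarrow> real"
  assumes "open U" "C_on n U g" "C_on n U h" "length us \<le> n" "x \<in> U" "0 \<le> M"
    and M: "\<And>s t. (s, t) \<in> set (splits us) \<Longrightarrow> s \<noteq> [] \<Longrightarrow> \<bar>iter_deriv s g x * iter_deriv t h x\<bar> \<le> M"
  shows "\<bar>iter_deriv us (\<lambda>x. g x * h x) x - g x * iter_deriv us h x\<bar> \<le> 2 ^ length us * M"
proof -
  obtain L where L: "splits us = L @ [([], us)]" "\<forall>(s, t)\<in>set L. s \<noteq> []"
    using splits_last by blast
  have "\<bar>\<Sum>(s, t)\<leftarrow>L. iter_deriv s g x * iter_deriv t h x\<bar> \<le> real (length L) * M"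
    by (rule abs_sum_list_le) (use L M in auto)
  also have "\<dots> \<le> real (length (splits us)) * M"
    using assms(6) by (intro mult_right_mono) (simp_all add: L(1))
  also have "\<dots> = 2 ^ length us * M"
    by (simp add: length_splits)
  finally show ?thesis
    unfolding iter_deriv_mult[OF assms(1-5)] by (simp add: L(1))
qed


subsection \<open>Words of parameter and phase directions\<close>

text \<open>The words that test a C^{d,n}-norm, with letters in any order. A zero letter counts as a
  phase letter and costs nothing in \<open>d\<close>.\<close>

definition admissible ::
  "nat \<Rightarrow> nat \<Rightarrow> ('p::euclidean_space \<times> 'z::euclidean_space) list \<Rightarrow> bool" where
  "admissible d n us \<longleftrightarrow> length us \<le> n \<and> length (filter (\<lambda>u. fst u \<noteq> 0) us) \<le> d \<and>
     (\<forall>u\<in>set us. norm u \<le> 1 \<and> (fst u = 0 \<or> snd u = 0))"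

text \<open>A single phase letter is enough for decay; \<mu> will be \<open>\<theta> ^ k\<close>.
  Purely parametric derivatives stay bounded but need not shrink.\<close>

definition weight :: "real \<Rightarrow> ('p::euclidean_space \<times> 'z::euclidean_space) list \<Rightarrow> real" where
  "weight \<mu> us = (if \<exists>u\<in>set us. fst u = 0 then \<mu> else 1)"

lemma admissible_Nil [simp]: "admissible d n []"
  by (simp add: admissible_def)

lemma admissible_mono: "admissible d n us \<Longrightarrow> d \<le> d' \<Longrightarrow> n \<le> n' \<Longrightarrow> admissible d' n' us"
  by (auto simp: admissible_def)

lemma admissible_length: "admissible d n us \<Longrightarrow> length us \<le> m \<Longrightarrow> admissible d m us"
  by (simp add: admissible_def)

lemma admissible_snoc:
  "admissible d (Suc n) (us @ [u]) \<longleftrightarrow>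
     norm u \<le> 1 \<and> (if fst u = 0 then admissible d n us else snd u = 0 \<and> 0 < d \<and> admissible (d - 1) n us)"
  by (auto simp: admissible_def)

lemma admissible_splits:
  assumes "(s, t) \<in> set (splits us)" "admissible d n us"
  shows "admissible d n s" "admissible d n t"
proof -
  have m: "mset us = mset s + mset t"
    using mset_splits[OF assms(1)] by simp
  have "length us = length s + length t"
    by (metis m size_mset size_union)
  moreover have "set us = set s \<union> set t"
    by (metis m set_mset_mset set_mset_union)
  moreover have "length (filter P us) = length (filter P s) + length (filter P t)" for P
    by (metis m filter_union_mset mset_filter size_mset size_union)
  ultimately show "admissible d n s" "admissible d n t"
    using assms(2) by (auto simp: admissible_def)
qed

lemma weight_Nil [simp]: "weight \<mu> [] = 1"
  by (simp add: weight_def)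

lemma weight_nonneg: "0 \<le> \<mu> \<Longrightarrow> 0 \<le> weight \<mu> us"
  by (simp add: weight_def)

lemma weight_le_1: "\<mu> \<le> 1 \<Longrightarrow> weight \<mu> us \<le> 1"
  by (simp add: weight_def)

text \<open>A phase letter of \<open>us\<close> lands in \<open>s\<close> or in \<open>t\<close> and
  supplies the factor \<mu> there; the other weight is at most 1.\<close>

lemma weight_mult_le:
  assumes "0 \<le> \<mu>" "\<mu> \<le> 1" "set us \<subseteq> set s \<union> set t"
  shows "weight \<mu> s * weight \<mu> t \<le> weight \<mu> us"
  using assms by (auto simp: weight_def mult_le_one mult_left_le_one_le)

lemma set_splits: "(s, t) \<in> set (splits us) \<Longrightarrow> set us = set s \<union> set t"
  by (metis mset_splits set_mset_mset set_mset_union)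

lemma length_splits_le: "(s, t) \<in> set (splits us) \<Longrightarrow> length s + length t = length us"
  by (metis mset_splits size_mset size_union)


subsection \<open>Functions of the parameter and one phase coordinate\<close>

text \<open>Stated through derivatives because slices of V need not be connected: \<phi> is not
  claimed to be a function of p and \<open>z \<bullet> q\<close> alone.\<close>

definition depends ::
  "nat \<Rightarrow> 'z::euclidean_space \<Rightarrow> ('p::euclidean_space \<times> 'z) set \<Rightarrow> ('p \<times> 'z \<Rightarrow> real) \<Rightarrow> bool" where
  "depends n q V \<phi> \<longleftrightarrow> C_on n V \<phi> \<and>
     (\<forall>\<beta> w. length \<beta> < n \<longrightarrow> w \<bullet> q = 0 \<longrightarrow> (\<forall>e\<in>V. dir_deriv (0, w) (iter_deriv \<beta> \<phi>) e = 0))"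

lemma dependsI:
  assumes V: "open V" and C: "C_on n V \<phi>"
    and z: "\<And>w e. 0 < n \<Longrightarrow> w \<bullet> q = 0 \<Longrightarrow> e \<in> V \<Longrightarrow> dir_deriv (0, w) \<phi> e = 0"
  shows "depends n q V \<phi>"
  unfolding depends_def
proof (intro conjI allI impI ballI C)
  fix \<beta> :: "('a \<times> 'b) list" and w e
  assume \<beta>: "length \<beta> < n" and w: "w \<bullet> q = 0" and e: "e \<in> V"
  have "dir_deriv (0, w) (iter_deriv \<beta> \<phi>) e = iter_deriv (\<beta> @ [(0, w)]) \<phi> e"
    using iter_deriv_rotate[OF V C e \<beta>] by (simp add: iter_deriv_Cons)
  also have "\<dots> = iter_deriv \<beta> (\<lambda>_. 0) e"
    unfolding iter_deriv_snoc using z w \<beta> by (intro iter_deriv_cong_open[OF V e]) auto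
  finally show "dir_deriv (0, w) (iter_deriv \<beta> \<phi>) e = 0"
    by (simp add: iter_deriv_zero)
qed

lemma depends_dir_deriv: "depends (Suc n) q V \<phi> \<Longrightarrow> depends n q V (dir_deriv u \<phi>)"
  unfolding depends_def by (simp add: C_on_dir_deriv flip: iter_deriv_snoc)

lemma depends_mono: "depends n q V \<phi> \<Longrightarrow> m \<le> n \<Longrightarrow> depends m q V \<phi>"
  unfolding depends_def using C_on_mono by auto

lemma dir_deriv_depends:
  assumes "depends n q V \<phi>" "0 < n" "q \<bullet> q = 1" "e \<in> V"
  shows "dir_deriv (v, w) \<phi> e = dir_deriv (v, 0) \<phi> e + (w \<bullet> q) * dir_deriv (0, q) \<phi> e"
proof -
  have "\<phi> differentiable (at e)"
    using assms by (auto simp: depends_def C_on_imp_differentiable)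
  then interpret linear "\<lambda>u. dir_deriv u \<phi> e"
    by (rule dir_deriv_linear)
  have "(v, w) = (v, 0) + (w \<bullet> q) *\<^sub>R (0, q) + (0, w - (w \<bullet> q) *\<^sub>R q)"
    by simp
  then have "dir_deriv (v, w) \<phi> e = dir_deriv (v, 0) \<phi> e + (w \<bullet> q) * dir_deriv (0, q) \<phi> e
      + dir_deriv (0, w - (w \<bullet> q) *\<^sub>R q) \<phi> e"
    by (metis add scaleR real_scaleR_def)
  moreover have "(w - (w \<bullet> q) *\<^sub>R q) \<bullet> q = 0"
    using assms(3) by (simp add: inner_diff_left)
  then have "dir_deriv (0, w - (w \<bullet> q) *\<^sub>R q) (iter_deriv [] \<phi>) e = 0"
    using assms unfolding depends_def by (metis list.size(3))
  ultimately show ?thesis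
    by simp
qed

text \<open>\<open>H\<close> lifts (p, T) to the full product; its phase coordinates orthogonal to
  \<open>q\<close> are left free.\<close>

definition lifts ::
  "('p::euclidean_space \<times> 'z::euclidean_space) set \<Rightarrow> ('p \<times> 'z) set \<Rightarrow> 'z \<Rightarrow>
   ('p \<times> 'z \<Rightarrow> 'p \<times> 'z) \<Rightarrow> ('p \<times> 'z \<Rightarrow> real) \<Rightarrow> bool" where
  "lifts W V q H T \<longleftrightarrow> H ` W \<subseteq> V \<and>
     (\<forall>e\<in>W. H differentiable (at e) \<and> fst (H e) = fst e \<and> snd (H e) \<bullet> q = T e)"

lemma dir_deriv_lifts:
  assumes W: "open W" and L: "lifts W V q H T" and e: "e \<in> W"
  shows "fst (dir_deriv u H e) = fst u" "snd (dir_deriv u H e) \<bullet> q = dir_deriv u T e"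
proof -
  have D: "(H has_derivative (\<lambda>u. dir_deriv u H e)) (at e)"
    using L e by (auto simp: lifts_def intro: has_derivative_dir_deriv)
  have "dir_deriv u (\<lambda>e. fst (H e)) e = fst (dir_deriv u H e)"
    by (intro dir_deriv_eq has_derivative_fst D)
  moreover have "dir_deriv u (\<lambda>e. fst (H e)) e = dir_deriv u fst e"
    using L by (intro dir_deriv_cong_open[OF W e]) (auto simp: lifts_def)
  moreover have "dir_deriv u fst e = fst u"
    by (intro dir_deriv_eq bounded_linear_imp_has_derivative bounded_linear_fst)
  ultimately show "fst (dir_deriv u H e) = fst u"
    by simp
  have "dir_deriv u (\<lambda>e. snd (H e) \<bullet> q) e = snd (dir_deriv u H e) \<bullet> q"
    by (intro dir_deriv_eq has_derivative_inner_left has_derivative_snd D)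
  moreover have "dir_deriv u (\<lambda>e. snd (H e) \<bullet> q) e = dir_deriv u T e"
    using L by (intro dir_deriv_cong_open[OF W e]) (auto simp: lifts_def)
  ultimately show "snd (dir_deriv u H e) \<bullet> q = dir_deriv u T e"
    by simp
qed

text \<open>The free coordinates of \<open>H\<close> drop out, because \<phi> does not see
  directions orthogonal to \<open>q\<close>. What remains is the chain rule of \<phi>(p, T).\<close>

lemma dir_deriv_compose_lifts:
  assumes W: "open W" and L: "lifts W V q H T" and e: "e \<in> W"
    and \<phi>: "depends n q V \<phi>" "0 < n" "q \<bullet> q = 1"
  shows "dir_deriv u (\<lambda>e. \<phi> (H e)) e
    = dir_deriv (fst u, 0) \<phi> (H e) + dir_deriv (0, q) \<phi> (H e) * dir_deriv u T e"
proof -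
  have "H e \<in> V" "H differentiable (at e)"
    using L e by (auto simp: lifts_def)
  then have "dir_deriv u (\<lambda>e. \<phi> (H e)) e = dir_deriv (dir_deriv u H e) \<phi> (H e)"
    using \<phi> by (intro dir_deriv_compose) (auto simp: depends_def C_on_imp_differentiable)
  also have "\<dots> = dir_deriv (fst (dir_deriv u H e), snd (dir_deriv u H e)) \<phi> (H e)"
    by simp
  also have "\<dots> = dir_deriv (fst u, 0) \<phi> (H e) + dir_deriv u T e * dir_deriv (0, q) \<phi> (H e)"
    by (subst dir_deriv_depends[OF \<phi> \<open>H e \<in> V\<close>]) (simp only: dir_deriv_lifts[OF W L e])
  finally show ?thesis
    by (simp only: mult.commute)
qed


subsection \<open>Derivatives of compositions\<close>

definition controlled ::
  "nat \<Rightarrow> nat \<Rightarrow> real \<Rightarrow> 'z::euclidean_space \<Rightarrow> ('p::euclidean_space \<times> 'z) set \<Rightarrow>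
   ('p \<times> 'z \<Rightarrow> real) \<Rightarrow> bool" where
  "controlled d n K q V \<phi> \<longleftrightarrow> depends n q V \<phi> \<and>
     (\<forall>\<beta> e. admissible d n \<beta> \<longrightarrow> e \<in> V \<longrightarrow> \<bar>iter_deriv \<beta> \<phi> e\<bar> \<le> K)"

text \<open>The empty word is excluded: a tower starts from a phase coordinate, whose values have no
  bound in terms of the constants.\<close>

definition tame_derivs ::
  "nat \<Rightarrow> nat \<Rightarrow> real \<Rightarrow> real \<Rightarrow> ('p::euclidean_space \<times> 'z::euclidean_space) set \<Rightarrow>
   ('p \<times> 'z \<Rightarrow> real) \<Rightarrow> bool" where
  "tame_derivs d n M \<mu> W T \<longleftrightarrow>
     (\<forall>us e. admissible d n us \<longrightarrow> us \<noteq> [] \<longrightarrow> e \<in> W \<longrightarrow> \<bar>iter_deriv us T e\<bar> \<le> M * weight \<mu> us)"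

lemma tame_derivs_mono:
  "tame_derivs d n M \<mu> W T \<Longrightarrow> d' \<le> d \<Longrightarrow> n' \<le> n \<Longrightarrow> tame_derivs d' n' M \<mu> W T"
  unfolding tame_derivs_def using admissible_mono by blast

lemma controlledD:
  "controlled d n K q V \<phi> \<Longrightarrow> admissible d n \<beta> \<Longrightarrow> e \<in> V \<Longrightarrow> \<bar>iter_deriv \<beta> \<phi> e\<bar> \<le> K"
  unfolding controlled_def by blast

lemma tame_derivsD:
  "tame_derivs d n M \<mu> W T \<Longrightarrow> admissible d n us \<Longrightarrow> us \<noteq> [] \<Longrightarrow> e \<in> W \<Longrightarrow>
    \<bar>iter_deriv us T e\<bar> \<le> M * weight \<mu> us"
  unfolding tame_derivs_def by blast

lemma controlled_mono:
  "controlled d n K q V \<phi> \<Longrightarrow> d' \<le> d \<Longrightarrow> n' \<le> n \<Longrightarrow> controlled d' n' K q V \<phi>"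
  unfolding controlled_def using admissible_mono depends_mono by blast

lemma controlled_param:
  assumes "controlled d (Suc n) K q V \<phi>" "norm v \<le> 1" "v \<noteq> 0" "0 < d"
  shows "controlled (d - 1) n K q V (dir_deriv (v, 0) \<phi>)"
proof -
  have "admissible d (Suc n) (\<beta> @ [(v, 0)])" if "admissible (d - 1) n \<beta>" for \<beta> :: "('b \<times> 'a) list"
    using that assms(2-4) by (simp add: admissible_snoc)
  then show ?thesis
    using assms(1) depends_dir_deriv unfolding controlled_def by (auto simp flip: iter_deriv_snoc)
qed

lemma controlled_phase:
  assumes "controlled d (Suc n) K q V \<phi>" "q \<bullet> q = 1"
  shows "controlled d n K q V (dir_deriv (0, q) \<phi>)"
proof -
  have "norm q = 1"
    using assms(2) by (simp add: norm_eq_sqrt_inner)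
  then have "admissible d (Suc n) (\<beta> @ [(0, q)])" if "admissible d n \<beta>" for \<beta> :: "('b \<times> 'a) list"
    using that by (simp add: admissible_snoc)
  then show ?thesis
    using assms(1) depends_dir_deriv unfolding controlled_def by (auto simp flip: iter_deriv_snoc)
qed

text \<open>Common step of the bound and of the remainder below. The letter \<open>u\<close> is
  spent on the chain rule, then Leibniz distributes \<open>us\<close>; apart from the subtracted
  term at most \<open>length us\<close> letters meet \<open>T\<close>. The derivatives of \<phi>
  along \<open>H\<close> enter as hypotheses, to be supplied by induction on the order.\<close>

lemma iter_deriv_compose_step:
  assumes W: "open W" and V: "open V" and L: "lifts W V q H T" and q: "q \<bullet> q = 1"
    and CH: "C_on (Suc n) W H" and CT: "C_on (Suc n) W T" and \<phi>: "depends (Suc n) q V \<phi>"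
    and T: "tame_derivs d (length us) M \<mu> W T"
    and \<mu>: "0 \<le> \<mu>" "\<mu> \<le> 1" and MC: "0 \<le> M" "0 \<le> C"
    and adm: "admissible d (Suc n) (us @ [u])" and e: "e \<in> W"
    and param: "fst u \<noteq> 0 \<Longrightarrow> \<bar>iter_deriv us (\<lambda>e. dir_deriv (fst u, 0) \<phi> (H e)) e\<bar> \<le> C * weight \<mu> us"
    and phase: "\<And>t. admissible d n t \<Longrightarrow>
      \<bar>iter_deriv t (\<lambda>e. dir_deriv (0, q) \<phi> (H e)) e\<bar> \<le> C * weight \<mu> t"
  shows "\<bar>iter_deriv (us @ [u]) (\<lambda>e. \<phi> (H e)) e - dir_deriv (0, q) \<phi> (H e) * iter_deriv (us @ [u]) T e\<bar>
    \<le> (1 + 2 ^ n * M) * C * weight \<mu> (us @ [u])"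
proof -
  let ?w = "weight \<mu> (us @ [u])"
  have w0: "0 \<le> ?w"
    by (rule weight_nonneg[OF \<mu>(1)])
  have len: "length us \<le> n" and admus: "admissible d n us"
    using adm by (auto simp: admissible_def)
  have comp: "C_on n W (\<lambda>e. dir_deriv v \<phi> (H e))" for v
  proof (rule C_on_compose[OF W V])
    show "C_on n V (dir_deriv v \<phi>)"
      using depends_dir_deriv[OF \<phi>, of v] by (simp add: depends_def)
    show "C_on n W H"
      by (rule C_on_mono[OF CH]) simp
    show "H ` W \<subseteq> V"
      using L by (simp add: lifts_def)
  qed
  have CdT: "C_on n W (dir_deriv u T)"
    by (rule C_on_dir_deriv[OF CT])
  have "iter_deriv (us @ [u]) (\<lambda>e. \<phi> (H e)) e
      = iter_deriv us (\<lambda>e. dir_deriv (fst u, 0) \<phi> (H e) + dir_deriv (0, q) \<phi> (H e) * dir_deriv u T e) e"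
    unfolding iter_deriv_snoc
    using dir_deriv_compose_lifts[OF W L _ \<phi> _ q] by (intro iter_deriv_cong_open[OF W e]) auto
  also have "\<dots> = iter_deriv us (\<lambda>e. dir_deriv (fst u, 0) \<phi> (H e)) e
      + iter_deriv us (\<lambda>e. dir_deriv (0, q) \<phi> (H e) * dir_deriv u T e) e"
    by (intro iter_deriv_add[OF W _ _ len e] comp C_on_mult[OF W] CdT)
  finally have split: "iter_deriv (us @ [u]) (\<lambda>e. \<phi> (H e)) e = \<dots>" .
  \<comment> \<open>A phase letter has \<open>fst u = 0\<close> and kills this term; a parameter
    letter does not change the weight.\<close>
  have first: "\<bar>iter_deriv us (\<lambda>e. dir_deriv (fst u, 0) \<phi> (H e)) e\<bar> \<le> C * ?w"
  proof (cases "fst u = 0")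
    case True
    have HV: "H y \<in> V" if "y \<in> W" for y
      using L that by (auto simp: lifts_def)
    have zero: "dir_deriv 0 \<phi> y = 0" if "y \<in> V" for y
      using linear_0[OF dir_deriv_linear[of \<phi> y]] \<phi> that
      by (simp add: depends_def C_on_imp_differentiable[of "Suc n" V \<phi>])
    have "iter_deriv us (\<lambda>e. dir_deriv (fst u, 0) \<phi> (H e)) e = iter_deriv us (\<lambda>_. 0) e"
      by (rule iter_deriv_cong_open[OF W e]) (simp add: True zero[OF HV] flip: zero_prod_def)
    then show ?thesis
      using mult_nonneg_nonneg[OF MC(2) w0] by (simp add: iter_deriv_zero)
  next
    case False
    then have "?w = weight \<mu> us"
      by (simp add: weight_def)
    with param[OF False] show ?thesis
      by simp
  qed
  have "\<bar>iter_deriv us (\<lambda>e. dir_deriv (0, q) \<phi> (H e) * dir_deriv u T e) e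
      - dir_deriv (0, q) \<phi> (H e) * iter_deriv us (dir_deriv u T) e\<bar> \<le> 2 ^ length us * (C * M * ?w)"
  proof (rule iter_deriv_mult_remainder[OF W comp CdT len e])
    show "0 \<le> C * M * ?w"
      using MC w0 by simp
    fix s t assume st: "(s, t) \<in> set (splits us)" "s \<noteq> []"
    have "length t < length us"
      using length_splits_le[OF st(1)] st(2) by (cases s) auto
    then obtain l where l: "length us = Suc l" "length t \<le> l"
      by (cases "length us") auto
    have "admissible d' l t" if "admissible d' n us" for d'
      using admissible_length[OF admissible_splits(2)[OF st(1) that] l(2)] .
    then have "admissible d (length us) (t @ [u])"
      using adm unfolding l(1) admissible_snoc by (auto split: if_splits)
    then have "\<bar>iter_deriv (t @ [u]) T e\<bar> \<le> M * weight \<mu> (t @ [u])"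
      using T e unfolding tame_derivs_def by blast
    moreover have "\<bar>iter_deriv s (\<lambda>e. dir_deriv (0, q) \<phi> (H e)) e\<bar> \<le> C * weight \<mu> s"
      using phase admissible_splits[OF st(1) admus] by blast
    ultimately have "\<bar>iter_deriv s (\<lambda>e. dir_deriv (0, q) \<phi> (H e)) e\<bar> * \<bar>iter_deriv t (dir_deriv u T) e\<bar>
        \<le> (C * weight \<mu> s) * (M * weight \<mu> (t @ [u]))"
      using MC weight_nonneg[OF \<mu>(1), of s] by (intro mult_mono) (auto simp: iter_deriv_snoc)
    also have "\<dots> = C * M * (weight \<mu> s * weight \<mu> (t @ [u]))"
      by simp
    also have "\<dots> \<le> C * M * ?w"
      using MC set_splits[OF st(1)] by (intro mult_left_mono weight_mult_le[OF \<mu>]) auto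
    finally show "\<bar>iter_deriv s (\<lambda>e. dir_deriv (0, q) \<phi> (H e)) e * iter_deriv t (dir_deriv u T) e\<bar> \<le> C * M * ?w"
      by (simp add: abs_mult)
  qed
  also have "\<dots> \<le> 2 ^ n * (C * M * ?w)"
    using len MC w0 by (intro mult_right_mono power_increasing) auto
  finally have "\<bar>iter_deriv us (\<lambda>e. dir_deriv (0, q) \<phi> (H e) * dir_deriv u T e) e
      - dir_deriv (0, q) \<phi> (H e) * iter_deriv (us @ [u]) T e\<bar> \<le> 2 ^ n * (C * M * ?w)"
    by (simp only: iter_deriv_snoc)
  moreover have "(1 + 2 ^ n * M) * C * ?w = C * ?w + 2 ^ n * (C * M * ?w)"
    by (simp add: algebra_simps)
  ultimately show ?thesis
    using first unfolding split by linarith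
qed

text \<open>\<open>K * M\<close> bounds the term with every letter on \<open>T\<close>; the rest is
  the estimate of \<open>iter_deriv_compose_step\<close>, where \<open>2 ^ n\<close> counts Leibniz
  terms.\<close>

primrec comp_const :: "nat \<Rightarrow> real \<Rightarrow> real \<Rightarrow> real" where
  "comp_const 0 K M = K"
| "comp_const (Suc n) K M = K * M + (1 + 2 ^ n * M) * comp_const n K M"

lemma comp_const_nonneg: "0 \<le> K \<Longrightarrow> 0 \<le> M \<Longrightarrow> 0 \<le> comp_const n K M"
  by (induction n) auto

lemma comp_const_ge: "0 \<le> K \<Longrightarrow> 0 \<le> M \<Longrightarrow> K \<le> comp_const n K M"
proof (induction n)
  case (Suc n)
  have "1 * comp_const n K M \<le> (1 + 2 ^ n * M) * comp_const n K M"
    using Suc comp_const_nonneg by (intro mult_right_mono) auto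
  moreover have "0 \<le> K * M" "K \<le> comp_const n K M"
    using Suc by simp_all
  ultimately show ?case
    unfolding comp_const.simps by linarith
qed simp

text \<open>Induction on the order with \<open>d\<close> and \<phi> free: a parameter letter
  replaces them by \<open>d - 1\<close> and a parameter derivative of \<phi>, whereas the factor in
  front of the derivative of \<open>T\<close> keeps \<open>d\<close> and passes to the derivative
  along \<open>q\<close>.\<close>

lemma iter_deriv_compose_bound:
  assumes W: "open W" and V: "open V" and L: "lifts W V q H T" and q: "q \<bullet> q = 1"
    and \<mu>: "0 \<le> \<mu>" "\<mu> \<le> 1" and KM: "0 \<le> K" "0 \<le> M"
    and "C_on n W H" "C_on n W T" "controlled d n K q V \<phi>" "tame_derivs d n M \<mu> W T"
    and "admissible d n us" and e: "e \<in> W"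
  shows "\<bar>iter_deriv us (\<lambda>e. \<phi> (H e)) e\<bar> \<le> comp_const n K M * weight \<mu> us"
  using assms(9-13)
proof (induction n arbitrary: d \<phi> us)
  case 0
  have "H e \<in> V"
    using L e by (auto simp: lifts_def)
  from controlledD[OF 0(3) admissible_Nil this] 0(5) show ?case
    by (simp add: admissible_def)
next
  case (Suc n)
  let ?C = "comp_const n K M"
  show ?case
  proof (cases us rule: rev_cases)
    case Nil
    have "\<bar>iter_deriv [] \<phi> (H e)\<bar> \<le> K"
      using Suc.prems(3) L e unfolding controlled_def lifts_def by (metis admissible_Nil image_subset_iff)
    with Nil show ?thesis
      using comp_const_ge[OF KM, of "Suc n"] by simp
  next
    case (snoc us' u)
    note adm = Suc.prems(5)[unfolded snoc]
    have mono: "C_on n W H" "C_on n W T"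
      using C_on_mono[OF Suc.prems(1)] C_on_mono[OF Suc.prems(2)] by auto
    have "length us' \<le> Suc n"
      using adm by (simp add: admissible_def)
    then have "\<bar>iter_deriv (us' @ [u]) (\<lambda>e. \<phi> (H e)) e - dir_deriv (0, q) \<phi> (H e) * iter_deriv (us' @ [u]) T e\<bar>
        \<le> (1 + 2 ^ n * M) * ?C * weight \<mu> (us' @ [u])"
    proof (intro iter_deriv_compose_step[OF W V L q Suc.prems(1,2) _ _ \<mu> KM(2) comp_const_nonneg[OF KM] adm e])
      show "depends (Suc n) q V \<phi>"
        using Suc.prems(3) by (simp add: controlled_def)
      show "tame_derivs d (length us') M \<mu> W T" if "length us' \<le> Suc n"
        using tame_derivs_mono[OF Suc.prems(4) _ that] by simp
      show "\<bar>iter_deriv us' (\<lambda>e. dir_deriv (fst u, 0) \<phi> (H e)) e\<bar> \<le> ?C * weight \<mu> us'"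
        if "fst u \<noteq> 0"
      proof (rule Suc.IH[OF mono])
        have "norm (fst u) \<le> 1"
          using adm norm_fst_le[of "fst u" "snd u"] by (auto simp: admissible_snoc)
        then show "controlled (d - 1) n K q V (dir_deriv (fst u, 0) \<phi>)"
          using adm that by (intro controlled_param Suc.prems) (auto simp: admissible_snoc)
        show "tame_derivs (d - 1) n M \<mu> W T"
          using tame_derivs_mono[OF Suc.prems(4)] by simp
        show "admissible (d - 1) n us'"
          using adm that by (simp add: admissible_snoc)
      qed
      show "\<bar>iter_deriv t (\<lambda>e. dir_deriv (0, q) \<phi> (H e)) e\<bar> \<le> ?C * weight \<mu> t"
        if "admissible d n t" for t
        by (rule Suc.IH[OF mono controlled_phase[OF Suc.prems(3) q] tame_derivs_mono[OF Suc.prems(4)] that]) simp_all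
    qed
    moreover have "\<bar>dir_deriv (0, q) \<phi> (H e) * iter_deriv (us' @ [u]) T e\<bar> \<le> K * (M * weight \<mu> (us' @ [u]))"
    proof -
      have "\<bar>iter_deriv [] (dir_deriv (0, q) \<phi>) (H e)\<bar> \<le> K"
        using controlled_phase[OF Suc.prems(3) q] L e unfolding controlled_def lifts_def
        by (metis admissible_Nil image_subset_iff)
      moreover have "\<bar>iter_deriv (us' @ [u]) T e\<bar> \<le> M * weight \<mu> (us' @ [u])"
        using Suc.prems(4) adm e unfolding tame_derivs_def by blast
      ultimately show ?thesis
        unfolding abs_mult using KM by (intro mult_mono) auto
    qed
    moreover have "comp_const (Suc n) K M * weight \<mu> (us' @ [u])
        = K * (M * weight \<mu> (us' @ [u])) + (1 + 2 ^ n * M) * ?C * weight \<mu> (us' @ [u])"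
      by (simp add: algebra_simps)
    ultimately show ?thesis
      unfolding snoc by linarith
  qed
qed

text \<open>\<open>T\<close> is tame up to order n only, while the word has length n + 1: the top
  derivative of \<open>T\<close> stays inside the difference. This allows induction on the order
  along a tower.\<close>

lemma iter_deriv_compose_remainder:
  assumes W: "open W" and V: "open V" and L: "lifts W V q H T" and q: "q \<bullet> q = 1"
    and \<mu>: "0 \<le> \<mu>" "\<mu> \<le> 1" and KM: "0 \<le> K" "0 \<le> M"
    and CH: "C_on (Suc n) W H" and CT: "C_on (Suc n) W T"
    and \<phi>: "controlled d (Suc n) K q V \<phi>" and T: "tame_derivs d n M \<mu> W T"
    and adm: "admissible d (Suc n) us" and us: "length us = Suc n" and e: "e \<in> W"
  shows "\<bar>iter_deriv us (\<lambda>e. \<phi> (H e)) e - dir_deriv (0, q) \<phi> (H e) * iter_deriv us T e\<bar>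
    \<le> (1 + 2 ^ n * M) * comp_const n K M * weight \<mu> us"
proof -
  obtain us' u where us': "us = us' @ [u]" "length us' = n"
    using us by (cases us rule: rev_cases) auto
  note adm = adm[unfolded us']
  have mono: "C_on n W H" "C_on n W T"
    using C_on_mono[OF CH] C_on_mono[OF CT] by auto
  show ?thesis
    unfolding us'(1)
  proof (rule iter_deriv_compose_step[OF W V L q CH CT _ _ \<mu> KM(2) comp_const_nonneg[OF KM] adm e])
    show "depends (Suc n) q V \<phi>"
      using \<phi> by (simp add: controlled_def)
    show "tame_derivs d (length us') M \<mu> W T"
      using T us' by simp
    show "\<bar>iter_deriv us' (\<lambda>e. dir_deriv (fst u, 0) \<phi> (H e)) e\<bar> \<le> comp_const n K M * weight \<mu> us'"
      if "fst u \<noteq> 0"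
    proof (rule iter_deriv_compose_bound[OF W V L q \<mu> KM mono])
      have "norm (fst u) \<le> 1"
        using adm norm_fst_le[of "fst u" "snd u"] by (auto simp: admissible_snoc)
      then show "controlled (d - 1) n K q V (dir_deriv (fst u, 0) \<phi>)"
        using adm that by (intro controlled_param \<phi>) (auto simp: admissible_snoc)
      show "tame_derivs (d - 1) n M \<mu> W T"
        using tame_derivs_mono[OF T] by simp
      show "admissible (d - 1) n us'"
        using adm that by (simp add: admissible_snoc)
    qed (rule e)
    show "\<bar>iter_deriv t (\<lambda>e. dir_deriv (0, q) \<phi> (H e)) e\<bar> \<le> comp_const n K M * weight \<mu> t"
      if "admissible d n t" for t
      by (rule iter_deriv_compose_bound[OF W V L q \<mu> KM mono controlled_phase[OF \<phi> q] T that e])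
  qed
qed


subsection \<open>Parameter derivatives\<close>

primrec param_const :: "nat \<Rightarrow> real \<Rightarrow> real \<Rightarrow> real" where
  "param_const 0 K M = 0"
| "param_const (Suc n) K M = param_const n K M + 2 ^ n * (comp_const n K M * M)"

lemma param_const_nonneg: "0 \<le> K \<Longrightarrow> 0 \<le> M \<Longrightarrow> 0 \<le> param_const n K M"
  by (induction n) (auto intro!: add_nonneg_nonneg mult_nonneg_nonneg comp_const_nonneg)

lemma param_const_mono:
  assumes "0 \<le> K" "0 \<le> M" "n \<le> n'"
  shows "param_const n K M \<le> param_const n' K M"
proof (rule lift_Suc_mono_le[OF _ assms(3)])
  show "param_const i K M \<le> param_const (Suc i) K M" for i
    using assms(1,2) comp_const_nonneg[OF assms(1,2), of i] by simp
qed

text \<open>Only the derivatives of \<open>\<phi>\<close> involving the phase coordinate enter the difference.\<close>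

lemma iter_deriv_compose_param:
  assumes W: "open W" and V: "open V" and L: "lifts W V q H T" and q: "q \<bullet> q = 1"
    and \<mu>: "0 \<le> \<mu>" "\<mu> \<le> 1" and KM: "0 \<le> K" "0 \<le> M"
    and "C_on n W H" "C_on n W T" "depends n q V \<phi>"
    and "0 < n \<Longrightarrow> controlled (n - 1) (n - 1) K q V (dir_deriv (0, q) \<phi>)"
    and "tame_derivs n n M \<mu> W T"
    and "length vs = n" "\<forall>v\<in>set vs. norm v \<le> 1 \<and> snd v = 0" and e: "e \<in> W"
  shows "\<bar>iter_deriv vs (\<lambda>e. \<phi> (H e)) e - iter_deriv vs \<phi> (H e)\<bar> \<le> param_const n K M"
  using assms(9-15)
proof (induction n arbitrary: \<phi> vs)
  case (Suc n)
  obtain vs' v where vs: "vs = vs' @ [v]" "length vs' = n"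
    using Suc.prems(6) by (cases vs rule: rev_cases) auto
  have v: "norm v \<le> 1" "snd v = 0" and vs': "\<forall>v\<in>set vs'. norm v \<le> 1 \<and> snd v = 0"
    using Suc.prems(7) by (auto simp: vs)
  then have v0: "(fst v, 0) = v"
    by (simp add: prod_eq_iff)
  have mono: "C_on n W H" "C_on n W T"
    using C_on_mono[OF Suc.prems(1)] C_on_mono[OF Suc.prems(2)] by auto
  have C\<phi>: "C_on (Suc n) V \<phi>"
    using Suc.prems(3) by (simp add: depends_def)
  have HV: "H ` W \<subseteq> V"
    using L by (simp add: lifts_def)
  have comp: "C_on n W (\<lambda>e. dir_deriv u \<phi> (H e))" for u
    by (rule C_on_compose[OF W V C_on_dir_deriv[OF C\<phi>] mono(1) HV])
  have CdT: "C_on n W (dir_deriv v T)"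
    by (rule C_on_dir_deriv[OF Suc.prems(2)])
  have phase: "controlled n n K q V (dir_deriv (0, q) \<phi>)"
    using Suc.prems(4) by simp
  have adm: "admissible n n vs'" "admissible (Suc n) (Suc n) (vs' @ [v])"
    using vs' v vs(2) by (auto simp: admissible_def le_trans[OF length_filter_le])
  have "iter_deriv vs (\<lambda>e. \<phi> (H e)) e
      = iter_deriv vs' (\<lambda>e. dir_deriv v \<phi> (H e) + dir_deriv (0, q) \<phi> (H e) * dir_deriv v T e) e"
    unfolding vs iter_deriv_snoc
    using dir_deriv_compose_lifts[OF W L _ Suc.prems(3) _ q, of _ v]
    by (intro iter_deriv_cong_open[OF W e]) (simp add: v0)
  also have "\<dots> = iter_deriv vs' (\<lambda>e. dir_deriv v \<phi> (H e)) e
      + iter_deriv vs' (\<lambda>e. dir_deriv (0, q) \<phi> (H e) * dir_deriv v T e) e"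
    by (rule iter_deriv_add[OF W comp C_on_mult[OF W comp CdT] _ e]) (simp add: vs)
  finally have split: "iter_deriv vs (\<lambda>e. \<phi> (H e)) e = \<dots>" .
  have "\<bar>iter_deriv vs' (\<lambda>e. dir_deriv v \<phi> (H e)) e - iter_deriv vs' (dir_deriv v \<phi>) (H e)\<bar>
      \<le> param_const n K M"
  proof (rule Suc.IH[OF mono depends_dir_deriv[OF Suc.prems(3)] _ _ vs(2) vs'])
    show "tame_derivs n n M \<mu> W T"
      using tame_derivs_mono[OF Suc.prems(5)] by simp
    assume n: "0 < n"
    then have sn: "Suc (n - 1) = n"
      by simp
    have "depends (n - 1) q V (dir_deriv (0, q) (dir_deriv v \<phi>))"
      by (rule depends_dir_deriv) (simp only: sn depends_dir_deriv[OF Suc.prems(3)])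
    moreover have "\<bar>iter_deriv \<beta> (dir_deriv (0, q) (dir_deriv v \<phi>)) y\<bar> \<le> K"
      if \<beta>: "admissible (n - 1) (n - 1) \<beta>" and y: "y \<in> V" for \<beta> y
    proof -
      \<comment> \<open>The hypothesis bounds derivatives of \<open>dir_deriv (0, q) \<phi>\<close>,
        so the phase letter has to move innermost, past v.\<close>
      have "iter_deriv \<beta> (dir_deriv (0, q) (dir_deriv v \<phi>)) y = iter_deriv (\<beta> @ [(0, q), v]) \<phi> y"
        by (simp add: iter_deriv_append iter_deriv_Cons)
      also have "\<dots> = iter_deriv (\<beta> @ [v, (0, q)]) \<phi> y"
        using \<beta> n by (intro iter_deriv_perm[OF V C\<phi> y]) (auto simp: admissible_def)
      also have "\<dots> = iter_deriv (\<beta> @ [v]) (dir_deriv (0, q) \<phi>) y"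
        by (simp add: iter_deriv_append iter_deriv_Cons)
      also have "admissible n n (\<beta> @ [v])"
        using \<beta> v n by (auto simp: admissible_def)
      then have "\<bar>iter_deriv (\<beta> @ [v]) (dir_deriv (0, q) \<phi>) y\<bar> \<le> K"
        using controlledD[OF phase _ y] by blast
      finally show ?thesis .
    qed
    ultimately show "controlled (n - 1) (n - 1) K q V (dir_deriv (0, q) (dir_deriv v \<phi>))"
      unfolding controlled_def by blast
  qed
  then have first: "\<bar>iter_deriv vs' (\<lambda>e. dir_deriv v \<phi> (H e)) e - iter_deriv vs \<phi> (H e)\<bar>
      \<le> param_const n K M"
    by (simp only: vs iter_deriv_snoc)
  have "\<bar>iter_deriv vs' (\<lambda>e. dir_deriv (0, q) \<phi> (H e) * dir_deriv v T e) e\<bar>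
      \<le> 2 ^ length vs' * (comp_const n K M * M)"
  proof (rule iter_deriv_mult_bound[OF W comp CdT _ e])
    show "length vs' \<le> n"
      by (simp add: vs)
    fix s t assume st: "(s, t) \<in> set (splits vs')"
    have "\<bar>iter_deriv s (\<lambda>e. dir_deriv (0, q) \<phi> (H e)) e\<bar> \<le> comp_const n K M * weight \<mu> s"
      using tame_derivs_mono[OF Suc.prems(5), of n n] admissible_splits(1)[OF st adm(1)]
      by (intro iter_deriv_compose_bound[OF W V L q \<mu> KM mono phase _ _ e]) auto
    also have "\<dots> \<le> comp_const n K M * 1"
      using weight_le_1[OF \<mu>(2)] by (intro mult_left_mono comp_const_nonneg[OF KM])
    finally have "\<bar>iter_deriv s (\<lambda>e. dir_deriv (0, q) \<phi> (H e)) e\<bar> \<le> comp_const n K M"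
      by simp
    moreover have "\<bar>iter_deriv (t @ [v]) T e\<bar> \<le> M * weight \<mu> (t @ [v])"
      using admissible_splits(2)[OF st adm(1)] v
      by (intro tame_derivsD[OF Suc.prems(5) _ _ e]) (auto simp: admissible_def)
    then have "\<bar>iter_deriv t (dir_deriv v T) e\<bar> \<le> M"
      using mult_left_mono[OF weight_le_1[OF \<mu>(2)] KM(2), of "t @ [v]"] by (simp add: iter_deriv_snoc)
    ultimately show "\<bar>iter_deriv s (\<lambda>e. dir_deriv (0, q) \<phi> (H e)) e * iter_deriv t (dir_deriv v T) e\<bar>
        \<le> comp_const n K M * M"
      unfolding abs_mult using comp_const_nonneg[OF KM] by (intro mult_mono) auto
  qed
  then show ?case
    using first unfolding split param_const.simps vs(2) by linarith
qed simp


section \<open>Bounds for long compositions, uniform in their length\<close>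

section \<open>Towers of contractions\<close>

text \<open>The start 1, preserved by \<open>max\<close>, bounds the derivatives of the coordinate
  \<open>T 0\<close>. With C the remainder constant at order n, the quotient solves
  \<open>c * X + C = \<theta> * X\<close>, because
  \<open>\<theta> - c = (1 - c) / 2\<close>.\<close>

fun tower_const :: "real \<Rightarrow> real \<Rightarrow> nat \<Rightarrow> real" where
  "tower_const c K 0 = 1"
| "tower_const c K (Suc n) = max (tower_const c K n)
     ((1 + 2 ^ n * tower_const c K n) * comp_const n K (tower_const c K n) / ((1 - c) / 2))"

lemma tower_const_ge_1: "1 \<le> tower_const c K n"
  by (induction n) auto

lemma iter_deriv_linear:
  assumes "bounded_linear L" "us \<noteq> []"
  shows "iter_deriv us L = (\<lambda>_. if length us = 1 then L (last us) else 0)"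
proof -
  obtain us' u where us: "us = us' @ [u]"
    using assms(2) by (cases us rule: rev_cases) auto
  have D: "dir_deriv u L = (\<lambda>_. L u)"
    using bounded_linear_imp_has_derivative[OF assms(1)] by (auto simp: dir_deriv_eq)
  show ?thesis
  proof (cases us' rule: rev_cases)
    case (snoc us'' v)
    have "dir_deriv v (\<lambda>_. L u) = (\<lambda>_. 0)"
      by (auto simp: dir_deriv_def)
    then show ?thesis
      unfolding us snoc iter_deriv_snoc D by (simp add: iter_deriv_zero)
  qed (simp add: us D iter_deriv_Cons)
qed

text \<open>\<open>T k = \<phi>\<^sub>k\<^sub>-\<^sub>1(p, \<phi>\<^sub>k\<^sub>-\<^sub>2(p, \<dots> \<phi>\<^sub>0(p, x) \<dots>))\<close> up to the second phase coordinate of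
  \<open>H k\<close>, on which \<open>\<phi> k\<close> does not depend infinitesimally.\<close>

locale contraction_tower =
  fixes W :: "('p::euclidean_space \<times> 'z::euclidean_space) set"
    and V :: "nat \<Rightarrow> ('p \<times> 'z) set" and \<phi> :: "nat \<Rightarrow> 'p \<times> 'z \<Rightarrow> real"
    and H :: "nat \<Rightarrow> 'p \<times> 'z \<Rightarrow> 'p \<times> 'z" and T :: "nat \<Rightarrow> 'p \<times> 'z \<Rightarrow> real"
    and N :: nat and q :: 'z and c K :: real and d r :: nat
  assumes W: "open W" and V: "\<And>k. k < N \<Longrightarrow> open (V k)" and q: "q \<bullet> q = 1"
    and c: "0 < c" "c < 1" and K: "0 \<le> K" and r: "0 < r"
    and H: "\<And>k. k < N \<Longrightarrow> C_on r W (H k)"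
    and lifts: "\<And>k. k < N \<Longrightarrow> lifts W (V k) q (H k) (T k)"
    and T0: "\<And>e. e \<in> W \<Longrightarrow> T 0 e = snd e \<bullet> q"
    and step: "\<And>k e. k < N \<Longrightarrow> e \<in> W \<Longrightarrow> T (Suc k) e = \<phi> k (H k e)"
    and ctl: "\<And>k. k < N \<Longrightarrow> controlled d r K q (V k) (\<phi> k)"
    and contr: "\<And>k e. k < N \<Longrightarrow> e \<in> V k \<Longrightarrow> \<bar>dir_deriv (0, q) (\<phi> k) e\<bar> \<le> c"
    and nz: "\<And>k e. k < N \<Longrightarrow> e \<in> V k \<Longrightarrow> dir_deriv (0, q) (\<phi> k) e \<noteq> 0"
begin

abbreviation \<theta> :: real where "\<theta> \<equiv> (1 + c) / 2"

abbreviation M :: real where "M \<equiv> tower_const c K r"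

lemma \<theta>_pow: "0 \<le> \<theta> ^ k" "\<theta> ^ k \<le> 1"
  using c by (auto intro!: power_le_one)

lemma bounded_linear_T0: "bounded_linear (\<lambda>e::'p \<times> 'z. snd e \<bullet> q)"
  using bounded_linear_compose[OF bounded_linear_inner_left bounded_linear_snd] .

lemma depends_\<phi>: "k < N \<Longrightarrow> depends r q (V k) (\<phi> k)"
  using ctl by (simp add: controlled_def)

lemma H_in: "k < N \<Longrightarrow> e \<in> W \<Longrightarrow> H k e \<in> V k"
  using lifts by (auto simp: lifts_def)

lemma C_on_T: "k \<le> N \<Longrightarrow> C_on r W (T k)"
proof (induction k)
  case 0
  have "C_on r W (\<lambda>e. snd e \<bullet> q)"
    by (rule C_on_bounded_linear[OF bounded_linear_T0])
  then show ?case
    using C_on_cong[OF W, of "T 0" "\<lambda>e. snd e \<bullet> q" r] T0 by simp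
next
  case (Suc k)
  then have k: "k < N"
    by simp
  have "C_on r (V k) (\<phi> k)"
    using depends_\<phi>[OF k] by (simp add: depends_def)
  moreover have "H k ` W \<subseteq> V k"
    using lifts[OF k] by (simp add: lifts_def)
  ultimately have "C_on r W (\<lambda>e. \<phi> k (H k e))"
    by (intro C_on_compose[OF W V[OF k] _ H[OF k]])
  then show ?case
    using C_on_cong[OF W, of "T (Suc k)" "\<lambda>e. \<phi> k (H k e)" r] step[OF k] by simp
qed

text \<open>Outer induction on the order for all k at once, inner induction on k at top order. The
  outer hypothesis gives the remainder the same weight as the top derivative, so both fit into one
  linear recursion in k.\<close>

lemma tame_T: "k \<le> N \<Longrightarrow> n \<le> r \<Longrightarrow> tame_derivs d n (tower_const c K n) (\<theta> ^ k) W (T k)"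
proof (induction n arbitrary: k)
  case 0
  then show ?case
    by (auto simp: tame_derivs_def admissible_def)
next
  case (Suc n)
  let ?M = "tower_const c K n" and ?M' = "tower_const c K (Suc n)"
  let ?C = "(1 + 2 ^ n * ?M) * comp_const n K ?M"
  have M0: "0 \<le> ?M" "0 \<le> ?M'" "1 \<le> ?M'"
    using tower_const_ge_1[of c K n] tower_const_ge_1[of c K "Suc n"] by linarith+
  have MM: "?M \<le> ?M'"
    by simp
  have "?C / ((1 - c) / 2) \<le> ?M'"
    by simp
  moreover have "0 < (1 - c) / 2"
    using c by simp
  ultimately have "?C \<le> ?M' * ((1 - c) / 2)"
    by (simp only: pos_divide_le_eq)
  then have C: "c * ?M' + ?C \<le> \<theta> * ?M'"
    by (simp add: field_simps del: tower_const.simps)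
  have "\<bar>iter_deriv us (T k) e\<bar> \<le> ?M' * weight (\<theta> ^ k) us"
    if "k \<le> N" "admissible d (Suc n) us" "us \<noteq> []" "e \<in> W" for k us e
    using that(1)
  proof (induction k)
    case 0
    have "iter_deriv us (T 0) e = iter_deriv us (\<lambda>e. snd e \<bullet> q) e"
      using T0 by (intro iter_deriv_cong_open[OF W that(4)])
    also have "\<bar>\<dots>\<bar> \<le> 1"
    proof -
      have "norm (last us) \<le> 1"
        using that by (auto simp: admissible_def)
      then have "\<bar>snd (last us) \<bullet> q\<bar> \<le> 1"
        using Cauchy_Schwarz_ineq2[of "snd (last us)" q] norm_snd_le[of "snd (last us)" "fst (last us)"] q
        by (simp add: norm_eq_sqrt_inner[of q])
      then show ?thesis
        by (simp add: iter_deriv_linear[OF bounded_linear_T0 that(3)])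
    qed
    also have "1 \<le> ?M' * weight (\<theta> ^ 0) us"
      using M0 by (simp add: weight_def del: tower_const.simps)
    finally show ?case .
  next
    case (Suc k)
    then have k: "k < N" and IH: "\<bar>iter_deriv us (T k) e\<bar> \<le> ?M' * weight (\<theta> ^ k) us"
      by simp_all
    show ?case
    proof (cases "length us \<le> n")
      case True
      then have "\<bar>iter_deriv us (T (Suc k)) e\<bar> \<le> ?M * weight (\<theta> ^ Suc k) us"
        using Suc.prems that Suc_leD[OF \<open>Suc n \<le> r\<close>]
        by (intro tame_derivsD[OF \<open>\<And>k. k \<le> N \<Longrightarrow> n \<le> r \<Longrightarrow> tame_derivs d n ?M (\<theta> ^ k) W (T k)\<close>])
          (auto intro: admissible_length)
      also have "\<dots> \<le> ?M' * weight (\<theta> ^ Suc k) us"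
        by (intro mult_right_mono MM weight_nonneg \<theta>_pow)
      finally show ?thesis .
    next
      case False
      then have len: "length us = Suc n"
        using that(2) by (simp add: admissible_def)
      let ?w = "weight (\<theta> ^ k) us" and ?w' = "weight (\<theta> ^ Suc k) us"
      \<comment> \<open>For a purely parametric word both weights are 1 and this only says
        \<open>\<theta> \<le> 1\<close>; the same recursion thus serves both kinds of words.\<close>
      have w: "0 \<le> ?w" "?w * \<theta> \<le> ?w'"
        using \<theta>_pow[of k] c by (auto simp: weight_def)
      have "iter_deriv us (T (Suc k)) e = iter_deriv us (\<lambda>e. \<phi> k (H k e)) e"
        using step[OF k] by (intro iter_deriv_cong_open[OF W that(4)])
      moreover have "\<bar>iter_deriv us (\<lambda>e. \<phi> k (H k e)) e
          - dir_deriv (0, q) (\<phi> k) (H k e) * iter_deriv us (T k) e\<bar> \<le> ?C * ?w"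
      proof (rule iter_deriv_compose_remainder[OF W V[OF k] lifts[OF k] q \<theta>_pow K M0(1)])
        show "C_on (Suc n) W (H k)" "C_on (Suc n) W (T k)"
          using C_on_mono[OF H[OF k] \<open>Suc n \<le> r\<close>] C_on_mono[OF C_on_T \<open>Suc n \<le> r\<close>] k by auto
        show "controlled d (Suc n) K q (V k) (\<phi> k)"
          using controlled_mono[OF ctl[OF k] _ \<open>Suc n \<le> r\<close>] by simp
        show "tame_derivs d n ?M (\<theta> ^ k) W (T k)"
          using \<open>\<And>k. k \<le> N \<Longrightarrow> n \<le> r \<Longrightarrow> tame_derivs d n ?M (\<theta> ^ k) W (T k)\<close> k \<open>Suc n \<le> r\<close> by simp
      qed (use that len in auto)
      moreover have "\<bar>dir_deriv (0, q) (\<phi> k) (H k e) * iter_deriv us (T k) e\<bar> \<le> c * (?M' * ?w)"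
        unfolding abs_mult using contr[OF k H_in[OF k that(4)]] IH c by (intro mult_mono) auto
      ultimately have "\<bar>iter_deriv us (T (Suc k)) e\<bar> \<le> c * (?M' * ?w) + ?C * ?w"
        by linarith
      also have "\<dots> = (c * ?M' + ?C) * ?w"
        by (simp add: algebra_simps del: tower_const.simps)
      also have "\<dots> \<le> (\<theta> * ?M') * ?w"
        using C w(1) by (rule mult_right_mono)
      also have "\<dots> = ?M' * (?w * \<theta>)"
        by (simp add: algebra_simps del: tower_const.simps)
      also have "\<dots> \<le> ?M' * ?w'"
        using w(2) M0(2) by (rule mult_left_mono)
      finally show ?thesis .
    qed
  qed
  with Suc.prems show ?case
    unfolding tame_derivs_def by blast
qed

lemma M_nonneg: "0 \<le> M"
  using tower_const_ge_1[of c K r] by linarith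

lemma tame_T': "k \<le> N \<Longrightarrow> tame_derivs d r M (\<theta> ^ k) W (T k)"
  by (rule tame_T) auto

text \<open>The composition bound for the last step covers the empty word too, as the values of
  \<open>\<phi> (N - 1)\<close> are bounded by \<open>K\<close>. No decay is claimed here.\<close>

theorem tower_bound:
  assumes "0 < N" "admissible d r us" "e \<in> W"
  shows "\<bar>iter_deriv us (T N) e\<bar> \<le> comp_const r K M"
proof -
  define k where "k = N - 1"
  have k: "k < N" "N = Suc k"
    using assms(1) by (auto simp: k_def)
  have "iter_deriv us (T N) e = iter_deriv us (\<lambda>e. \<phi> k (H k e)) e"
    unfolding k(2) using step[OF k(1)] by (intro iter_deriv_cong_open[OF W assms(3)])
  also have "\<bar>\<dots>\<bar> \<le> comp_const r K M * weight (\<theta> ^ k) us"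
    using k(1) by (intro iter_deriv_compose_bound[OF W V lifts q \<theta>_pow K M_nonneg H C_on_T ctl tame_T'] assms)
      auto
  also have "\<dots> \<le> comp_const r K M * 1"
    by (intro mult_left_mono weight_le_1 \<theta>_pow comp_const_nonneg[OF K M_nonneg])
  finally show ?thesis
    by simp
qed

lemma dir_deriv_zero_compose: "k < N \<Longrightarrow> e \<in> V k \<Longrightarrow> g differentiable (at e) \<Longrightarrow> dir_deriv (0, 0) g e = 0"
  using linear_0[OF dir_deriv_linear[of g e]] by (simp add: zero_prod_def)

text \<open>The letter \<open>(0, q)\<close> has no parameter part, so the first term of the chain
  rule vanishes and phase derivatives multiply.\<close>

lemma dir_deriv_T:
  assumes "k \<le> N" "e \<in> W"
  shows "dir_deriv (0, q) (T k) e = (\<Prod>i<k. dir_deriv (0, q) (\<phi> i) (H i e))"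
  using assms(1)
proof (induction k)
  case 0
  have "dir_deriv (0, q) (T 0) e = dir_deriv (0, q) (\<lambda>e. snd e \<bullet> q) e"
    using T0 by (intro dir_deriv_cong_open[OF W assms(2)])
  also have "\<dots> = q \<bullet> q"
    using dir_deriv_eq[OF bounded_linear_imp_has_derivative[OF bounded_linear_T0]] by simp
  finally show ?case
    using q by simp
next
  case (Suc k)
  then have k: "k < N"
    by simp
  have df: "\<phi> k differentiable (at (H k e))"
    using depends_\<phi>[OF k] H_in[OF k assms(2)] r
    by (auto simp: depends_def intro: C_on_imp_differentiable)
  have "dir_deriv (0, q) (T (Suc k)) e = dir_deriv (0, q) (\<lambda>e. \<phi> k (H k e)) e"
    using step[OF k] by (intro dir_deriv_cong_open[OF W assms(2)])
  also have "\<dots> = dir_deriv (0, q) (\<phi> k) (H k e) * dir_deriv (0, q) (T k) e"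
    using dir_deriv_compose_lifts[OF W lifts[OF k] assms(2) depends_\<phi>[OF k] r q, of "(0, q)"]
      dir_deriv_zero_compose[OF k H_in[OF k assms(2)] df] by simp
  finally show ?case
    using Suc by simp
qed

lemma ln_dir_deriv_T:
  assumes "e \<in> W"
  shows "ln \<bar>dir_deriv (0, q) (T N) e\<bar> = (\<Sum>k<N. ln \<bar>dir_deriv (0, q) (\<phi> k) (H k e)\<bar>)"
proof -
  have "ln (\<Prod>k<N. \<bar>dir_deriv (0, q) (\<phi> k) (H k e)\<bar>) = (\<Sum>k<N. ln \<bar>dir_deriv (0, q) (\<phi> k) (H k e)\<bar>)"
    using nz H_in[OF _ assms] by (intro ln_prod) auto
  then show ?thesis
    using assms by (simp add: dir_deriv_T abs_prod)
qed

section \<open>Sums along a tower; \<open>L k\<close> will be a logarithm of a phase derivative,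
  with or without a power of b divided out\<close>

context
  fixes L :: "nat \<Rightarrow> 'p \<times> 'z \<Rightarrow> real" and \<Lambda> :: "'p \<times> 'z \<Rightarrow> real"
  assumes L: "\<And>k. k < N \<Longrightarrow> depends (r - 1) q (V k) (L k)"
    and \<Lambda>: "\<And>e. e \<in> W \<Longrightarrow> \<Lambda> e = (\<Sum>k<N. L k (H k e))"
begin

lemma C_on_LH:
  assumes "k < N"
  shows "C_on (r - 1) W (\<lambda>e. L k (H k e))"
proof (rule C_on_compose[OF W V[OF assms]])
  show "C_on (r - 1) (V k) (L k)"
    using L[OF assms] by (simp add: depends_def)
  show "C_on (r - 1) W (H k)"
    by (rule C_on_mono[OF H[OF assms]]) simp
  show "H k ` W \<subseteq> V k"
    using lifts[OF assms] by (simp add: lifts_def)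
qed

text \<open>Each summand contains a phase derivative of \<open>T k\<close> and so carries
  \<open>\<theta> ^ k\<close>; the geometric series contributes
  \<open>1 / (1 - \<theta>) = 2 / (1 - c)\<close>. The order is r - 2 because the derivative inside
  the logarithm and the one outside cost one order each.\<close>

theorem tower_log_bound:
  assumes r2: "2 \<le> r" and bd: "\<And>k. k < N \<Longrightarrow> controlled d (r - 2) K q (V k) (dir_deriv (0, q) (L k))"
    and w: "norm w \<le> 1" and us: "admissible d (r - 2) us" and e: "e \<in> W"
  shows "\<bar>iter_deriv us (dir_deriv (0, w) \<Lambda>) e\<bar>
    \<le> 2 ^ r * (comp_const (r - 2) K M * M) * (2 / (1 - c))"
proof -
  let ?C = "comp_const (r - 2) K M"
  let ?f = "\<lambda>k e. dir_deriv (0, q) (L k) (H k e) * dir_deriv (0, w) (T k) e"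
  have r1: "Suc (r - 2) = r - 1"
    using r2 by simp
  have C0: "0 \<le> ?C"
    by (rule comp_const_nonneg[OF K M_nonneg])
  have CH: "C_on (r - 2) W (H k)" and CT: "C_on (r - 2) W (T k)" if "k < N" for k
    using C_on_mono[OF H[OF that]] C_on_mono[OF C_on_T[of k]] that by auto
  have CL: "C_on (r - 2) W (\<lambda>e. dir_deriv (0, q) (L k) (H k e))" if "k < N" for k
  proof (rule C_on_compose[OF W V[OF that] C_on_dir_deriv CH[OF that]])
    show "C_on (Suc (r - 2)) (V k) (L k)"
      using L[OF that] by (simp add: depends_def r1)
    show "H k ` W \<subseteq> V k"
      using lifts[OF that] by (simp add: lifts_def)
  qed
  have CdT: "C_on (r - 2) W (dir_deriv (0, w) (T k))" if "k < N" for k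
    using C_on_mono[OF C_on_T[of k], of "r - 1"] that by (intro C_on_dir_deriv) (simp add: r1)
  have "dir_deriv (0, w) \<Lambda> y = (\<Sum>k<N. ?f k y)" if y: "y \<in> W" for y
  proof -
    have "dir_deriv (0, w) \<Lambda> y = dir_deriv (0, w) (\<lambda>e. \<Sum>k<N. L k (H k e)) y"
      using \<Lambda> by (intro dir_deriv_cong_open[OF W y])
    also have "\<dots> = (\<Sum>k<N. dir_deriv (0, w) (\<lambda>e. L k (H k e)) y)"
      using iter_deriv_sum[OF W, of "{..<N}" "r - 1" "\<lambda>k e. L k (H k e)" "[(0, w)]"] C_on_LH y r2
      by (simp add: iter_deriv_Cons)
    also have "\<dots> = (\<Sum>k<N. ?f k y)"
    proof (rule sum.cong[OF refl])
      fix k assume "k \<in> {..<N}"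
      then have k: "k < N"
        by simp
      have "L k differentiable (at (H k y))"
        using L[OF k] H_in[OF k y] r2 by (auto simp: depends_def intro: C_on_imp_differentiable)
      then show "dir_deriv (0, w) (\<lambda>e. L k (H k e)) y = ?f k y"
        using dir_deriv_compose_lifts[OF W lifts[OF k] y L[OF k] _ q, of "(0, w)"] r2
          dir_deriv_zero_compose[OF k H_in[OF k y]] by simp
    qed
    finally show ?thesis .
  qed
  then have "iter_deriv us (dir_deriv (0, w) \<Lambda>) e = iter_deriv us (\<lambda>e. \<Sum>k<N. ?f k e) e"
    by (intro iter_deriv_cong_open[OF W e])
  also have "\<dots> = (\<Sum>k<N. iter_deriv us (?f k) e)"
    by (rule iter_deriv_sum[OF W C_on_mult[OF W CL CdT] _ e]) (use us in \<open>auto simp: admissible_def\<close>)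
  also have "\<bar>\<dots>\<bar> \<le> (\<Sum>k<N. 2 ^ r * (?C * M) * \<theta> ^ k)"
  proof (rule order_trans[OF sum_abs sum_mono])
    fix k assume "k \<in> {..<N}"
    then have k: "k < N"
      by simp
    have len: "length us \<le> r - 2"
      using us by (simp add: admissible_def)
    have "\<bar>iter_deriv us (?f k) e\<bar> \<le> 2 ^ length us * (?C * (M * \<theta> ^ k))"
    proof (rule iter_deriv_mult_bound[OF W CL[OF k] CdT[OF k] len e])
      fix s t assume st: "(s, t) \<in> set (splits us)"
      have "\<bar>iter_deriv s (\<lambda>e. dir_deriv (0, q) (L k) (H k e)) e\<bar> \<le> ?C * weight (\<theta> ^ k) s"
        using tame_derivs_mono[OF tame_T'[of k], of d "r - 2"] k admissible_splits(1)[OF st us]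
        by (intro iter_deriv_compose_bound[OF W V[OF k] lifts[OF k] q \<theta>_pow K M_nonneg CH[OF k] CT[OF k] bd[OF k] _ _ e])
          auto
      also have "\<dots> \<le> ?C * 1"
        by (intro mult_left_mono weight_le_1 \<theta>_pow C0)
      finally have "\<bar>iter_deriv s (\<lambda>e. dir_deriv (0, q) (L k) (H k e)) e\<bar> \<le> ?C"
        by simp
      moreover have "admissible d (Suc (r - 2)) (t @ [(0, w)])"
        using admissible_splits(2)[OF st us] w by (simp add: admissible_snoc)
      then have "\<bar>iter_deriv (t @ [(0, w)]) (T k) e\<bar> \<le> M * weight (\<theta> ^ k) (t @ [(0, w)])"
        using tame_derivsD[OF tame_T'[of k] admissible_mono _ e] k r2 by auto
      then have "\<bar>iter_deriv t (dir_deriv (0, w) (T k)) e\<bar> \<le> M * \<theta> ^ k"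
        by (simp add: iter_deriv_snoc weight_def)
      ultimately show "\<bar>iter_deriv s (\<lambda>e. dir_deriv (0, q) (L k) (H k e)) e
          * iter_deriv t (dir_deriv (0, w) (T k)) e\<bar> \<le> ?C * (M * \<theta> ^ k)"
        unfolding abs_mult using C0 by (intro mult_mono) auto
    qed
    also have "\<dots> \<le> 2 ^ r * (?C * (M * \<theta> ^ k))"
      using len C0 M_nonneg \<theta>_pow by (intro mult_right_mono power_increasing) auto
    finally show "\<bar>iter_deriv us (?f k) e\<bar> \<le> 2 ^ r * (?C * M) * \<theta> ^ k"
      by (simp add: mult.assoc)
  qed
  also have "\<dots> = 2 ^ r * (?C * M) * (\<Sum>k<N. \<theta> ^ k)"
    by (simp add: sum_distrib_left)
  also have "\<dots> \<le> 2 ^ r * (?C * M) * (2 / (1 - c))"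
  proof (rule mult_left_mono)
    have "(\<Sum>k<N. \<theta> ^ k) \<le> (\<Sum>k. \<theta> ^ k)"
      using c by (intro sum_le_suminf summable_geometric) auto
    also have "\<dots> = 1 / (1 - \<theta>)"
      using c by (intro suminf_geometric) auto
    also have "\<dots> = 2 / (1 - c)"
      using c by (simp add: field_simps)
    finally show "(\<Sum>k<N. \<theta> ^ k) \<le> 2 / (1 - c)" .
    show "0 \<le> 2 ^ r * (?C * M)"
      using C0 M_nonneg by simp
  qed
  finally show ?thesis .
qed

text \<open>\<open>b k\<close> is kept apart because it will grow with the length of the piece. The
  rest is a constant per piece; no decay in k is sought, since the sum is divided by the total
  length in the end.\<close>

theorem tower_param_bound:
  assumes n: "n \<le> d" "n \<le> r - 1"
    and bd: "\<And>k. k < N \<Longrightarrow> 0 < n \<Longrightarrow> controlled (n - 1) (n - 1) K q (V k) (dir_deriv (0, q) (L k))"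
    and b: "\<And>k y. k < N \<Longrightarrow> y \<in> V k \<Longrightarrow> \<bar>iter_deriv vs (L k) y\<bar> \<le> b k"
    and vs: "length vs = n" "\<forall>v\<in>set vs. norm v \<le> 1 \<and> snd v = 0" and e: "e \<in> W"
  shows "\<bar>iter_deriv vs \<Lambda> e\<bar> \<le> (\<Sum>k<N. b k + param_const r K M)"
proof -
  have "iter_deriv vs \<Lambda> e = iter_deriv vs (\<lambda>e. \<Sum>k<N. L k (H k e)) e"
    using \<Lambda> by (intro iter_deriv_cong_open[OF W e])
  also have "\<dots> = (\<Sum>k<N. iter_deriv vs (\<lambda>e. L k (H k e)) e)"
    by (rule iter_deriv_sum[OF W C_on_LH _ e]) (use vs n in auto)
  also have "\<bar>\<dots>\<bar> \<le> (\<Sum>k<N. b k + param_const r K M)"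
  proof (rule order_trans[OF sum_abs sum_mono])
    fix k assume "k \<in> {..<N}"
    then have k: "k < N"
      by simp
    have "\<bar>iter_deriv vs (\<lambda>e. L k (H k e)) e - iter_deriv vs (L k) (H k e)\<bar> \<le> param_const n K M"
    proof (rule iter_deriv_compose_param[OF W V[OF k] lifts[OF k] q \<theta>_pow K M_nonneg _ _ _ bd[OF k] _ vs e])
      show "C_on n W (H k)" "C_on n W (T k)"
        using C_on_mono[OF H[OF k]] C_on_mono[OF C_on_T[of k]] k n by auto
      show "depends n q (V k) (L k)"
        using depends_mono[OF L[OF k]] n by simp
      show "tame_derivs n n M (\<theta> ^ k) W (T k)"
        using tame_derivs_mono[OF tame_T'[of k]] k n by simp
    qed
    also have "param_const n K M \<le> param_const r K M"
      using n by (intro param_const_mono K M_nonneg) simp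
    finally show "\<bar>iter_deriv vs (\<lambda>e. L k (H k e)) e\<bar> \<le> b k + param_const r K M"
      using b[OF k H_in[OF k e]] by linarith
  qed
  finally show ?thesis .
qed

end

end


section \<open>Plane topology of boxes: injectivity on slices and compactness over
  parameters\<close>

section \<open>Tame boxes\<close>

lemma slope_le_lipschitz:
  assumes "slope_le r c \<psi>" "0 < r"
  shows "\<bar>\<psi> x - \<psi> y\<bar> \<le> c * \<bar>x - y\<bar>"
proof -
  have "(\<psi> has_field_derivative deriv \<psi> z) (at z within UNIV)" for z
    using assms C_on_imp_differentiable[of r UNIV \<psi> z]
    by (simp add: slope_le_def DERIV_deriv_iff_real_differentiable)
  then show ?thesis
    using assms field_differentiable_bound[of UNIV \<psi> "deriv \<psi>" c x y] by (simp add: slope_le_def)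
qed

lemma slope_le_continuous: "slope_le r c \<psi> \<Longrightarrow> continuous_on S \<psi>"
  unfolding slope_le_def by (meson C_on_imp_continuous continuous_on_subset subset_UNIV)

text \<open>The diffeomorphism with the square is what gives a path connected complement: in the
  plane, a homeomorphic image of a compact convex set does not separate.\<close>

lemma tame_box_with_topology:
  assumes "tame_box_with cv ch r Y \<psi>m \<psi>p \<phi>m \<phi>p"
  shows "compact Y" "connected Y" "path_connected (- Y)" "Y \<noteq> {}"
proof -
  let ?S = "{-1..1::real} \<times> {-1..1::real}"
  obtain U V h where h: "?S \<subseteq> U" "C_diffeo r U V h" "h ` ?S = Y"
    using assms unfolding tame_box_with_def by blast
  then obtain k where "homeomorphism U V h k"
    unfolding C_diffeo_def by blast
  then have hom: "homeomorphism ?S Y h k"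
    by (rule homeomorphism_of_subsets[where T'' = V]) (use h in auto)
  have S: "compact ?S" "convex ?S"
    by (auto intro: compact_Times convex_Times)
  have cont: "continuous_on ?S h"
    using hom by (simp add: homeomorphism_def)
  show "compact Y"
    using compact_continuous_image[OF cont S(1)] h(3) by simp
  show "connected Y"
    using connected_continuous_image[OF cont convex_connected[OF S(2)]] h(3) by simp
  show "Y \<noteq> {}"
    using h(3) by auto
  have "Y homeomorphic ?S"
    using hom homeomorphic_def homeomorphic_sym by blast
  then show "path_connected (- Y)"
    by (rule path_connected_complement_homeomorphic_convex_compact[OF _ S(2,1)]) simp
qed

lemma frontier_tame_box:
  assumes "tame_box_with cv ch r Y \<psi>m \<psi>p \<phi>m \<phi>p"
  shows "frontier Y \<subseteq> bd_u Y \<psi>m \<psi>p \<union> bd_s Y \<phi>m \<phi>p"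
proof
  fix z assume z: "z \<in> frontier Y"
  have zY: "z \<in> Y"
    using z frontier_subset_closed compact_imp_closed tame_box_with_topology(1)[OF assms] by blast
  have Y: "Y = {(x, y). \<psi>m x \<le> y \<and> y \<le> \<psi>p x \<and> \<phi>m y \<le> x \<and> x \<le> \<phi>p y}"
    using assms by (simp add: tame_box_with_def)
  have cont: "continuous_on UNIV \<psi>m" "continuous_on UNIV \<psi>p" "continuous_on UNIV \<phi>m" "continuous_on UNIV \<phi>p"
    using assms slope_le_continuous by (auto simp: tame_box_with_def)
  have cont': "continuous_on UNIV (\<lambda>z. \<psi> (fst z :: real))" "continuous_on UNIV (\<lambda>z. \<psi> (snd z :: real))"
    if "continuous_on UNIV \<psi>" for \<psi> :: "real \<Rightarrow> real"
    by (rule continuous_on_compose2[OF that]; auto intro: continuous_intros)+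
  let ?O = "{z. \<psi>m (fst z) < snd z} \<inter> {z. snd z < \<psi>p (fst z)} \<inter> {z. \<phi>m (snd z) < fst z} \<inter> {z. fst z < \<phi>p (snd z)}"
  have "open ?O"
    by (intro open_Int open_Collect_less cont'[OF cont(1)] cont'[OF cont(2)] cont'[OF cont(3)] cont'[OF cont(4)]
        continuous_on_fst continuous_on_snd continuous_on_id)
  moreover have "?O \<subseteq> Y"
    by (auto simp: Y)
  ultimately have "?O \<subseteq> interior Y"
    by (simp add: interior_maximal)
  moreover have "z \<notin> interior Y"
    using z by (simp add: frontier_def)
  ultimately have "z \<notin> ?O"
    by blast
  then show "z \<in> bd_u Y \<psi>m \<psi>p \<union> bd_s Y \<phi>m \<phi>p"
    using zY unfolding bd_u_def bd_s_def by (cases z) (auto simp: Y)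
qed

text \<open>\<rho> will be a clamped graph with corners, so the chain rule is not at hand. As the
  derivative of \<open>g\<close> vanishes vertically, \<rho> enters through the error term only, and
  a Lipschitz bound controls that.\<close>

lemma has_derivative_along_lipschitz:
  fixes g :: "real \<times> real \<Rightarrow> real"
  assumes D: "(g has_derivative (\<lambda>h. a * fst h)) (at (s, \<rho> s))"
    and lip: "\<And>t. \<bar>\<rho> t - \<rho> s\<bar> \<le> L * \<bar>t - s\<bar>" and L: "0 \<le> L"
  shows "((\<lambda>t. g (t, \<rho> t)) has_derivative (\<lambda>h. a * h)) (at s)"
  unfolding has_derivative_at_alt
proof (intro conjI allI impI)
  show "bounded_linear (\<lambda>h. a * h)"
    by (rule bounded_linear_mult_right)
  fix e :: real assume e: "0 < e"
  let ?e = "e / (1 + L)"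
  have e': "0 < ?e"
    using e L by simp
  then obtain d where d: "0 < d" "\<And>z. norm (z - (s, \<rho> s)) < d \<Longrightarrow>
      norm (g z - g (s, \<rho> s) - a * fst (z - (s, \<rho> s))) \<le> ?e * norm (z - (s, \<rho> s))"
    using D unfolding has_derivative_at_alt by blast
  have len: "norm ((t, \<rho> t) - (s, \<rho> s)) \<le> (1 + L) * norm (t - s)" for t
    using norm_Pair_le[of "t - s" "\<rho> t - \<rho> s"] lip[of t] by (simp add: algebra_simps)
  show "\<exists>d>0. \<forall>t. norm (t - s) < d \<longrightarrow>
      norm (g (t, \<rho> t) - g (s, \<rho> s) - a * (t - s)) \<le> e * norm (t - s)"
  proof (intro exI[of _ "d / (1 + L)"] conjI allI impI)
    show "0 < d / (1 + L)"
      using d L by simp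
    fix t assume t: "norm (t - s) < d / (1 + L)"
    then have "(1 + L) * norm (t - s) < d"
      using L by (simp add: field_simps)
    then have "norm ((t, \<rho> t) - (s, \<rho> s)) < d"
      using len[of t] by linarith
    from d(2)[OF this] have "norm (g (t, \<rho> t) - g (s, \<rho> s) - a * (t - s)) \<le> ?e * norm ((t, \<rho> t) - (s, \<rho> s))"
      by simp
    also have "\<dots> \<le> ?e * ((1 + L) * norm (t - s))"
      using e' len[of t] by (intro mult_left_mono) auto
    also have "\<dots> = e * norm (t - s)"
      using L by (simp add: field_simps)
    finally show "norm (g (t, \<rho> t) - g (s, \<rho> s) - a * (t - s)) \<le> e * norm (t - s)" .
  qed
qed

text \<open>Horizontal slices of a tame box may be disconnected, but two of their points are joined
  within the box by a Lipschitz graph (a horizontal segment clamped between \<open>\<psi>m\<close> and \<open>\<psi>p\<close>); since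
  the derivative of \<open>g\<close> vanishes in the vertical direction, Rolle's theorem applies along it.\<close>

lemma tame_box_slice_inj:
  assumes tame: "tame_box_with cv ch r Y \<psi>m \<psi>p \<phi>m \<phi>p" and r: "0 < r"
    and cone: "0 < cv" "0 < ch" "cv * ch < 1"
    and D: "\<And>z. z \<in> Y \<Longrightarrow> (g has_derivative (\<lambda>h. a z * fst h)) (at z)"
    and a: "\<And>z. z \<in> Y \<Longrightarrow> a z \<noteq> (0::real)"
    and pts: "(x0, y) \<in> Y" "(x1, y) \<in> Y" and eq: "g (x0, y) = g (x1, y)"
  shows "x0 = x1"
proof (rule ccontr)
  assume "x0 \<noteq> x1"
  then obtain l u where lu: "l < u" "(l, y) \<in> Y" "(u, y) \<in> Y" "g (l, y) = g (u, y)"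
    using pts eq by (metis linorder_neqE_linordered_idom)
  have Y: "Y = {(x, y). \<psi>m x \<le> y \<and> y \<le> \<psi>p x \<and> \<phi>m y \<le> x \<and> x \<le> \<phi>p y}"
    and sl: "slope_le r ch \<psi>m" "slope_le r ch \<psi>p" "slope_le r cv \<phi>m" "slope_le r cv \<phi>p"
    using tame by (simp_all add: tame_box_with_def)
  note lip = sl[THEN slope_le_lipschitz, OF r]
  define \<rho> where "\<rho> s = max (\<psi>m s) (min (\<psi>p s) y)" for s
  have \<rho>_lip: "\<bar>\<rho> t - \<rho> s\<bar> \<le> ch * \<bar>t - s\<bar>" for t s
    using lip(1)[of t s] lip(2)[of t s] by (simp add: \<rho>_def max_def min_def abs_if split: if_splits)
  have inY: "(s, \<rho> s) \<in> Y" if s: "l \<le> s" "s \<le> u" for s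
  proof -
    \<comment> \<open>The projection of the connected box meets every abscissa from l to u, so that
      \<open>\<psi>m s \<le> \<psi>p s\<close> and clamping is meaningful.\<close>
    have "connected (fst ` Y)"
      by (intro connected_continuous_image continuous_on_fst continuous_on_id tame_box_with_topology(2)[OF tame])
    then have "s \<in> fst ` Y"
      using lu s by (intro connectedD_interval[of "fst ` Y" l u s]) (auto simp: image_iff intro: bexI[rotated])
    then have gap: "\<psi>m s \<le> \<psi>p s"
      by (auto simp: Y)
    \<comment> \<open>At horizontal distance t from an endpoint the graph has left height y by at
      most \<open>ch * t\<close>, so \<phi>m and \<phi>p have moved by at most
      \<open>cv * ch * t \<le> t\<close>: the graph cannot cross the vertical sides.\<close>
    have dev: "\<bar>\<rho> s - y\<bar> \<le> ch * (s - l)" "\<bar>\<rho> s - y\<bar> \<le> ch * (u - s)"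
      using lu(2,3) s gap lip(1)[of s l] lip(2)[of s l] lip(1)[of s u] lip(2)[of s u]
        mult_nonneg_nonneg[of ch "s - l"] mult_nonneg_nonneg[of ch "u - s"] cone
      by (auto simp: \<rho>_def Y max_def min_def abs_if split: if_splits)
    have contr: "cv * (ch * x) \<le> x" if "0 \<le> x" for x
      using mult_right_mono[OF less_imp_le[OF cone(3)] that] by (simp add: mult.assoc)
    have "\<bar>\<phi>m (\<rho> s) - \<phi>m y\<bar> \<le> cv * (ch * (s - l))"
      using lip(3)[of "\<rho> s" y] mult_left_mono[OF dev(1), of cv] cone by linarith
    then have "\<phi>m (\<rho> s) \<le> s"
      using contr[of "s - l"] s lu(2) by (auto simp: Y abs_le_iff)
    moreover have "\<bar>\<phi>p (\<rho> s) - \<phi>p y\<bar> \<le> cv * (ch * (u - s))"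
      using lip(4)[of "\<rho> s" y] mult_left_mono[OF dev(2), of cv] cone by linarith
    then have "s \<le> \<phi>p (\<rho> s)"
      using contr[of "u - s"] s lu(3) by (auto simp: Y abs_le_iff)
    ultimately show ?thesis
      using gap by (auto simp: Y \<rho>_def)
  qed
  have der: "((\<lambda>t. g (t, \<rho> t)) has_derivative (\<lambda>h. a (s, \<rho> s) * h)) (at s)" if "l \<le> s" "s \<le> u" for s
    using cone by (intro has_derivative_along_lipschitz[where L = ch] D inY \<rho>_lip that) simp
  have ends: "\<rho> l = y" "\<rho> u = y"
    using lu by (auto simp: \<rho>_def Y)
  have "\<exists>s. l < s \<and> s < u \<and> (\<lambda>h. a (s, \<rho> s) * h) = (\<lambda>h. 0)"
  proof (rule Rolle_deriv[OF lu(1)])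
    show "g (l, \<rho> l) = g (u, \<rho> u)"
      using lu ends by simp
    show "continuous_on {l..u} (\<lambda>t. g (t, \<rho> t))"
      using der by (intro continuous_at_imp_continuous_on ballI has_derivative_continuous) auto
  qed (use der in auto)
  then obtain s where s: "l < s" "s < u" "(\<lambda>h. a (s, \<rho> s) * h) = (\<lambda>h. 0)"
    by blast
  have "a (s, \<rho> s) * 1 = 0"
    by (rule fun_cong[OF s(3)])
  with a[OF inY[of s]] s(1,2) show False
    by simp
qed


subsection \<open>Families of boxes\<close>

text \<open>The ray from z away from the origin leaves the compact set, hence meets its frontier at
  a point of norm at least \<open>norm z\<close>.\<close>

lemma compact_subset_ball_frontier:
  fixes Y :: "'a::euclidean_space set"
  assumes "compact Y" "frontier Y \<subseteq> ball 0 B" "0 < B"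
  shows "Y \<subseteq> ball 0 B"
proof
  fix z assume z: "z \<in> Y"
  show "z \<in> ball 0 B"
  proof (rule ccontr)
    assume "z \<notin> ball 0 B"
    then have zB: "B \<le> norm z" and z0: "0 < norm z"
      using assms(3) by auto
    let ?R = "(\<lambda>t. t *\<^sub>R z) ` {1..}"
    have "connected ?R"
      by (intro connected_continuous_image continuous_intros convex_connected convex_real_interval)
    moreover have "z \<in> ?R"
      by (rule image_eqI[of _ _ 1]) auto
    moreover have "\<not> ?R \<subseteq> Y"
    proof
      assume "?R \<subseteq> Y"
      obtain D where D: "\<And>y. y \<in> Y \<Longrightarrow> norm y \<le> D"
        using compact_imp_bounded[OF assms(1)] bounded_iff by blast
      have "D / norm z < max 1 (D / norm z + 1)"
        by simp
      then have "D < max 1 (D / norm z + 1) * norm z"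
        using z0 by (simp only: pos_divide_less_eq)
      moreover have "max 1 (D / norm z + 1) *\<^sub>R z \<in> ?R"
        by (rule imageI) simp
      then have "max 1 (D / norm z + 1) *\<^sub>R z \<in> Y"
        using \<open>?R \<subseteq> Y\<close> by (rule subsetD[rotated])
      ultimately show False
        using D[of "max 1 (D / norm z + 1) *\<^sub>R z"] by simp
    qed
    ultimately have "?R \<inter> frontier Y \<noteq> {}"
      using z by (intro connected_Int_frontier) auto
    then obtain t where t: "1 \<le> t" "t *\<^sub>R z \<in> frontier Y"
      by auto
    then have "t * norm z < B"
      using subsetD[OF assms(2) t(2)] by simp
    moreover have "1 * norm z \<le> t * norm z"
      using t(1) by (intro mult_right_mono) auto
    ultimately show False
      using zB by simp
  qed
qed

text \<open>If the frontiers move in a compact set and the complements are path connected, the sets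
  are upper semicontinuous in the parameter: a path from a point off \<open>Y p\<close> to infinity misses
  \<open>frontier (Y q)\<close> for \<open>q\<close> near \<open>p\<close>.\<close>

lemma compact_family:
  fixes Y :: "'p::euclidean_space \<Rightarrow> 'a::euclidean_space set"
  assumes C: "compact C" and \<Gamma>: "compact \<Gamma>"
    and comp: "\<And>p. p \<in> C \<Longrightarrow> compact (Y p)" and conn: "\<And>p. p \<in> C \<Longrightarrow> path_connected (- Y p)"
    and fr: "\<And>p z. p \<in> C \<Longrightarrow> z \<in> frontier (Y p) \<Longrightarrow> (p, z) \<in> \<Gamma>"
    and sub: "\<And>p z. p \<in> C \<Longrightarrow> (p, z) \<in> \<Gamma> \<Longrightarrow> z \<in> Y p"
  shows "compact {(p, z). p \<in> C \<and> z \<in> Y p}" (is "compact ?\<Omega>")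
proof -
  obtain B where B: "0 < B" "\<And>e. e \<in> \<Gamma> \<Longrightarrow> norm e < B"
  proof -
    obtain b where "0 < b" "\<And>e. e \<in> \<Gamma> \<Longrightarrow> norm e \<le> b"
      using compact_imp_bounded[OF \<Gamma>] bounded_pos by blast
    then show thesis
      by (intro that[of "b + 1"]) force+
  qed
  have ball: "Y p \<subseteq> ball 0 B" if "p \<in> C" for p
  proof (rule compact_subset_ball_frontier[OF comp[OF that] _ B(1)])
    show "frontier (Y p) \<subseteq> ball 0 B"
    proof
      fix z assume "z \<in> frontier (Y p)"
      then have "norm (p, z) < B"
        using B(2) fr[OF that] by blast
      then show "z \<in> ball 0 B"
        using norm_snd_le[of z p] by simp
    qed
  qed
  have "bounded ?\<Omega>"
  proof (rule bounded_subset)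
    show "bounded (C \<times> ball 0 B)"
      using compact_imp_bounded[OF C] by (intro bounded_Times) auto
    show "?\<Omega> \<subseteq> C \<times> ball 0 B"
      using ball by auto
  qed
  moreover have "closed ?\<Omega>"
    unfolding closed_sequential_limits
  proof (intro allI impI, elim conjE)
    fix x and l assume x: "\<forall>n. x n \<in> ?\<Omega>" and lim: "x \<longlonglongrightarrow> l"
    obtain p z where l: "l = (p, z)"
      by (cases l)
    have limp: "(\<lambda>n. fst (x n)) \<longlonglongrightarrow> p" and limz: "(\<lambda>n. snd (x n)) \<longlonglongrightarrow> z"
      using tendsto_fst[OF lim] tendsto_snd[OF lim] by (simp_all add: l)
    have xn: "fst (x n) \<in> C" "snd (x n) \<in> Y (fst (x n))" for n
      using x by (auto simp: case_prod_unfold)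
    have p: "p \<in> C"
      using closed_sequentially[OF compact_imp_closed[OF C] _ limp] xn by blast
    have "z \<in> Y p"
    proof (rule ccontr)
      assume z: "z \<notin> Y p"
      obtain b :: 'a where b: "b \<in> Basis"
        using nonempty_Basis by blast
      \<comment> \<open>A point outside all the sets \<open>Y q\<close> with
        \<open>q \<in> C\<close>, in the role of infinity.\<close>
      let ?w = "B *\<^sub>R b"
      have w: "?w \<notin> ball 0 B"
        using b B(1) by simp
      then have "?w \<notin> Y p"
        using ball[OF p] by blast
      with z conn[OF p] obtain g where g: "path g" "path_image g \<subseteq> - Y p" "pathstart g = z" "pathfinish g = ?w"
        unfolding path_connected_def by blast
      have "open (- Y p)"
        using comp[OF p] by (simp add: compact_imp_closed open_Compl)
      then obtain \<epsilon> where \<epsilon>: "0 < \<epsilon>" "cball z \<epsilon> \<subseteq> - Y p"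
        using z open_contains_cball by blast
      \<comment> \<open>The ball is added so that this connected set meets
        \<open>Y (fst (x n))\<close> for large n.\<close>
      let ?K = "path_image g \<union> cball z \<epsilon>"
      have K: "compact ?K" "connected ?K" "?K \<inter> Y p = {}"
        using g \<epsilon> pathstart_in_path_image[of g]
        by (auto intro!: compact_Un compact_path_image connected_Un connected_path_image)
      \<comment> \<open>The parameters over which \<Gamma> touches the connected set. They form a
        compact set that avoids p, because \<Gamma> over p lies in \<open>Y p\<close>.\<close>
      let ?Q = "fst ` (\<Gamma> \<inter> C \<times> ?K)"
      have "compact ?Q"
        by (intro compact_continuous_image continuous_on_fst continuous_on_id
            compact_Int \<Gamma> compact_Times C K)
      moreover have "p \<notin> ?Q"
        using sub K(3) by fastforce
      ultimately have "\<forall>\<^sub>F n in sequentially. fst (x n) \<in> - ?Q"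
        using limp by (intro topological_tendstoD) (auto simp: compact_imp_closed open_Compl)
      moreover have "\<forall>\<^sub>F n in sequentially. snd (x n) \<in> ball z \<epsilon>"
        using limz \<epsilon> by (intro topological_tendstoD) auto
      ultimately have "\<forall>\<^sub>F n in sequentially. fst (x n) \<in> - ?Q \<and> snd (x n) \<in> ball z \<epsilon>"
        by eventually_elim auto
      then obtain n where n: "fst (x n) \<notin> ?Q" "snd (x n) \<in> ball z \<epsilon>"
        unfolding eventually_sequentially by blast
      have "?K \<inter> frontier (Y (fst (x n))) = {}"
      proof (rule ccontr)
        assume "?K \<inter> frontier (Y (fst (x n))) \<noteq> {}"
        then obtain y where y: "y \<in> ?K" "y \<in> frontier (Y (fst (x n)))"
          by blast
        have "(fst (x n), y) \<in> \<Gamma> \<inter> C \<times> ?K"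
          using fr[OF xn(1) y(2)] xn(1) y(1) by blast
        from imageI[OF this, of fst] show False
          using n(1) by simp
      qed
      moreover have "snd (x n) \<in> ?K"
        using n(2) by simp
      then have "?K \<inter> Y (fst (x n)) \<noteq> {}"
        using xn(2)[of n] by blast
      ultimately have "?K \<subseteq> Y (fst (x n))"
        using connected_Int_frontier[OF K(2)] by blast
      moreover have "?w \<in> ?K"
        using g(4) pathfinish_in_path_image[of g] by auto
      ultimately show False
        using w ball[OF xn(1)] by blast
    qed
    with p show "l \<in> ?\<Omega>"
      by (simp add: l)
  qed
  ultimately show ?thesis
    by (simp add: compact_eq_bounded_closed)
qed

text \<open>Persistence makes only the boundary arcs continuous in p. Their graphs over a compact
  set of parameters are the \<Gamma> of \<open>compact_family\<close>, which passes compactness on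
  to the full boxes.\<close>

lemma compact_persistent_piece:
  assumes pp: "persistent_piece cv ch r P f (Y, n)" and C: "compact C" "C \<subseteq> P"
  shows "compact {(p, z). p \<in> C \<and> z \<in> Y p}"
proof -
  obtain \<gamma>1 \<gamma>2 \<delta>1 \<delta>2 where arcs: "arc_family r P \<gamma>1" "arc_family r P \<gamma>2" "arc_family r P \<delta>1" "arc_family r P \<delta>2"
    and bd: "\<forall>p\<in>P. \<exists>\<psi>m \<psi>p \<phi>m \<phi>p. tame_box_with cv ch r (Y p) \<psi>m \<psi>p \<phi>m \<phi>p \<and>
           bd_u (Y p) \<psi>m \<psi>p = \<gamma>1 p ` {-1..1} \<union> \<gamma>2 p ` {-1..1} \<and>
           bd_s (Y p) \<phi>m \<phi>p = \<delta>1 p ` {-1..1} \<union> \<delta>2 p ` {-1..1}"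
    using pp unfolding persistent_piece_def by auto
  define G where "G \<gamma> = (\<lambda>(p, t). (p, \<gamma> p t)) ` (C \<times> {-1..1::real})" for \<gamma> :: "'a \<Rightarrow> real \<Rightarrow> plane"
  have G: "compact (G \<gamma>)" if "arc_family r P \<gamma>" for \<gamma>
    unfolding G_def
  proof (rule compact_continuous_image)
    have "continuous_on (C \<times> {-1..1}) (\<lambda>(p, t). \<gamma> p t)"
      using that C(2) unfolding arc_family_def by (blast intro: continuous_on_subset)
    then show "continuous_on (C \<times> {-1..1}) (\<lambda>(p, t). (p, \<gamma> p t))"
      by (auto simp: case_prod_unfold intro!: continuous_intros)
  qed (auto intro: compact_Times C)
  have Gmem: "(p, z) \<in> G \<gamma> \<longleftrightarrow> p \<in> C \<and> z \<in> \<gamma> p ` {-1..1}" for p z \<gamma>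
    by (auto simp: G_def)
  show ?thesis
  proof (rule compact_family[where \<Gamma> = "G \<gamma>1 \<union> G \<gamma>2 \<union> G \<delta>1 \<union> G \<delta>2", OF C(1)])
    show "compact (G \<gamma>1 \<union> G \<gamma>2 \<union> G \<delta>1 \<union> G \<delta>2)"
      by (intro compact_Un G arcs)
    fix p assume p: "p \<in> C"
    from bspec[OF bd subsetD[OF C(2) p]] obtain \<psi>m \<psi>p \<phi>m \<phi>p where t: "tame_box_with cv ch r (Y p) \<psi>m \<psi>p \<phi>m \<phi>p"
      and b: "bd_u (Y p) \<psi>m \<psi>p = \<gamma>1 p ` {-1..1} \<union> \<gamma>2 p ` {-1..1}"
        "bd_s (Y p) \<phi>m \<phi>p = \<delta>1 p ` {-1..1} \<union> \<delta>2 p ` {-1..1}"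
      by (elim exE conjE)
    show "compact (Y p)" "path_connected (- Y p)"
      by (rule tame_box_with_topology[OF t])+
    fix z
    show "(p, z) \<in> G \<gamma>1 \<union> G \<gamma>2 \<union> G \<delta>1 \<union> G \<delta>2" if "z \<in> frontier (Y p)"
      using frontier_tame_box[OF t] that p by (auto simp: b Gmem)
    have "bd_u (Y p) \<psi>m \<psi>p \<subseteq> Y p" "bd_s (Y p) \<phi>m \<phi>p \<subseteq> Y p"
      by (auto simp: bd_u_def bd_s_def)
    then show "z \<in> Y p" if "(p, z) \<in> G \<gamma>1 \<union> G \<gamma>2 \<union> G \<delta>1 \<union> G \<delta>2"
      using that unfolding b Un_iff Gmem by blast
  qed
qed


section \<open>The affine-like representation of one piece and its regularity\<close>

section \<open>Hyperbolic pieces\<close>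

text \<open>\<open>Y = 0\<close> in the second bound gives \<open>snd (D (1, 0)) = 0\<close>. By the
  first bound, a vector whose image has first coordinate 0 is vertical;
  \<open>(fst (D (0, 1)), - fst (D (1, 0)))\<close> is such a vector, so its first entry is
  0.\<close>

lemma hyperbolic_diagonal:
  fixes D :: "real \<times> real \<Rightarrow> real \<times> real"
  assumes lin: "linear D"
    and hyp: "\<And>X Y. \<bar>X\<bar> \<le> c * \<bar>fst (D (X, Y))\<bar> \<and> \<bar>snd (D (X, Y))\<bar> \<le> c * \<bar>Y\<bar>"
  shows "D h = (fst (D (1, 0)) * fst h, snd (D (0, 1)) * snd h)"
    and "1 \<le> c * \<bar>fst (D (1, 0))\<bar>" and "\<bar>snd (D (0, 1))\<bar> \<le> c"
proof -
  interpret D: linear D by fact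
  have D: "D (x, y) = x *\<^sub>R D (1, 0) + y *\<^sub>R D (0, 1)" for x y
  proof -
    have "(x, y) = x *\<^sub>R (1, 0) + y *\<^sub>R (0, 1)"
      by simp
    then show ?thesis
      by (metis D.add D.scaleR)
  qed
  have "snd (D (1, 0)) = 0"
    using hyp[of 1 0] by simp
  moreover have "fst (D (0, 1)) = 0"
  proof (rule ccontr)
    assume g: "fst (D (0, 1)) \<noteq> 0"
    have "fst (D (fst (D (0, 1)), - fst (D (1, 0)))) = 0"
      by (simp add: D[of "fst (D (0, 1))"])
    then show False
      using hyp[of "fst (D (0, 1))" "- fst (D (1, 0))"] g by simp
  qed
  ultimately show "D h = (fst (D (1, 0)) * fst h, snd (D (0, 1)) * snd h)"
    using D[of "fst h" "snd h"] by (simp add: prod_eq_iff mult.commute)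
  show "1 \<le> c * \<bar>fst (D (1, 0))\<bar>" "\<bar>snd (D (0, 1))\<bar> \<le> c"
    using hyp[of 1 0] hyp[of 0 1] by simp_all
qed

lemma C_on_funpow:
  fixes h :: "'a::euclidean_space \<Rightarrow> 'a"
  assumes "C_on r UNIV h"
  shows "C_on r UNIV (h ^^ n)"
proof (induction n)
  case 0
  then show ?case
    using C_on_bounded_linear[OF bounded_linear_ident, of r UNIV] by (simp add: id_def)
next
  case (Suc n)
  then show ?case
    using C_on_compose[OF open_UNIV open_UNIV assms, of "h ^^ n"] by (simp add: o_def)
qed

lemma C_on_family_funpow:
  fixes f :: "'p::euclidean_space \<Rightarrow> plane \<Rightarrow> plane"
  assumes "diffeo_family r P f" "open P"
  shows "C_on r (P \<times> UNIV) (\<lambda>e. (f (fst e) ^^ n) (snd e))"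
proof (induction n)
  case 0
  then show ?case
    using C_on_bounded_linear[OF bounded_linear_snd] by simp
next
  case (Suc n)
  have o: "open (P \<times> (UNIV :: plane set))"
    using assms(2) by (intro open_Times) auto
  have "C_on r (P \<times> UNIV) (\<lambda>e. f (fst e) (snd e))"
    using C_family_imp_C_on[OF _ assms(2) open_UNIV, of r f] assms(1)
    by (simp add: diffeo_family_def case_prod_unfold)
  moreover have "C_on r (P \<times> UNIV) (\<lambda>e. (fst e, (f (fst e) ^^ n) (snd e)))"
    by (intro C_on_Pair[OF o] C_on_bounded_linear bounded_linear_fst Suc)
  moreover have "(\<lambda>e. (fst e, (f (fst e) ^^ n) (snd e))) ` (P \<times> UNIV) \<subseteq> P \<times> UNIV"
    by auto
  ultimately have "C_on r (P \<times> UNIV) (\<lambda>e. f (fst (fst e, (f (fst e) ^^ n) (snd e)))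
      (snd (fst e, (f (fst e) ^^ n) (snd e))))"
    by (rule C_on_compose[OF o o])
  then show ?case
    by simp
qed

lemma dir_deriv_diffeo_nonzero:
  assumes "C_diffeo r UNIV UNIV h" "0 < r" "dir_deriv u h z = 0"
  shows "u = 0"
proof -
  obtain k where k: "homeomorphism UNIV UNIV h k" "C_on r UNIV h" "C_on r UNIV k"
    using assms(1) unfolding C_diffeo_def by blast
  have d: "k differentiable (at (h z))" "h differentiable (at z)"
    using k assms(2) by (auto intro: C_on_imp_differentiable)
  have "dir_deriv u (\<lambda>z. k (h z)) z = dir_deriv 0 k (h z)"
    using dir_deriv_compose[OF d] assms(3) by simp
  also have "\<dots> = 0"
    using linear_0[OF dir_deriv_linear[OF d(1)]] by simp
  finally have "dir_deriv u (\<lambda>z. z) z = 0"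
    using k(1) by (simp add: homeomorphism_def)
  then show ?thesis
    by (simp add: dir_deriv_def)
qed

text \<open>Hyperbolicity bounds the vertical factor from above only; that it does not vanish, as
  its logarithm requires, comes from invertibility of the diffeomorphism.\<close>

lemma dir_deriv_funpow_nonzero:
  assumes h: "C_diffeo r UNIV UNIV h" and r: "0 < r" and u: "dir_deriv u (h ^^ n) z = 0"
  shows "u = 0"
  using u
proof (induction n)
  case 0
  then show ?case
    by (simp add: dir_deriv_def id_def)
next
  case (Suc n)
  have "C_on r UNIV h"
    using h by (auto simp: C_diffeo_def)
  then have d: "h differentiable (at ((h ^^ n) z))" "(h ^^ n) differentiable (at z)"
    using C_on_funpow[of r h n] r by (auto intro: C_on_imp_differentiable)
  have "dir_deriv (dir_deriv u (h ^^ n) z) h ((h ^^ n) z) = 0"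
    using Suc.prems dir_deriv_compose[OF d] by (simp add: o_def)
  from Suc.IH[OF dir_deriv_diffeo_nonzero[OF h r this]] show ?case .
qed

locale hyp_piece =
  fixes cv ch :: real and r :: nat and P :: "'p::euclidean_space set"
    and f :: "'p \<Rightarrow> plane \<Rightarrow> plane" and Y :: "'p \<Rightarrow> plane set" and n :: nat
  assumes cone: "0 < cv" "0 < ch" "cv * ch < 1" and r: "0 < r"
    and P: "open P" and f: "diffeo_family r P f"
    and piece: "persistent_piece cv ch r P f (Y, n)"
    and hyp: "\<And>p. p \<in> P \<Longrightarrow> is_hyperbolic cv ch (f p) (Y p) n"
begin

definition c :: real where "c = sqrt (cv * ch)"

lemma c: "0 < c" "c < 1"
  using cone by (simp_all add: c_def)

definition G :: "'p \<times> plane \<Rightarrow> plane" where "G e = (f (fst e) ^^ n) (snd e)"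

definition \<Omega> :: "('p \<times> plane) set" where "\<Omega> = rep_domain P f (Y, n)"

definition W :: "('p \<times> plane) set" where "W = interior \<Omega>"

definition A :: "'p \<times> plane \<Rightarrow> real" where "A e = rep_A f (Y, n) (fst e) (snd e)"

definition B :: "'p \<times> plane \<Rightarrow> real" where "B e = rep_B f (Y, n) (fst e) (snd e)"

text \<open>The inverse of the map from (p, x_0, y_0) to (p, x_1, y_0). The regularity of A and B is
  that of this inverse.\<close>

definition \<Psi> :: "'p \<times> plane \<Rightarrow> 'p \<times> plane" where "\<Psi> e = (fst e, (A e, snd (snd e)))"

definition \<alpha> :: "'p \<times> plane \<Rightarrow> real" where "\<alpha> e = fst (dir_deriv (0, (1, 0)) G e)"

definition \<beta> :: "'p \<times> plane \<Rightarrow> real" where "\<beta> e = snd (dir_deriv (0, (0, 1)) G e)"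

lemma open_PU: "open (P \<times> (UNIV :: plane set))"
  using P by (intro open_Times) auto

lemma C_on_G: "C_on r (P \<times> UNIV) G"
  unfolding G_def by (rule C_on_family_funpow[OF f P])

lemma G_differentiable: "fst e \<in> P \<Longrightarrow> G differentiable (at e)"
  using C_on_imp_differentiable[OF C_on_G r, of e] by (cases e) simp

lemma dir_deriv_G: "p \<in> P \<Longrightarrow> dir_deriv (0, w) G (p, z) = dir_deriv w (f p ^^ n) z"
  using iter_deriv_slice_snd[OF open_PU C_on_G, of "[w]" p z] r
  by (simp add: iter_deriv_Cons G_def)

lemma diagonal:
  assumes "p \<in> P" "z \<in> Y p"
  shows "dir_deriv (0, h) G (p, z) = (\<alpha> (p, z) * fst h, \<beta> (p, z) * snd h)"
    and "1 \<le> c * \<bar>\<alpha> (p, z)\<bar>" and "\<bar>\<beta> (p, z)\<bar> \<le> c" and "\<alpha> (p, z) \<noteq> 0" and "\<beta> (p, z) \<noteq> 0"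
proof -
  let ?D = "\<lambda>w. dir_deriv w (f p ^^ n) z"
  have diffeo: "C_diffeo r UNIV UNIV (f p)"
    using f assms(1) by (simp add: diffeo_family_def)
  then have "C_on r UNIV (f p)"
    by (auto simp: C_diffeo_def)
  then have lin: "linear ?D"
    using C_on_imp_differentiable[OF C_on_funpow r] dir_deriv_linear by blast
  have h: "\<bar>X\<bar> \<le> c * \<bar>fst (?D (X, Y))\<bar> \<and> \<bar>snd (?D (X, Y))\<bar> \<le> c * \<bar>Y\<bar>" for X Y
    using hyp[OF assms(1)] assms(2) unfolding is_hyperbolic_def c_def
    by (metis dir_deriv_def prod.collapse)
  have ab: "\<alpha> (p, z) = fst (?D (1, 0))" "\<beta> (p, z) = snd (?D (0, 1))"
    using assms(1) by (simp_all add: \<alpha>_def \<beta>_def dir_deriv_G)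
  show eq: "dir_deriv (0, h) G (p, z) = (\<alpha> (p, z) * fst h, \<beta> (p, z) * snd h)" for h
    unfolding ab dir_deriv_G[OF assms(1)] by (rule hyperbolic_diagonal(1)[OF lin h])
  show "1 \<le> c * \<bar>\<alpha> (p, z)\<bar>" "\<bar>\<beta> (p, z)\<bar> \<le> c"
    unfolding ab by (rule hyperbolic_diagonal[OF lin h])+
  then show "\<alpha> (p, z) \<noteq> 0"
    by auto
  show "\<beta> (p, z) \<noteq> 0"
  proof
    assume "\<beta> (p, z) = 0"
    then have "?D (0, 1) = 0"
      using eq[of "(0, 1)"] assms(1) by (simp add: dir_deriv_G zero_prod_def)
    from dir_deriv_funpow_nonzero[OF diffeo r this] show False
      by (simp add: zero_prod_def)
  qed
qed

lemma is_piece: "p \<in> P \<Longrightarrow> is_piece cv ch r (f p) (Y p) n"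
  using piece by (simp add: persistent_piece_def)

lemma slice_inj:
  assumes p: "p \<in> P" and z: "(x, y) \<in> Y p" "(x', y) \<in> Y p"
    and eq: "fst ((f p ^^ n) (x, y)) = fst ((f p ^^ n) (x', y))"
  shows "x = x'"
proof -
  obtain \<psi>m \<psi>p \<phi>m \<phi>p where t: "tame_box_with cv ch r (Y p) \<psi>m \<psi>p \<phi>m \<phi>p"
    using is_piece[OF p] unfolding is_piece_def tame_box_def by blast
  have "C_on r UNIV (f p)"
    using f p by (auto simp: diffeo_family_def C_diffeo_def)
  then have df: "(f p ^^ n) differentiable (at z)" for z
    using C_on_imp_differentiable[OF C_on_funpow r] by blast
  show ?thesis
  proof (rule tame_box_slice_inj[OF t r cone _ _ z, where g = "\<lambda>z. fst ((f p ^^ n) z)" and a = "\<lambda>z. \<alpha> (p, z)"])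
    fix z assume z: "z \<in> Y p"
    have "((\<lambda>z. fst ((f p ^^ n) z)) has_derivative (\<lambda>h. fst (dir_deriv h (f p ^^ n) z))) (at z)"
      by (intro has_derivative_fst has_derivative_dir_deriv df)
    moreover have "fst (dir_deriv h (f p ^^ n) z) = \<alpha> (p, z) * fst h" for h
      using diagonal(1)[OF p z, of h] dir_deriv_G[OF p, of h z] by simp
    ultimately show "((\<lambda>z. fst ((f p ^^ n) z)) has_derivative (\<lambda>h. \<alpha> (p, z) * fst h)) (at z)"
      by simp
    show "\<alpha> (p, z) \<noteq> 0"
      by (rule diagonal(4)[OF p z])
  qed (use eq in simp)
qed

lemma compact_Y:
  assumes "p \<in> P"
  shows "compact (Y p)"
proof -
  obtain \<psi>m \<psi>p \<phi>m \<phi>p where "tame_box_with cv ch r (Y p) \<psi>m \<psi>p \<phi>m \<phi>p"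
    using is_piece[OF assms] unfolding is_piece_def tame_box_def by blast
  then show ?thesis
    by (rule tame_box_with_topology(1))
qed

lemma ex_affine_rep:
  assumes p: "p \<in> P"
  shows "\<exists>A B. is_affine_rep (f p) (Y p) n A B"
proof -
  let ?F = "f p ^^ n"
  obtain b where b: "\<And>z. z \<in> Y p \<Longrightarrow> norm z \<le> b"
    using compact_imp_bounded[OF compact_Y[OF p]] bounded_iff by blast
  have out: "(b + 1, y) \<notin> Y p" for y
    using b[of "(b + 1, y)"] norm_fst_le[of "b + 1" y] by auto
  \<comment> \<open>The representation is an equivalence, so a wrong pair must not satisfy its
    right-hand side. The default \<open>b + 1\<close> lies outside every slice of the box, hence
    \<open>x0 = A (x1, y0)\<close> can hold only where the choice was genuine.\<close>
  define A where "A w = (if \<exists>x. (x, snd w) \<in> Y p \<and> fst (?F (x, snd w)) = fst w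
    then SOME x. (x, snd w) \<in> Y p \<and> fst (?F (x, snd w)) = fst w else b + 1)" for w
  define B where "B w = snd (?F (A w, snd w))" for w
  have A: "fst (?F (A w, snd w)) = fst w" if "(A w, snd w) \<in> Y p" for w
  proof -
    have "\<exists>x. (x, snd w) \<in> Y p \<and> fst (?F (x, snd w)) = fst w"
    proof (rule ccontr)
      assume "\<not> ?thesis"
      then have "A w = b + 1"
        unfolding A_def by (rule if_not_P)
      with that out show False
        by simp
    qed
    from someI_ex[OF this] this show ?thesis
      unfolding A_def by simp
  qed
  have Ax: "A (x1, y0) = x0" if "(x0, y0) \<in> Y p" "fst (?F (x0, y0)) = x1" for x0 y0 x1
  proof -
    have ex: "\<exists>x. (x, snd (x1, y0)) \<in> Y p \<and> fst (?F (x, snd (x1, y0))) = fst (x1, y0)"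
      using that by auto
    from someI_ex[OF ex] ex
    have "(A (x1, y0), y0) \<in> Y p" "fst (?F (A (x1, y0), y0)) = x1"
      unfolding A_def by simp_all
    then show ?thesis
      using slice_inj[OF p, of "A (x1, y0)" y0 x0] that by simp
  qed
  have "is_affine_rep (f p) (Y p) n A B"
    unfolding is_affine_rep_def
  proof (intro allI impI, elim conjE)
    fix x0 y0 x1 y1 assume z: "(x0, y0) \<in> Y p"
    show "?F (x0, y0) = (x1, y1) \<longleftrightarrow> x0 = A (x1, y0) \<and> y1 = B (x1, y0)"
    proof
      assume "?F (x0, y0) = (x1, y1)"
      then show "x0 = A (x1, y0) \<and> y1 = B (x1, y0)"
        using Ax[OF z] by (simp add: B_def)
    next
      assume e: "x0 = A (x1, y0) \<and> y1 = B (x1, y0)"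
      then have "fst (?F (x0, y0)) = x1" "snd (?F (x0, y0)) = y1"
        using A[of "(x1, y0)"] z by (simp_all add: B_def)
      then show "?F (x0, y0) = (x1, y1)"
        by (simp add: prod_eq_iff)
    qed
  qed
  then show ?thesis
    by blast
qed

lemma affine_rep:
  assumes "p \<in> P" "(x0, y0) \<in> Y p" "(f p ^^ n) (x0, y0) = (x1, y1)"
  shows "A (p, (x1, y0)) = x0" "B (p, (x1, y0)) = y1"
proof -
  have "\<exists>ab. case_prod (is_affine_rep (f p) (Y p) n) ab"
    using ex_affine_rep[OF assms(1)] by auto
  from someI_ex[OF this]
  have "is_affine_rep (f p) (Y p) n (fst (affine_rep (f p) (Y p) n)) (snd (affine_rep (f p) (Y p) n))"
    unfolding affine_rep_def by (simp add: case_prod_unfold)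
  then have "is_affine_rep (f p) (Y p) n (rep_A f (Y, n) p) (rep_B f (Y, n) p)"
    by (simp add: rep_A_def rep_B_def)
  moreover have "(x1, y1) \<in> (f p ^^ n) ` Y p"
    using assms by (metis image_eqI)
  ultimately show "A (p, (x1, y0)) = x0" "B (p, (x1, y0)) = y1"
    using assms unfolding is_affine_rep_def by (auto simp: A_def B_def)
qed

lemma \<Psi>_of:
  assumes "fst e \<in> P" "snd e \<in> Y (fst e)"
  shows "\<Psi> (fst e, (fst (G e), snd (snd e))) = e" "B (fst e, (fst (G e), snd (snd e))) = snd (G e)"
    "(fst e, (fst (G e), snd (snd e))) \<in> \<Omega>"
proof -
  have eq: "(f (fst e) ^^ n) (fst (snd e), snd (snd e)) = (fst (G e), snd (G e))"
    by (simp add: G_def)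
  have Y: "(fst (snd e), snd (snd e)) \<in> Y (fst e)"
    using assms(2) by simp
  show "\<Psi> (fst e, (fst (G e), snd (snd e))) = e" "B (fst e, (fst (G e), snd (snd e))) = snd (G e)"
    using affine_rep[OF assms(1) Y eq] by (simp_all add: \<Psi>_def prod_eq_iff)
  show "(fst e, (fst (G e), snd (snd e))) \<in> \<Omega>"
    unfolding \<Omega>_def rep_domain_def using assms(1) Y eq by blast
qed

lemma \<Omega>D:
  assumes "e \<in> \<Omega>"
  shows "fst e \<in> P" "snd (\<Psi> e) \<in> Y (fst e)" "G (\<Psi> e) = (fst (snd e), B e)"
proof -
  obtain p x1 y0 x0 y1 where *: "e = (p, (x1, y0))" "p \<in> P" "(x0, y0) \<in> Y p" "(f p ^^ n) (x0, y0) = (x1, y1)"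
    using assms unfolding \<Omega>_def rep_domain_def by auto
  then show "fst e \<in> P" "snd (\<Psi> e) \<in> Y (fst e)" "G (\<Psi> e) = (fst (snd e), B e)"
    using affine_rep[OF *(2-4)] by (simp_all add: \<Psi>_def G_def)
qed

lemma open_W: "open W"
  by (simp add: W_def)

lemma W_subset: "W \<subseteq> \<Omega>"
  by (simp add: W_def interior_subset)

lemmas WD = \<Omega>D[OF subsetD[OF W_subset]]

lemma fst_\<Psi> [simp]: "fst (\<Psi> e) = fst e"
  by (simp add: \<Psi>_def)

lemma snd_snd_\<Psi> [simp]: "snd (snd (\<Psi> e)) = snd (snd e)"
  by (simp add: \<Psi>_def)

text \<open>A continuous injection on a compact set has a continuous inverse, and the piece over a
  closed ball of parameters is compact. The pointwise inverse function theorem, used next, takes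
  this continuity as an input.\<close>

lemma continuous_\<Psi>:
  assumes e: "e \<in> W"
  shows "continuous (at e) \<Psi>"
proof -
  have "fst e \<in> P"
    using WD(1)[OF e] .
  then obtain \<rho> where \<rho>: "0 < \<rho>" "cball (fst e) \<rho> \<subseteq> P"
    using P open_contains_cball by blast
  let ?C = "cball (fst e) \<rho>" and ?\<Phi> = "\<lambda>e. (fst e, (fst (G e), snd (snd e)))"
  let ?S = "{(p, z). p \<in> ?C \<and> z \<in> Y p}"
  have comp: "compact ?S"
    by (rule compact_persistent_piece[OF piece _ \<rho>(2)]) simp
  have "?S \<subseteq> P \<times> UNIV"
    using \<rho>(2) by auto
  then have "continuous_on ?S G"
    using C_on_imp_continuous[OF C_on_G] continuous_on_subset by blast
  then have "continuous_on ?S ?\<Phi>"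
    by (intro continuous_intros)
  then have "continuous_on (?\<Phi> ` ?S) \<Psi>"
  proof (rule continuous_on_inv[OF _ comp])
    show "\<forall>e\<in>?S. \<Psi> (?\<Phi> e) = e"
      using \<Psi>_of(1) \<rho>(2) by auto
  qed
  moreover have "W \<inter> ball (fst e) \<rho> \<times> UNIV \<subseteq> ?\<Phi> ` ?S"
  proof
    fix e' assume e': "e' \<in> W \<inter> ball (fst e) \<rho> \<times> UNIV"
    show "e' \<in> ?\<Phi> ` ?S"
    proof (rule image_eqI)
      show "e' = ?\<Phi> (\<Psi> e')"
        using WD(3)[of e'] e' by (simp add: prod_eq_iff)
      show "\<Psi> e' \<in> ?S"
        using WD(2)[of e'] e' by (auto simp: case_prod_unfold mem_Times_iff)
    qed
  qed
  ultimately have "continuous_on (W \<inter> ball (fst e) \<rho> \<times> UNIV) \<Psi>"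
    by (rule continuous_on_subset)
  moreover have "open (W \<inter> ball (fst e) \<rho> \<times> UNIV)" "e \<in> W \<inter> ball (fst e) \<rho> \<times> UNIV"
    using e \<rho>(1) by (auto intro!: open_Int open_Times open_W simp: mem_Times_iff)
  ultimately show ?thesis
    using continuous_on_eq_continuous_at by blast
qed

text \<open>Implicit differentiation of \<open>fst (G (p, (A, y)))\<close> = x, where y is the
  second phase coordinate. It contributes nothing, because the phase differential is
  diagonal.\<close>

definition dA :: "'p \<times> plane \<Rightarrow> 'p \<times> plane \<Rightarrow> real" where
  "dA u e = (fst (snd u) - fst (dir_deriv (fst u, 0) G (\<Psi> e))) * inverse (\<alpha> (\<Psi> e))"

lemma has_derivative_\<Psi>:
  assumes e: "e \<in> W"
  shows "(\<Psi> has_derivative (\<lambda>u. (fst u, (dA u e, snd (snd u))))) (at e)"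
proof -
  note eW = WD[OF e]
  let ?z = "snd (\<Psi> e)"
  have \<Psi>e: "\<Psi> e = (fst e, ?z)"
    by (simp add: prod_eq_iff)
  have df: "G differentiable (at (\<Psi> e))"
    using eW(1) by (intro G_differentiable) simp
  interpret lin: linear "\<lambda>u. dir_deriv u G (\<Psi> e)"
    using df by (rule dir_deriv_linear)
  have split: "fst (dir_deriv u G (\<Psi> e)) = fst (dir_deriv (fst u, 0) G (\<Psi> e)) + \<alpha> (\<Psi> e) * fst (snd u)" for u
  proof -
    have "u = (fst u, 0) + (0, snd u)"
      by (simp add: prod_eq_iff)
    then have "dir_deriv u G (\<Psi> e) = dir_deriv (fst u, 0) G (\<Psi> e) + dir_deriv (0, snd u) G (\<Psi> e)"
      by (metis lin.add)
    then show ?thesis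
      using diagonal(1)[OF eW(1,2), of "snd u"] \<Psi>e by simp
  qed
  have nz: "\<alpha> (\<Psi> e) \<noteq> 0"
    using diagonal(4)[OF eW(1,2)] \<Psi>e by simp
  show ?thesis
  proof (rule has_derivative_inverse_basic[OF _ _ _ continuous_\<Psi>[OF e] open_W e])
    show "((\<lambda>e. (fst e, (fst (G e), snd (snd e)))) has_derivative
        (\<lambda>u. (fst u, (fst (dir_deriv u G (\<Psi> e)), snd (snd u))))) (at (\<Psi> e))"
      by (intro has_derivative_Pair has_derivative_fst has_derivative_snd has_derivative_ident
          has_derivative_dir_deriv df)
    have "linear (\<lambda>u. (fst u, (dA u e, snd (snd u))))"
    proof (rule linearI)
      have p: "(v + v', 0) = (v, 0) + (v', 0::plane)" "(s *\<^sub>R v, 0) = s *\<^sub>R (v, 0::plane)" for v v' :: 'p and s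
        by simp_all
      fix u u' :: "'p \<times> plane" and s :: real
      show "(fst (u + u'), (dA (u + u') e, snd (snd (u + u')))) =
          (fst u, (dA u e, snd (snd u))) + (fst u', (dA u' e, snd (snd u')))"
        by (simp only: dA_def p fst_add snd_add lin.add) (simp add: algebra_simps)
      show "(fst (s *\<^sub>R u), (dA (s *\<^sub>R u) e, snd (snd (s *\<^sub>R u)))) = s *\<^sub>R (fst u, (dA u e, snd (snd u)))"
        by (simp only: dA_def p fst_scaleR snd_scaleR lin.scaleR) (simp add: algebra_simps)
    qed
    then show "bounded_linear (\<lambda>u. (fst u, (dA u e, snd (snd u))))"
      by (simp add: linear_conv_bounded_linear)
    show "(\<lambda>u. (fst u, (dA u e, snd (snd u)))) \<circ>
        (\<lambda>u. (fst u, (fst (dir_deriv u G (\<Psi> e)), snd (snd u)))) = id"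
    proof -
      have "dA (fst u, (fst (dir_deriv u G (\<Psi> e)), snd (snd u))) e = fst (snd u)" for u
        using split[of u] nz by (simp add: dA_def)
      then show ?thesis
        by (simp add: fun_eq_iff)
    qed
    show "(fst (\<Psi> e'), (fst (G (\<Psi> e')), snd (snd (\<Psi> e')))) = e'" if "e' \<in> W" for e'
      using WD(3)[OF that] by (simp add: prod_eq_iff)
  qed
qed

lemma \<Psi>_in: "\<Psi> ` W \<subseteq> P \<times> UNIV"
  using WD(1) by (auto simp: \<Psi>_def)

text \<open>A bootstrap: the derivative of \<Psi> is an expression in derivatives of
  \<open>G\<close> at \<Psi> itself, so each order of regularity of \<Psi> yields the next until
  that of \<open>G\<close> is used up.\<close>

lemma C_on_\<Psi>: "k \<le> r \<Longrightarrow> C_on k W \<Psi>"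
proof (induction k)
  case 0
  show ?case
    unfolding C_on_0 by (intro continuous_at_imp_continuous_on ballI continuous_\<Psi>)
next
  case (Suc k)
  then have \<Psi>: "C_on k W \<Psi>"
    by simp
  have "C_on (Suc k) (P \<times> UNIV) G"
    using C_on_mono[OF C_on_G Suc.prems] .
  then have comp: "C_on k W (\<lambda>e. dir_deriv v G (\<Psi> e))" for v
    by (intro C_on_compose[OF open_W open_PU C_on_dir_deriv \<Psi> \<Psi>_in])
  show ?case
  proof (rule C_on_SucI[OF open_W has_derivative_\<Psi>])
    fix u :: "'p \<times> plane"
    have "C_on k W (\<lambda>e. inverse (\<alpha> (\<Psi> e)))"
    proof (rule C_on_inverse[OF open_W])
      show "C_on k W (\<lambda>e. \<alpha> (\<Psi> e))"
        unfolding \<alpha>_def by (rule C_on_fst[OF open_W comp])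
      show "\<alpha> (\<Psi> e) \<noteq> 0" if "e \<in> W" for e
        using diagonal(4)[OF WD(1,2)[OF that]] by (simp add: \<Psi>_def)
    qed
    then have "C_on k W (dA u)"
      unfolding dA_def
      by (intro C_on_mult[OF open_W] C_on_diff[OF open_W] C_on_const C_on_fst[OF open_W] comp)
    then show "C_on k W (\<lambda>e. (fst u, (dA u e, snd (snd u))))"
      by (intro C_on_Pair[OF open_W] C_on_const)
  qed
qed

lemma A_eq: "A e = fst (snd (\<Psi> e))"
  by (simp add: \<Psi>_def)

lemma C_on_A: "C_on r W A"
  unfolding A_eq[abs_def] by (intro C_on_fst C_on_snd open_W C_on_\<Psi>) simp

lemma C_on_B: "C_on r W B"
proof -
  have "C_on r W (\<lambda>e. snd (G (\<Psi> e)))"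
    by (intro C_on_snd[OF open_W] C_on_compose[OF open_W open_PU C_on_G C_on_\<Psi> \<Psi>_in]) simp
  then show ?thesis
    using C_on_cong[OF open_W, of B "\<lambda>e. snd (G (\<Psi> e))" r] WD(3) by simp
qed

lemma dir_deriv_A:
  assumes "e \<in> W"
  shows "dir_deriv u A e = dA u e"
proof -
  have "((\<lambda>e. fst (snd (\<Psi> e))) has_derivative (\<lambda>u. fst (snd (fst u, (dA u e, snd (snd u)))))) (at e)"
    by (intro has_derivative_fst has_derivative_snd has_derivative_\<Psi> assms)
  then show ?thesis
    unfolding A_eq[abs_def] by (simp add: dir_deriv_eq)
qed

lemma dA_phase:
  assumes "e \<in> W"
  shows "dA (0, w) e = fst w * inverse (\<alpha> (\<Psi> e))"
proof -
  have "G differentiable (at (\<Psi> e))"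
    using WD(1)[OF assms] by (intro G_differentiable) simp
  from linear_0[OF dir_deriv_linear[OF this]] show ?thesis
    by (simp add: dA_def zero_prod_def)
qed

lemma dir_deriv_A_phase:
  assumes "e \<in> W"
  shows "dir_deriv (0, w) A e = fst w * inverse (\<alpha> (\<Psi> e))"
  using dir_deriv_A[OF assms] dA_phase[OF assms] by simp

lemma dir_deriv_B_phase:
  assumes "e \<in> W"
  shows "dir_deriv (0, w) B e = snd w * \<beta> (\<Psi> e)"
proof -
  have \<Psi>e: "\<Psi> e = (fst e, snd (\<Psi> e))"
    by (simp add: prod_eq_iff)
  have df: "G differentiable (at (\<Psi> e))"
    using WD(1)[OF assms] by (intro G_differentiable) simp
  have "((\<lambda>e. snd (G (\<Psi> e))) has_derivative
      (\<lambda>u. snd (dir_deriv (fst u, (dA u e, snd (snd u))) G (\<Psi> e)))) (at e)"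
    by (intro has_derivative_snd has_derivative_compose[OF has_derivative_\<Psi>[OF assms] has_derivative_dir_deriv[OF df]])
  then have "dir_deriv (0, w) (\<lambda>e. snd (G (\<Psi> e))) e = snd (dir_deriv (0, (dA (0, w) e, snd w)) G (\<Psi> e))"
    by (simp add: dir_deriv_eq)
  also have "\<dots> = snd w * \<beta> (\<Psi> e)"
    using diagonal(1)[OF WD(1,2)[OF assms], of "(dA (0, w) e, snd w)"] \<Psi>e by simp
  also have "dir_deriv (0, w) (\<lambda>e. snd (G (\<Psi> e))) e = dir_deriv (0, w) B e"
    using WD(3) by (intro dir_deriv_cong_open[OF open_W assms]) simp
  finally show ?thesis .
qed

lemma contraction_A:
  assumes "e \<in> W"
  shows "\<bar>dir_deriv (0, (1, 0)) A e\<bar> \<le> c" "dir_deriv (0, (1, 0)) A e \<noteq> 0"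
proof -
  have "1 \<le> c * \<bar>\<alpha> (\<Psi> e)\<bar>" "\<alpha> (\<Psi> e) \<noteq> 0"
    using diagonal(2,4)[OF WD(1,2)[OF assms]] by (simp_all add: \<Psi>_def)
  then show "\<bar>dir_deriv (0, (1, 0)) A e\<bar> \<le> c" "dir_deriv (0, (1, 0)) A e \<noteq> 0"
    by (simp_all add: dir_deriv_A_phase[OF assms] abs_inverse field_simps)
qed

lemma contraction_B:
  assumes "e \<in> W"
  shows "\<bar>dir_deriv (0, (0, 1)) B e\<bar> \<le> c" "dir_deriv (0, (0, 1)) B e \<noteq> 0"
  using diagonal(3,5)[OF WD(1,2)[OF assms]]
  by (simp_all add: dir_deriv_B_phase[OF assms] \<Psi>_def)

lemma depends_A: "depends r (1, 0) W A"
  by (rule dependsI[OF open_W C_on_A]) (simp add: dir_deriv_A_phase inner_prod_def)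

lemma depends_B: "depends r (0, 1) W B"
  by (rule dependsI[OF open_W C_on_B]) (simp add: dir_deriv_B_phase inner_prod_def)

end


section \<open>Translation between the norms in the distortions and bounds on words\<close>

section \<open>Distortions in terms of words\<close>

lemma deriv_norm_le:
  assumes "0 \<le> K"
  shows "deriv_norm i j g p x \<le> ennreal K \<longleftrightarrow>
    (\<forall>vs ws. length vs = i \<longrightarrow> length ws = j \<longrightarrow> (\<forall>v\<in>set vs. norm v \<le> 1) \<longrightarrow>
      (\<forall>w\<in>set ws. norm w \<le> 1) \<longrightarrow> norm (fam_deriv vs ws g p x) \<le> K)"
  unfolding deriv_norm_def using assms by (auto simp: SUP_le_iff)

lemma C_norm_le:
  assumes "0 \<le> K"
  shows "C_norm d s \<Omega> g \<le> ennreal K \<longleftrightarrow>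
    (\<forall>vs ws p x. int (length vs) \<le> d \<longrightarrow> int (length vs + length ws) \<le> s \<longrightarrow>
      (\<forall>v\<in>set vs. norm v \<le> 1) \<longrightarrow> (\<forall>w\<in>set ws. norm w \<le> 1) \<longrightarrow> (p, x) \<in> interior \<Omega> \<longrightarrow>
      norm (fam_deriv vs ws g p x) \<le> K)"
proof -
  have "C_norm d s \<Omega> g \<le> ennreal K \<longleftrightarrow> (\<forall>i j p x. int i \<le> d \<longrightarrow> int (i + j) \<le> s \<longrightarrow>
      (p, x) \<in> interior \<Omega> \<longrightarrow> deriv_norm i j g p x \<le> ennreal K)"
    unfolding C_norm_def by (auto simp: SUP_le_iff Ball_def)
  then show ?thesis
    unfolding deriv_norm_le[OF assms] by blast
qed

definition word :: "'p::euclidean_space list \<Rightarrow> 'z::euclidean_space list \<Rightarrow> ('p \<times> 'z) list" where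
  "word vs ws = map (\<lambda>v. (v, 0)) vs @ map (Pair 0) ws"

lemma admissible_word:
  assumes "length vs \<le> d" "length vs + length ws \<le> n"
    and "\<forall>v\<in>set vs. norm v \<le> 1" "\<forall>w\<in>set ws. norm w \<le> 1"
  shows "admissible d n (word vs ws)"
  using assms by (auto simp: admissible_def word_def intro: order_trans[OF length_filter_le])

text \<open>The norms see only sorted words, parameter letters before phase letters. Together with
  \<open>iter_deriv_perm\<close> this recovers all admissible words.\<close>

lemma admissible_sort:
  assumes "admissible d n \<beta>"
  obtains vs ws where "mset (word vs ws) = mset \<beta>" "length vs \<le> d" "length vs + length ws \<le> n"
    "\<forall>v\<in>set vs. norm v \<le> 1" "\<forall>w\<in>set ws. norm w \<le> 1"
proof
  let ?vs = "map fst (filter (\<lambda>u. fst u \<noteq> 0) \<beta>)" and ?ws = "map snd (filter (\<lambda>u. \<not> fst u \<noteq> 0) \<beta>)"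
  have "map (\<lambda>v. (v, 0)) ?vs = filter (\<lambda>u. fst u \<noteq> 0) \<beta>"
    unfolding map_map o_def
  proof (rule map_idI)
    fix u assume "u \<in> set (filter (\<lambda>u. fst u \<noteq> 0) \<beta>)"
    then have "snd u = 0"
      using assms by (auto simp: admissible_def dest!: bspec[of _ _ u])
    then show "(fst u, 0) = u"
      by (simp add: prod_eq_iff)
  qed
  moreover have "map (Pair 0) ?ws = filter (\<lambda>u. \<not> fst u \<noteq> 0) \<beta>"
    by (auto simp: prod_eq_iff intro!: map_idI)
  ultimately show "mset (word ?vs ?ws) = mset \<beta>"
    unfolding word_def mset_append by (simp only: mset_filter multiset_partition[symmetric])
  have "length (filter P \<beta>) + length (filter (\<lambda>x. \<not> P x) \<beta>) = length \<beta>" for P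
    by (rule sum_length_filter_compl)
  then show "length ?vs + length ?ws \<le> n"
    using assms by (simp only: admissible_def length_map)
  show "length ?vs \<le> d"
    using assms by (simp add: admissible_def)
  have "norm (fst u) \<le> 1" "norm (snd u) \<le> 1" if "u \<in> set \<beta>" for u
    using assms that norm_fst_le[of "fst u" "snd u"] norm_snd_le[of "snd u" "fst u"]
    by (force simp: admissible_def)+
  then show "\<forall>v\<in>set ?vs. norm v \<le> 1" "\<forall>w\<in>set ?ws. norm w \<le> 1"
    by auto
qed

lemma iter_deriv_Pair:
  assumes W: "open W" and C: "C_on n W g" "C_on n W h" and "length us \<le> n" "e \<in> W"
  shows "iter_deriv us (\<lambda>e. (g e, h e)) e = (iter_deriv us g e, iter_deriv us h e)"
  using iter_deriv_linear_compose[OF W bounded_linear_fst C_on_Pair[OF W C] assms(4,5)]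
    iter_deriv_linear_compose[OF W bounded_linear_snd C_on_Pair[OF W C] assms(4,5)]
  by (simp add: prod_eq_iff)

lemma fam_deriv_Pair:
  assumes W: "open W" and C: "C_on n W g" "C_on n W h"
    and g: "\<And>p z. (p, z) \<in> W \<Longrightarrow> F p z = (g (p, z), h (p, z))"
    and len: "length vs + length ws \<le> n" and e: "(p, z) \<in> W"
  shows "fam_deriv vs ws F p z = (iter_deriv (word vs ws) g (p, z), iter_deriv (word vs ws) h (p, z))"
proof -
  have "fam_deriv vs ws F p z = iter_deriv (word vs ws) (\<lambda>e. (g e, h e)) (p, z)"
    unfolding word_def by (rule fam_deriv_joint[OF W C_on_Pair[OF W C] len e g])
  also have "\<dots> = (iter_deriv (word vs ws) g (p, z), iter_deriv (word vs ws) h (p, z))"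
    by (rule iter_deriv_Pair[OF W C _ e]) (use len in \<open>simp add: word_def\<close>)
  finally show ?thesis .
qed

text \<open>The \<open>min\<close> serves two distortions: it is d for n = r, where d is at most r,
  and it is the order d' of \<open>distortion_1\<close> for n = r - 2.\<close>

lemma C_norm_le_imp_word:
  assumes K: "0 \<le> K" and W: "W = interior \<Omega>" and C: "C_on n W g" "C_on n W h"
    and g: "\<And>p z. (p, z) \<in> W \<Longrightarrow> F p z = (g (p, z), h (p, z))"
    and le: "C_norm (min (int d) (int n)) (int n) \<Omega> F \<le> ennreal K"
    and \<beta>: "admissible d n \<beta>" and e: "e \<in> W"
  shows "norm (iter_deriv \<beta> g e) \<le> K" "norm (iter_deriv \<beta> h e) \<le> K"
proof -
  obtain p z where pz: "e = (p, z)"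
    by (cases e)
  obtain vs ws where w: "mset (word vs ws) = mset \<beta>" "length vs \<le> d" "length vs + length ws \<le> n"
    "\<forall>v\<in>set vs. norm v \<le> 1" "\<forall>w\<in>set ws. norm w \<le> 1"
    using admissible_sort[OF \<beta>] .
  have oW: "open W"
    by (simp add: W)
  have len: "length (word vs ws) \<le> n"
    using w by (simp add: word_def)
  have "norm (fam_deriv vs ws F p z) \<le> K"
    using le w e unfolding C_norm_le[OF K] W pz by simp
  also have "fam_deriv vs ws F p z = (iter_deriv (word vs ws) g e, iter_deriv (word vs ws) h e)"
    using fam_deriv_Pair[OF oW C g w(3)] e unfolding pz by blast
  also have "\<dots> = (iter_deriv \<beta> g e, iter_deriv \<beta> h e)"
    by (simp only: iter_deriv_perm[OF oW C(1) e len w(1)] iter_deriv_perm[OF oW C(2) e len w(1)])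
  finally have le: "norm (iter_deriv \<beta> g e, iter_deriv \<beta> h e) \<le> K" .
  show "norm (iter_deriv \<beta> g e) \<le> K" "norm (iter_deriv \<beta> h e) \<le> K"
    by (rule order_trans[OF norm_fst_le le] order_trans[OF norm_snd_le le])+
qed

text \<open>The factor 2 comes from bounding the norm of a pair by the sum of the norms of its
  components.\<close>

lemma C_norm_leI:
  assumes K: "0 \<le> K" and W: "W = interior \<Omega>" and C: "C_on n W g" "C_on n W h"
    and g: "\<And>p z. (p, z) \<in> W \<Longrightarrow> F p z = (g (p, z), h (p, z))"
    and le: "\<And>\<beta> e. admissible d n \<beta> \<Longrightarrow> e \<in> W \<Longrightarrow>
      norm (iter_deriv \<beta> g e) \<le> K \<and> norm (iter_deriv \<beta> h e) \<le> K"
  shows "C_norm (min (int d) (int n)) (int n) \<Omega> F \<le> ennreal (2 * K)"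
proof -
  have "norm (fam_deriv vs ws F p z) \<le> 2 * K"
    if w: "length vs \<le> d" "length vs + length ws \<le> n"
      "\<forall>v\<in>set vs. norm v \<le> 1" "\<forall>w\<in>set ws. norm w \<le> 1" and e: "(p, z) \<in> W" for vs ws p z
  proof -
    have "open W"
      by (simp add: W)
    from fam_deriv_Pair[OF this C g w(2) e]
    have "norm (fam_deriv vs ws F p z)
        \<le> norm (iter_deriv (word vs ws) g (p, z)) + norm (iter_deriv (word vs ws) h (p, z))"
      by (simp add: norm_Pair_le)
    also have "\<dots> \<le> 2 * K"
      using le[OF admissible_word[OF w] e] by simp
    finally show ?thesis .
  qed
  moreover have "0 \<le> 2 * K"
    using K by simp
  ultimately show ?thesis
    using C_norm_le[of "2 * K" "min (int d) (int n)" "int n" \<Omega> F] unfolding W by simp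
qed

lemma depends_ln:
  assumes V: "open V" and \<phi>: "depends r q V \<phi>" and r: "0 < r"
    and nz: "\<And>e. e \<in> V \<Longrightarrow> dir_deriv (0, q) \<phi> e \<noteq> 0"
  shows "depends (r - 1) q V (\<lambda>e. ln \<bar>dir_deriv (0, q) \<phi> e\<bar>)"
proof (rule dependsI[OF V])
  have "C_on (Suc (r - 1)) V \<phi>"
    using \<phi> r by (simp add: depends_def)
  then have C: "C_on (r - 1) V (dir_deriv (0, q) \<phi>)"
    by (rule C_on_dir_deriv)
  then show "C_on (r - 1) V (\<lambda>e. ln \<bar>dir_deriv (0, q) \<phi> e\<bar>)"
    using nz by (rule C_on_ln_abs[OF V])
  fix w e assume r1: "0 < r - 1" and w: "w \<bullet> q = 0" and e: "e \<in> V"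
  have "((\<lambda>e. ln \<bar>dir_deriv (0, q) \<phi> e\<bar>) has_derivative
      (\<lambda>u. dir_deriv u (dir_deriv (0, q) \<phi>) e * inverse (dir_deriv (0, q) \<phi> e))) (at e)"
    using C_on_imp_differentiable[OF C r1 e] nz[OF e]
    by (intro has_derivative_ln_abs has_derivative_dir_deriv)
  from dir_deriv_eq[OF this, of "(0, w)"]
  have "dir_deriv (0, w) (\<lambda>e. ln \<bar>dir_deriv (0, q) \<phi> e\<bar>) e
      = dir_deriv (0, w) (iter_deriv [(0, q)] \<phi>) e * inverse (dir_deriv (0, q) \<phi> e)"
    by (simp add: iter_deriv_Cons)
  also have "dir_deriv (0, w) (iter_deriv [(0, q)] \<phi>) e = 0"
    using \<phi> w e r1 unfolding depends_def by simp
  finally show "dir_deriv (0, w) (\<lambda>e. ln \<bar>dir_deriv (0, q) \<phi> e\<bar>) e = 0"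
    by simp
qed

lemma partial_x_slice:
  fixes g :: "'p::euclidean_space \<times> plane \<Rightarrow> real"
  assumes "g differentiable (at (p, z))"
  shows "partial_x (\<lambda>z. g (p, z)) z = dir_deriv (0, (1, 0)) g (p, z)"
proof -
  obtain x y where z: "z = (x, y)"
    by (cases z)
  have "((\<lambda>s. (p, (s, y))) has_derivative (\<lambda>h. (0, (h, 0)))) (at x)"
    by (intro has_derivative_Pair has_derivative_const has_derivative_ident)
  from has_derivative_compose[OF this has_derivative_dir_deriv[OF assms[unfolded z]]]
  have D: "((\<lambda>s. g (p, (s, y))) has_derivative (\<lambda>h. dir_deriv (0, (h, 0)) g (p, (x, y)))) (at x)" .
  have "(\<lambda>h. dir_deriv (0, (h, 0)) g (p, (x, y))) = (*) (dir_deriv (0, (1, 0)) g (p, (x, y)))"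
  proof (rule ext)
    fix h
    have "dir_deriv (h *\<^sub>R (0, (1, 0))) g (p, (x, y)) = h *\<^sub>R dir_deriv (0, (1, 0)) g (p, (x, y))"
      by (rule linear_scale[OF dir_deriv_linear[OF assms[unfolded z]]])
    then show "dir_deriv (0, (h, 0)) g (p, (x, y)) = dir_deriv (0, (1, 0)) g (p, (x, y)) * h"
      by (simp add: mult.commute)
  qed
  with D have "((\<lambda>s. g (p, (s, y))) has_real_derivative dir_deriv (0, (1, 0)) g (p, (x, y))) (at x)"
    by (simp only: has_field_derivative_def)
  then show ?thesis
    by (simp add: partial_x_def z DERIV_imp_deriv)
qed

lemma partial_y_slice:
  fixes g :: "'p::euclidean_space \<times> plane \<Rightarrow> real"
  assumes "g differentiable (at (p, z))"
  shows "partial_y (\<lambda>z. g (p, z)) z = dir_deriv (0, (0, 1)) g (p, z)"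
proof -
  obtain x y where z: "z = (x, y)"
    by (cases z)
  have "((\<lambda>s. (p, (x, s))) has_derivative (\<lambda>h. (0, (0, h)))) (at y)"
    by (intro has_derivative_Pair has_derivative_const has_derivative_ident)
  from has_derivative_compose[OF this has_derivative_dir_deriv[OF assms[unfolded z]]]
  have D: "((\<lambda>s. g (p, (x, s))) has_derivative (\<lambda>h. dir_deriv (0, (0, h)) g (p, (x, y)))) (at y)" .
  have "(\<lambda>h. dir_deriv (0, (0, h)) g (p, (x, y))) = (*) (dir_deriv (0, (0, 1)) g (p, (x, y)))"
  proof (rule ext)
    fix h
    have "dir_deriv (h *\<^sub>R (0, (0, 1))) g (p, (x, y)) = h *\<^sub>R dir_deriv (0, (0, 1)) g (p, (x, y))"
      by (rule linear_scale[OF dir_deriv_linear[OF assms[unfolded z]]])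
    then show "dir_deriv (0, (0, h)) g (p, (x, y)) = dir_deriv (0, (0, 1)) g (p, (x, y)) * h"
      by (simp add: mult.commute)
  qed
  with D have "((\<lambda>s. g (p, (x, s))) has_real_derivative dir_deriv (0, (0, 1)) g (p, (x, y))) (at y)"
    by (simp only: has_field_derivative_def)
  then show ?thesis
    by (simp add: partial_y_def z DERIV_imp_deriv)
qed

lemma differential_slice:
  fixes g :: "'p::euclidean_space \<times> plane \<Rightarrow> real"
  assumes W: "open W" and C: "C_on n W g" "0 < n" and e: "(p, z) \<in> W"
    and eq: "\<And>w. (p, w) \<in> W \<Longrightarrow> h w = g (p, w)"
  shows "differential h z = (dir_deriv (0, (1, 0)) g (p, z), dir_deriv (0, (0, 1)) g (p, z))"
proof -
  have o: "open {w. (p, w) \<in> W}"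
    using open_vimage[OF W, of "Pair p"] by (simp add: vimage_def continuous_on_Pair)
  have "dir_deriv u h z = dir_deriv (0, u) g (p, z)" for u
  proof -
    have "dir_deriv u h z = dir_deriv u (\<lambda>w. g (p, w)) z"
      using eq e by (intro dir_deriv_cong_open[OF o]) auto
    then show ?thesis
      using iter_deriv_slice_snd[OF W C(1) _ e, of "[u]"] C(2) by (simp add: iter_deriv_Cons)
  qed
  then show ?thesis
    by (simp add: differential_def dir_deriv_def)
qed

context hyp_piece
begin

definition lA :: "'p \<times> plane \<Rightarrow> real" where "lA e = ln \<bar>dir_deriv (0, (1, 0)) A e\<bar>"

definition lB :: "'p \<times> plane \<Rightarrow> real" where "lB e = ln \<bar>dir_deriv (0, (0, 1)) B e\<bar>"

lemma depends_lA: "depends (r - 1) (1, 0) W lA"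
  unfolding lA_def[abs_def] using contraction_A by (intro depends_ln open_W depends_A r) auto

lemma depends_lB: "depends (r - 1) (0, 1) W lB"
  unfolding lB_def[abs_def] using contraction_B by (intro depends_ln open_W depends_B r) auto

lemma rep_A_slice: "rep_A f (Y, n) p = (\<lambda>z. A (p, z))"
  by (simp add: A_def)

lemma rep_B_slice: "rep_B f (Y, n) p = (\<lambda>z. B (p, z))"
  by (simp add: B_def)

lemma W_eq: "W = interior (rep_domain P f (Y, n))"
  by (simp add: W_def \<Omega>_def)

lemma partial_A: "(p, z) \<in> W \<Longrightarrow> ln \<bar>partial_x (rep_A f (Y, n) p) z\<bar> = lA (p, z)"
  unfolding rep_A_slice lA_def using partial_x_slice[OF C_on_imp_differentiable[OF C_on_A r]] by simp

lemma partial_B: "(p, z) \<in> W \<Longrightarrow> partial_y (rep_B f (Y, n) p) z = dir_deriv (0, (0, 1)) B (p, z)"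
  unfolding rep_B_slice using partial_y_slice[OF C_on_imp_differentiable[OF C_on_B r]] by simp

lemma distortion_0_controlled:
  assumes "d \<le> r" "0 \<le> K" "distortion_0 d r P f (Y, n) \<le> ennreal K"
  shows "controlled d r K (1, 0) W A" "controlled d r K (0, 1) W B"
proof -
  have "C_norm (min (int d) (int r)) (int r) (rep_domain P f (Y, n))
      (\<lambda>p z. (rep_A f (Y, n) p z, rep_B f (Y, n) p z)) \<le> ennreal K"
    using assms(1,3) by (simp add: distortion_0_def min_absorb1)
  note * = C_norm_le_imp_word[OF assms(2) W_eq C_on_A C_on_B _ this]
  show "controlled d r K (1, 0) W A" "controlled d r K (0, 1) W B"
    unfolding controlled_def using depends_A depends_B * by (auto simp: A_def B_def)
qed

lemma distortion_0_leI:
  assumes "d \<le> r" "0 \<le> K"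
    and "\<And>us e. admissible d r us \<Longrightarrow> e \<in> W \<Longrightarrow> \<bar>iter_deriv us A e\<bar> \<le> K \<and> \<bar>iter_deriv us B e\<bar> \<le> K"
  shows "distortion_0 d r P f (Y, n) \<le> ennreal (2 * K)"
proof -
  have "C_norm (min (int d) (int r)) (int r) (rep_domain P f (Y, n))
      (\<lambda>p z. (rep_A f (Y, n) p z, rep_B f (Y, n) p z)) \<le> ennreal (2 * K)"
    by (rule C_norm_leI[OF assms(2) W_eq C_on_A C_on_B]) (use assms(3) in \<open>auto simp: A_def B_def\<close>)
  then show ?thesis
    using assms(1) by (simp add: distortion_0_def min_absorb1)
qed

definition dlA :: "'p \<times> plane \<Rightarrow> plane" where
  "dlA e = (dir_deriv (0, (1, 0)) lA e, dir_deriv (0, (0, 1)) lA e)"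

definition dlB :: "'p \<times> plane \<Rightarrow> plane" where
  "dlB e = (dir_deriv (0, (1, 0)) lB e, dir_deriv (0, (0, 1)) lB e)"

context
  assumes r2: "2 \<le> r"
begin

lemma Suc_r2: "Suc (r - 2) = r - 1" "int r - 2 = int (r - 2)"
  using r2 by auto

lemma C_on_dl: "C_on (r - 2) W (dir_deriv u lA)" "C_on (r - 2) W (dir_deriv u lB)"
  using depends_lA depends_lB by (auto simp: depends_def Suc_r2(1) intro!: C_on_dir_deriv)

lemma C_on_dlA: "C_on (r - 2) W dlA" and C_on_dlB: "C_on (r - 2) W dlB"
  unfolding dlA_def[abs_def] dlB_def[abs_def] by (intro C_on_Pair open_W C_on_dl)+

lemma differential_lA:
  assumes "(p, z) \<in> W"
  shows "differential (\<lambda>w. ln \<bar>partial_x (rep_A f (Y, n) p) w\<bar>) z = dlA (p, z)"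
  unfolding dlA_def
proof (rule differential_slice[where W = W and n = "r - 1", OF open_W _ _ assms])
  show "C_on (r - 1) W lA"
    using depends_lA by (simp add: depends_def)
qed (use r2 in \<open>auto simp: partial_A\<close>)

lemma differential_lB:
  assumes "(p, z) \<in> W"
  shows "differential (\<lambda>w. ln \<bar>partial_y (rep_B f (Y, n) p) w\<bar>) z = dlB (p, z)"
  unfolding dlB_def
proof (rule differential_slice[where W = W and n = "r - 1", OF open_W _ _ assms])
  show "C_on (r - 1) W lB"
    using depends_lB by (simp add: depends_def)
qed (use r2 in \<open>auto simp: partial_B lB_def\<close>)

lemma iter_deriv_dlA:
  assumes "length us \<le> r - 2" "e \<in> W"
  shows "iter_deriv us dlA e = (iter_deriv us (dir_deriv (0, (1, 0)) lA) e, iter_deriv us (dir_deriv (0, (0, 1)) lA) e)"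
  unfolding dlA_def[abs_def] by (rule iter_deriv_Pair[OF open_W C_on_dl(1) C_on_dl(1) assms])

lemma iter_deriv_dlB:
  assumes "length us \<le> r - 2" "e \<in> W"
  shows "iter_deriv us dlB e = (iter_deriv us (dir_deriv (0, (1, 0)) lB) e, iter_deriv us (dir_deriv (0, (0, 1)) lB) e)"
  unfolding dlB_def[abs_def] by (rule iter_deriv_Pair[OF open_W C_on_dl(2) C_on_dl(2) assms])

lemma distortion_1_controlled:
  assumes "0 \<le> K" "distortion_1 d r P f (Y, n) \<le> ennreal K"
  shows "controlled d (r - 2) K (1, 0) W (dir_deriv (0, (1, 0)) lA)"
    "controlled d (r - 2) K (0, 1) W (dir_deriv (0, (0, 1)) lB)"
proof -
  have *: "norm (iter_deriv us dlA e) \<le> K" "norm (iter_deriv us dlB e) \<le> K"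
    if "admissible d (r - 2) us" "e \<in> W" for us e
    using C_norm_le_imp_word[OF assms(1) W_eq C_on_dlA C_on_dlB _ assms(2)[unfolded distortion_1_def Suc_r2(2)] that]
      differential_lA differential_lB by auto
  have "\<bar>iter_deriv us (dir_deriv (0, (1, 0)) lA) e\<bar> \<le> K" "\<bar>iter_deriv us (dir_deriv (0, (0, 1)) lB) e\<bar> \<le> K"
    if us: "admissible d (r - 2) us" and e: "e \<in> W" for us e
  proof -
    have len: "length us \<le> r - 2"
      using us by (simp add: admissible_def)
    show "\<bar>iter_deriv us (dir_deriv (0, (1, 0)) lA) e\<bar> \<le> K"
      using order_trans[OF norm_fst_le *(1)[OF us e, unfolded iter_deriv_dlA[OF len e]]] by simp
    show "\<bar>iter_deriv us (dir_deriv (0, (0, 1)) lB) e\<bar> \<le> K"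
      using order_trans[OF norm_snd_le *(2)[OF us e, unfolded iter_deriv_dlB[OF len e]]] by simp
  qed
  moreover have "depends (r - 2) (1, 0) W (dir_deriv (0, (1, 0)) lA)" "depends (r - 2) (0, 1) W (dir_deriv (0, (0, 1)) lB)"
    using depends_lA depends_lB by (auto intro!: depends_dir_deriv simp: Suc_r2)
  ultimately show "controlled d (r - 2) K (1, 0) W (dir_deriv (0, (1, 0)) lA)"
    "controlled d (r - 2) K (0, 1) W (dir_deriv (0, (0, 1)) lB)"
    unfolding controlled_def by blast+
qed

text \<open>4 counts two logarithms with two phase derivatives each.\<close>

lemma distortion_1_leI:
  assumes "0 \<le> K"
    and b: "\<And>us e w. admissible d (r - 2) us \<Longrightarrow> e \<in> W \<Longrightarrow> norm w \<le> 1 \<Longrightarrow>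
      \<bar>iter_deriv us (dir_deriv (0, w) lA) e\<bar> \<le> K \<and> \<bar>iter_deriv us (dir_deriv (0, w) lB) e\<bar> \<le> K"
  shows "distortion_1 d r P f (Y, n) \<le> ennreal (4 * K)"
proof -
  have "norm (iter_deriv us dlA e) \<le> 2 * K \<and> norm (iter_deriv us dlB e) \<le> 2 * K"
    if us: "admissible d (r - 2) us" and e: "e \<in> W" for us e
  proof -
    have len: "length us \<le> r - 2"
      using us by (simp add: admissible_def)
    have "norm (iter_deriv us dlA e) \<le> norm (iter_deriv us (dir_deriv (0, (1, 0)) lA) e) + norm (iter_deriv us (dir_deriv (0, (0, 1)) lA) e)"
      unfolding iter_deriv_dlA[OF len e] by (rule norm_Pair_le)
    moreover have "norm (iter_deriv us dlB e) \<le> norm (iter_deriv us (dir_deriv (0, (1, 0)) lB) e) + norm (iter_deriv us (dir_deriv (0, (0, 1)) lB) e)"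
      unfolding iter_deriv_dlB[OF len e] by (rule norm_Pair_le)
    ultimately show ?thesis
      using b[OF us e, of "(1, 0)"] b[OF us e, of "(0, 1)"] by simp
  qed
  then have "C_norm (min (int d) (int (r - 2))) (int (r - 2)) (rep_domain P f (Y, n))
       (\<lambda>p z. (differential (\<lambda>w. ln \<bar>partial_x (rep_A f (Y, n) p) w\<bar>) z,
               differential (\<lambda>w. ln \<bar>partial_y (rep_B f (Y, n) p) w\<bar>) z)) \<le> ennreal (2 * (2 * K))"
    using assms(1) by (intro C_norm_leI[OF _ W_eq C_on_dlA C_on_dlB]) (auto simp: differential_lA differential_lB)
  then show ?thesis
    by (simp add: distortion_1_def Suc_r2)
qed

end

lemma distortion_1_trivial: "r < 2 \<Longrightarrow> 0 \<le> K \<Longrightarrow> distortion_1 d r P f (Y, n) \<le> ennreal K"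
  by (simp add: distortion_1_def C_norm_le)

end

lemma divide_le_ennreal_iff:
  assumes "0 < n" "0 \<le> K"
  shows "X / ennreal (real n) \<le> ennreal K \<longleftrightarrow> X \<le> ennreal (K * real n)"
proof
  have eq: "ennreal (real n) * (X / ennreal (real n)) = X"
    using assms by (simp add: ennreal_times_divide mult.commute[of _ X] mult_divide_eq_ennreal)
  assume "X / ennreal (real n) \<le> ennreal K"
  from mult_left_mono[OF this, of "ennreal (real n)"] show "X \<le> ennreal (K * real n)"
    using assms by (simp add: eq mult.commute flip: ennreal_mult)
next
  assume "X \<le> ennreal (K * real n)"
  from divide_right_mono_ennreal[OF this, of "ennreal (real n)"] show "X / ennreal (real n) \<le> ennreal K"
    using assms by (simp add: divide_ennreal)
qed

locale hyp_piece_b = hyp_piece cv ch r P f Y n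
  for cv ch r and P :: "('a::euclidean_space \<times> real) set" and f Y n +
  fixes m :: nat
  assumes b: "\<And>p. p \<in> P \<Longrightarrow> snd p \<noteq> 0"
begin

definition lBm :: "('a \<times> real) \<times> plane \<Rightarrow> real" where
  "lBm e = ln \<bar>dir_deriv (0, (0, 1)) B e / snd (fst e) ^ (m * n)\<bar>"

text \<open>Dividing by the power of b subtracts a function of the parameter alone. Phase
  derivatives do not notice it, so the bounds from \<open>distortion_1\<close> serve for
  \<open>lBm\<close> as well.\<close>

lemma lBm_eq:
  assumes "e \<in> W"
  shows "lBm e = lB e + - real (m * n) * ln \<bar>snd (fst e)\<bar>"
proof -
  have "snd (fst e) \<noteq> 0" "dir_deriv (0, (0, 1)) B e \<noteq> 0"
    using b[OF WD(1)[OF assms]] contraction_B(2)[OF assms] by simp_all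
  then show ?thesis
    by (simp add: lBm_def lB_def ln_div ln_realpow power_abs abs_divide)
qed

lemma bounded_linear_b: "bounded_linear (\<lambda>e::('a \<times> real) \<times> plane. snd (fst e))"
  using bounded_linear_compose[OF bounded_linear_snd bounded_linear_fst] .

lemma C_on_lnb: "C_on k W (\<lambda>e. - real (m * n) * ln \<bar>snd (fst e)\<bar>)"
proof (rule C_on_mult[OF open_W C_on_const])
  show "C_on k W (\<lambda>e. ln \<bar>snd (fst e)\<bar>)"
    by (rule C_on_ln_abs[OF open_W C_on_bounded_linear[OF bounded_linear_b]]) (use WD(1) b in blast)
qed

lemma C_on_lBm: "C_on (r - 1) W lBm"
proof -
  have "C_on (r - 1) W lB"
    using depends_lB by (simp add: depends_def)
  from C_on_add[OF open_W this C_on_lnb] show ?thesis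
    using C_on_cong[OF open_W, of lBm "\<lambda>e. lB e + - real (m * n) * ln \<bar>snd (fst e)\<bar>"] lBm_eq
    by blast
qed

lemma dir_deriv_lBm:
  assumes r1: "0 < r - 1" and e: "e \<in> W"
  shows "dir_deriv (0, w) lBm e = dir_deriv (0, w) lB e"
proof -
  have "lB differentiable (at e)"
    using depends_lB r1 e by (auto simp: depends_def intro: C_on_imp_differentiable)
  moreover have "((\<lambda>e. ln \<bar>snd (fst e)\<bar>) has_derivative (\<lambda>u. snd (fst u) * inverse (snd (fst e)))) (at e)"
    using b[OF WD(1)[OF e]]
    by (intro has_derivative_ln_abs bounded_linear_imp_has_derivative bounded_linear_b)
  ultimately have "((\<lambda>e. lB e + - real (m * n) * ln \<bar>snd (fst e)\<bar>) has_derivative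
      (\<lambda>u. dir_deriv u lB e + - real (m * n) * (snd (fst u) * inverse (snd (fst e))))) (at e)"
    by (intro has_derivative_add has_derivative_mult_right has_derivative_dir_deriv)
  from dir_deriv_eq[OF this, of "(0, w)"]
  have "dir_deriv (0, w) (\<lambda>e. lB e + - real (m * n) * ln \<bar>snd (fst e)\<bar>) e = dir_deriv (0, w) lB e"
    by simp
  then show ?thesis
    using dir_deriv_cong_open[OF open_W e lBm_eq] by simp
qed

lemma depends_lBm: "depends (r - 1) (0, 1) W lBm"
proof (rule dependsI[OF open_W C_on_lBm])
  fix w :: plane and e assume r1: "0 < r - 1" and w: "w \<bullet> (0, 1) = 0" and e: "e \<in> W"
  have "dir_deriv (0, w) (iter_deriv [] lB) e = 0"
    using depends_lB w e r1 unfolding depends_def by (metis list.size(3))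
  then show "dir_deriv (0, w) lBm e = 0"
    by (simp add: dir_deriv_lBm[OF r1 e])
qed

lemma controlled_dir_deriv_lBm:
  assumes "2 \<le> r" "controlled d k K (0, 1) W (dir_deriv (0, (0, 1)) lB)" "k \<le> r - 2"
  shows "controlled d k K (0, 1) W (dir_deriv (0, (0, 1)) lBm)"
proof -
  have "iter_deriv us (dir_deriv (0, (0, 1)) lBm) e = iter_deriv us (dir_deriv (0, (0, 1)) lB) e"
    if "e \<in> W" for us e
    using assms(1) by (intro iter_deriv_cong_open[OF open_W that] dir_deriv_lBm) auto
  moreover have "depends k (0, 1) W (dir_deriv (0, (0, 1)) lBm)"
  proof -
    have "depends (Suc (r - 2)) (0, 1) W lBm"
      using depends_lBm assms(1) by (simp add: Suc_r2)
    then show ?thesis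
      using depends_mono[OF depends_dir_deriv assms(3)] by blast
  qed
  ultimately show ?thesis
    using assms(2) unfolding controlled_def by simp
qed

lemma distortion_m_le_iff:
  assumes K: "0 \<le> K" and n: "0 < n"
  shows "distortion_m m d r P f (Y, n) \<le> ennreal K \<longleftrightarrow>
    (\<forall>vs e. 1 \<le> length vs \<longrightarrow> length vs \<le> min d (r - 1) \<longrightarrow> (\<forall>v\<in>set vs. norm v \<le> 1) \<longrightarrow> e \<in> W \<longrightarrow>
      norm (iter_deriv (word vs []) lA e, iter_deriv (word vs []) lBm e) \<le> K * real n)"
proof -
  let ?F = "\<lambda>p z. (ln \<bar>partial_x (rep_A f (Y, n) p) z\<bar>, ln \<bar>partial_y (rep_B f (Y, n) p) z / snd p ^ (m * n)\<bar>)"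
  have K': "0 \<le> K * real n"
    using K by simp
  have lA: "C_on (r - 1) W lA"
    using depends_lA by (simp add: depends_def)
  have eq: "fam_deriv vs [] ?F p z = (iter_deriv (word vs []) lA (p, z), iter_deriv (word vs []) lBm (p, z))"
    if "length vs \<le> min d (r - 1)" "(p, z) \<in> W" for vs p z
    using that by (intro fam_deriv_Pair[OF open_W lA C_on_lBm]) (auto simp: partial_A partial_B lBm_def)
  have "distortion_m m d r P f (Y, n) \<le> ennreal K \<longleftrightarrow>
      (\<forall>k p z. 1 \<le> k \<longrightarrow> k \<le> min d (r - 1) \<longrightarrow> (p, z) \<in> W \<longrightarrow> deriv_norm k 0 ?F p z \<le> ennreal (K * real n))"
    unfolding distortion_m_def snd_conv divide_le_ennreal_iff[OF n K]
    by (auto simp: SUP_le_iff Ball_def W_eq)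
  also have "\<dots> \<longleftrightarrow> (\<forall>vs p z. 1 \<le> length vs \<longrightarrow> length vs \<le> min d (r - 1) \<longrightarrow> (p, z) \<in> W \<longrightarrow>
      (\<forall>v\<in>set vs. norm v \<le> 1) \<longrightarrow> norm (fam_deriv vs [] ?F p z) \<le> K * real n)"
    unfolding deriv_norm_le[OF K'] by auto
  also have "\<dots> \<longleftrightarrow> (\<forall>vs p z. 1 \<le> length vs \<longrightarrow> length vs \<le> min d (r - 1) \<longrightarrow> (p, z) \<in> W \<longrightarrow>
      (\<forall>v\<in>set vs. norm v \<le> 1) \<longrightarrow>
      norm (iter_deriv (word vs []) lA (p, z), iter_deriv (word vs []) lBm (p, z)) \<le> K * real n)"
    using eq by (metis (no_types, lifting))
  finally show ?thesis
    by auto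
qed

end


section \<open>The product as a piece, its orbit, and the two towers along it\<close>

section \<open>Products of hyperbolic pieces\<close>

text \<open>Unfolds the left-nested product into an itinerary. Pieces are numbered from 1 and steps
  from 0: the box of \<open>D (Suc k)\<close> is met once the first k pieces have been run
  through.\<close>

lemma star_seq_Suc:
  "star_seq f D (Suc N) =
    (\<lambda>p. {z. \<forall>k<Suc N. (f p ^^ (\<Sum>i<k. snd (D (Suc i)))) z \<in> fst (D (Suc k)) p},
     \<Sum>i<Suc N. snd (D (Suc i)))"
proof (induction N)
  case 0
  then show ?case
    by (simp add: star_seq_def prod_eq_iff)
next
  case (Suc N)
  have "star_seq f D (Suc (Suc N)) = star f (star_seq f D (Suc N)) (D (Suc (Suc N)))"
    by (simp add: star_seq_def)
  also have "\<dots> = (\<lambda>p. {z. \<forall>k<Suc (Suc N). (f p ^^ (\<Sum>i<k. snd (D (Suc i)))) z \<in> fst (D (Suc k)) p},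
     \<Sum>i<Suc (Suc N). snd (D (Suc i)))"
    unfolding Suc.IH star_def
    by (auto simp: case_prod_unfold fun_eq_iff less_Suc_eq)
  finally show ?case .
qed

locale hyp_chain =
  fixes cv ch :: real and r :: nat and P :: "'p::euclidean_space set"
    and f :: "'p \<Rightarrow> plane \<Rightarrow> plane" and D :: "nat \<Rightarrow> 'p piece" and N :: nat
  assumes cone: "0 < cv" "0 < ch" "cv * ch < 1" and r: "0 < r"
    and P: "open P" and f: "diffeo_family r P f" and N: "0 < N"
    and pieces: "\<And>k. k < N \<Longrightarrow> hyperbolic_piece cv ch r P f (D (Suc k))"
    and product: "persistent_piece cv ch r P f (star_seq f D N)"
begin

definition Yk :: "nat \<Rightarrow> 'p \<Rightarrow> plane set" where "Yk k = fst (D (Suc k))"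

definition nk :: "nat \<Rightarrow> nat" where "nk k = snd (D (Suc k))"

lemma D_eq: "D (Suc k) = (Yk k, nk k)"
  by (simp add: Yk_def nk_def)

definition s :: "nat \<Rightarrow> nat" where "s k = (\<Sum>i<k. nk i)"

definition YS :: "'p \<Rightarrow> plane set" where "YS p = {z. \<forall>k<N. (f p ^^ s k) z \<in> Yk k p}"

lemma star_seq_eq: "star_seq f D N = (YS, s N)"
  using star_seq_Suc[of f D "N - 1"] N by (simp add: YS_def[abs_def] s_def Yk_def nk_def)

lemma hp: "k < N \<Longrightarrow> hyp_piece cv ch r P f (Yk k) (nk k)"
  using cone r P f pieces[of k] by (simp add: hyp_piece_def hyperbolic_piece_def D_eq)

definition c :: real where "c = sqrt (cv * ch)"

lemma c: "0 < c" "c < 1"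
  using cone by (simp_all add: c_def)

lemma s_0 [simp]: "s 0 = 0"
  by (simp add: s_def)

lemma s_Suc: "(f p ^^ s (Suc k)) z = (f p ^^ nk k) ((f p ^^ s k) z)"
  unfolding s_def sum.lessThan_Suc by (simp add: add.commute[of _ "nk k"] funpow_add)

lemma C_on_f: "p \<in> P \<Longrightarrow> C_on r UNIV (f p ^^ k)"
  using f by (intro C_on_funpow) (auto simp: diffeo_family_def C_diffeo_def)

lemma f_differentiable: "p \<in> P \<Longrightarrow> (f p ^^ k) differentiable (at z)"
  using C_on_imp_differentiable[OF C_on_f r] by simp

text \<open>Points of \<open>YS p\<close> visit the boxes \<open>Yk k p\<close> in turn, so the
  inequalities of the pieces multiply. As \<open>c ^ N \<le> c\<close>, the product is itself
  hyperbolic, and the results on single pieces apply to it as \<open>S\<close>.\<close>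

lemma product_hyperbolic:
  assumes p: "p \<in> P" and z: "z \<in> YS p" and k: "k \<le> N"
  shows "\<bar>fst u\<bar> \<le> c ^ k * \<bar>fst (dir_deriv u (f p ^^ s k) z)\<bar> \<and>
    \<bar>snd (dir_deriv u (f p ^^ s k) z)\<bar> \<le> c ^ k * \<bar>snd u\<bar>"
  using k
proof (induction k)
  case 0
  have "dir_deriv u (f p ^^ s 0) z = u"
    by (simp add: dir_deriv_def id_def)
  then show ?case
    by (simp only: power_0 mult_1 order_refl simp_thms)
next
  case (Suc k)
  then have k: "k < N"
    by simp
  let ?v = "dir_deriv u (f p ^^ s k) z" and ?y = "(f p ^^ s k) z"
  have "dir_deriv u (f p ^^ s (Suc k)) z = dir_deriv u (\<lambda>z. (f p ^^ nk k) ((f p ^^ s k) z)) z"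
    by (simp add: s_Suc[abs_def])
  also have "\<dots> = dir_deriv ?v (f p ^^ nk k) ?y"
    by (rule dir_deriv_compose[OF f_differentiable[OF p] f_differentiable[OF p]])
  finally have eq: "dir_deriv u (f p ^^ s (Suc k)) z = dir_deriv ?v (f p ^^ nk k) ?y" .
  have "is_hyperbolic cv ch (f p) (Yk k p) (nk k)"
    using hyp_piece.hyp[OF hp[OF k] p] .
  moreover have "?y \<in> Yk k p"
    using z k by (simp add: YS_def)
  ultimately have h: "\<bar>fst ?v\<bar> \<le> c * \<bar>fst (dir_deriv ?v (f p ^^ nk k) ?y)\<bar>"
    "\<bar>snd (dir_deriv ?v (f p ^^ nk k) ?y)\<bar> \<le> c * \<bar>snd ?v\<bar>"
    unfolding is_hyperbolic_def c_def dir_deriv_def by (metis prod.collapse)+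
  have "c ^ k * \<bar>fst ?v\<bar> \<le> c ^ k * (c * \<bar>fst (dir_deriv ?v (f p ^^ nk k) ?y)\<bar>)"
    using h(1) c by (intro mult_left_mono) auto
  moreover have "c * \<bar>snd ?v\<bar> \<le> c * (c ^ k * \<bar>snd u\<bar>)"
    using Suc c by (intro mult_left_mono) auto
  ultimately show ?case
    unfolding eq using Suc h by (simp add: mult.assoc mult.left_commute)
qed

sublocale S: hyp_piece cv ch r P f YS "s N"
proof
  show "persistent_piece cv ch r P f (YS, s N)"
    using product by (simp add: star_seq_eq)
  fix p assume p: "p \<in> P"
  have cN: "c ^ N \<le> c"
    using power_decreasing[of 1 N c] c N by simp
  show "is_hyperbolic cv ch (f p) (YS p) (s N)"
    unfolding is_hyperbolic_def c_def[symmetric]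
  proof (intro ballI allI impI)
    fix z X0 Y0 X1 Y1 assume z: "z \<in> YS p" and "(X1, Y1) = frechet_derivative (f p ^^ s N) (at z) (X0, Y0)"
    then have eq: "dir_deriv (X0, Y0) (f p ^^ s N) z = (X1, Y1)"
      by (simp add: dir_deriv_def)
    have "\<bar>X0\<bar> \<le> c ^ N * \<bar>X1\<bar>" "\<bar>Y1\<bar> \<le> c ^ N * \<bar>Y0\<bar>"
      using product_hyperbolic[OF p z order_refl, of "(X0, Y0)"] by (simp_all add: eq)
    then show "\<bar>X0\<bar> \<le> c * \<bar>X1\<bar> \<and> \<bar>Y1\<bar> \<le> c * \<bar>Y0\<bar>"
      using mult_right_mono[OF cN, of "\<bar>X1\<bar>"] mult_right_mono[OF cN, of "\<bar>Y0\<bar>"] by auto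
  qed
qed (use cone r P f in auto)

definition orbit :: "nat \<Rightarrow> 'p \<times> plane \<Rightarrow> plane" where
  "orbit k e = (f (fst e) ^^ s k) (snd (S.\<Psi> e))"

text \<open>The mixed coordinates (x_{k+1}, y_k) along the orbit, in which the representation of
  piece k takes its arguments.\<close>

definition H :: "nat \<Rightarrow> 'p \<times> plane \<Rightarrow> 'p \<times> plane" where
  "H k e = (fst e, (fst (orbit (Suc k) e), snd (orbit k e)))"

abbreviation Wk :: "nat \<Rightarrow> ('p \<times> plane) set" where "Wk k \<equiv> hyp_piece.W P f (Yk k) (nk k)"

abbreviation Ak :: "nat \<Rightarrow> 'p \<times> plane \<Rightarrow> real" where "Ak k \<equiv> hyp_piece.A f (Yk k) (nk k)"

abbreviation Bk :: "nat \<Rightarrow> 'p \<times> plane \<Rightarrow> real" where "Bk k \<equiv> hyp_piece.B f (Yk k) (nk k)"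

abbreviation lAk :: "nat \<Rightarrow> 'p \<times> plane \<Rightarrow> real" where "lAk k \<equiv> hyp_piece.lA f (Yk k) (nk k)"

abbreviation lBk :: "nat \<Rightarrow> 'p \<times> plane \<Rightarrow> real" where "lBk k \<equiv> hyp_piece.lB f (Yk k) (nk k)"

lemma fst_H [simp]: "fst (H k e) = fst e"
  by (simp add: H_def)

lemma orbit_0: "orbit 0 e = (S.A e, snd (snd e))"
  by (simp add: orbit_def S.\<Psi>_def)

lemma orbit_Suc: "orbit (Suc k) e = (f (fst e) ^^ nk k) (orbit k e)"
  by (simp add: orbit_def s_Suc)

lemma orbit_N: "e \<in> S.W \<Longrightarrow> orbit N e = (fst (snd e), S.B e)"
  using S.WD(3)[of e] by (simp add: orbit_def S.G_def)

lemma orbit_in: "e \<in> S.W \<Longrightarrow> k < N \<Longrightarrow> orbit k e \<in> Yk k (fst e)"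
  using S.WD(2)[of e] by (simp add: orbit_def YS_def)

lemma C_on_orbit: "C_on r S.W (orbit k)"
proof -
  have "C_on r S.W (\<lambda>e. (f (fst (S.\<Psi> e)) ^^ s k) (snd (S.\<Psi> e)))"
    by (rule C_on_compose[OF S.open_W S.open_PU C_on_family_funpow[OF f P] S.C_on_\<Psi> S.\<Psi>_in]) simp
  then show ?thesis
    by (simp add: orbit_def[abs_def])
qed

lemma C_on_H: "C_on r S.W (H k)"
  unfolding H_def[abs_def]
  by (intro C_on_Pair C_on_fst C_on_snd S.open_W C_on_orbit C_on_bounded_linear bounded_linear_fst)

lemma H_piece:
  assumes e: "e \<in> S.W" and k: "k < N"
  shows "hyp_piece.\<Psi> f (Yk k) (nk k) (H k e) = (fst e, orbit k e)"
    and "Ak k (H k e) = fst (orbit k e)" and "Bk k (H k e) = snd (orbit (Suc k) e)"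
    and "H k e \<in> hyp_piece.\<Omega> P f (Yk k) (nk k)"
proof -
  interpret K: hyp_piece cv ch r P f "Yk k" "nk k"
    by (rule hp[OF k])
  have 1: "fst (fst e, orbit k e) \<in> P" "snd (fst e, orbit k e) \<in> Yk k (fst (fst e, orbit k e))"
    using S.WD(1)[OF e] orbit_in[OF e k] by simp_all
  have H: "H k e = (fst (fst e, orbit k e), (fst (K.G (fst e, orbit k e)), snd (snd (fst e, orbit k e))))"
    by (simp add: H_def orbit_Suc K.G_def)
  show *: "K.\<Psi> (H k e) = (fst e, orbit k e)"
    unfolding H by (rule K.\<Psi>_of(1)[OF 1])
  show "K.A (H k e) = fst (orbit k e)"
    by (simp add: K.A_eq *)
  show "K.B (H k e) = snd (orbit (Suc k) e)"
    unfolding H K.\<Psi>_of(2)[OF 1] by (simp add: K.G_def orbit_Suc)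
  show "H k e \<in> K.\<Omega>"
    unfolding H by (rule K.\<Psi>_of(3)[OF 1])
qed

lemma f_inj: "p \<in> P \<Longrightarrow> inj (f p ^^ k)"
  using f unfolding diffeo_family_def C_diffeo_def homeomorphism_def
  by (intro inj_fn) (metis UNIV_I injI)

text \<open>Continuity of \<open>H k\<close> alone would not keep interior points inside; invariance of domain does.\<close>

lemma H_in_Wk:
  assumes k: "k < N"
  shows "H k ` S.W \<subseteq> Wk k"
proof -
  interpret K: hyp_piece cv ch r P f "Yk k" "nk k"
    by (rule hp[OF k])
  \<comment> \<open>The representation of piece k recovers \<open>orbit k e\<close> from
    \<open>H k e\<close>; injectivity of the iterates then gives the start of the orbit, and with it
    e.\<close>
  have "inj_on (H k) S.W"
  proof (rule inj_onI)
    fix e e' assume e: "e \<in> S.W" "e' \<in> S.W" and eq: "H k e = H k e'"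
    have p: "fst e = fst e'"
      using arg_cong[OF eq, of fst] by simp
    have "orbit k e = orbit k e'"
      using H_piece(1)[OF e(1) k] H_piece(1)[OF e(2) k] eq by simp
    then have "snd (S.\<Psi> e) = snd (S.\<Psi> e')"
      using f_inj[OF S.WD(1)[OF e(1)]] p by (auto simp: orbit_def dest: injD)
    then have "S.\<Psi> e = S.\<Psi> e'"
      using p by (simp add: prod_eq_iff)
    then have "(fst (snd e), S.B e) = (fst (snd e'), S.B e')" "snd (snd e) = snd (snd e')"
      using S.WD(3)[OF e(1)] S.WD(3)[OF e(2)] S.snd_snd_\<Psi>[of e] S.snd_snd_\<Psi>[of e'] by simp_all
    then show "e = e'"
      using p by (simp add: prod_eq_iff)
  qed
  then have "open (H k ` S.W)"
    by (intro invariance_of_domain C_on_imp_continuous[OF C_on_H] S.open_W)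
  moreover have "H k ` S.W \<subseteq> K.\<Omega>"
    using H_piece(4)[OF _ k] by auto
  ultimately show ?thesis
    unfolding K.W_def by (rule interior_maximal[rotated])
qed

lemma H_lifts:
  assumes k: "k < N"
  shows "lifts S.W (Wk k) (1, 0) (H k) (\<lambda>e. fst (orbit (Suc k) e))"
    and "lifts S.W (Wk k) (0, 1) (H k) (\<lambda>e. snd (orbit k e))"
  using H_in_Wk[OF k] C_on_imp_differentiable[OF C_on_H r]
  unfolding lifts_def by (auto simp: H_def inner_prod_def)

text \<open>x_k is computed from x_{k+1} by piece k, so this tower starts at the end of the orbit
  and its step k uses piece \<open>N - Suc k\<close>. In \<open>tower_B\<close> the pieces come in
  their natural order.\<close>

lemma tower_A:
  assumes "0 \<le> K" "\<And>k. k < N \<Longrightarrow> controlled d r K (1, 0) (Wk k) (Ak k)"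
  shows "contraction_tower S.W (\<lambda>k. Wk (N - Suc k)) (\<lambda>k. Ak (N - Suc k)) (\<lambda>k. H (N - Suc k))
    (\<lambda>k e. fst (orbit (N - k) e)) N (1, 0) c K d r"
proof
  show "open S.W"
    by (rule S.open_W)
  show "((1, 0)::plane) \<bullet> (1, 0) = 1"
    by (simp add: inner_prod_def)
  show "fst (orbit (N - 0) e) = snd e \<bullet> (1, 0)" if "e \<in> S.W" for e
    using orbit_N[OF that] by (cases e) (auto simp: inner_prod_def)
  fix k assume "k < N"
  then have k': "N - Suc k < N" "Suc (N - Suc k) = N - k"
    by auto
  interpret K: hyp_piece cv ch r P f "Yk (N - Suc k)" "nk (N - Suc k)"
    by (rule hp[OF k'(1)])
  have cK: "K.c = c"
    by (simp add: K.c_def c_def)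
  show "open K.W"
    by (rule K.open_W)
  show "C_on r S.W (H (N - Suc k))"
    by (rule C_on_H)
  show "lifts S.W K.W (1, 0) (H (N - Suc k)) (\<lambda>e. fst (orbit (N - k) e))"
    using H_lifts(1)[OF k'(1)] by (simp only: k'(2))
  show "controlled d r K (1, 0) K.W K.A"
    by (rule assms(2)[OF k'(1)])
  show "fst (orbit (N - Suc k) e) = K.A (H (N - Suc k) e)" if "e \<in> S.W" for e
    by (rule H_piece(2)[OF that k'(1), symmetric])
  show "\<bar>dir_deriv (0, (1, 0)) K.A e\<bar> \<le> c" "dir_deriv (0, (1, 0)) K.A e \<noteq> 0" if "e \<in> K.W" for e
    using K.contraction_A[OF that] by (simp_all add: cK)
qed (use c r assms in auto)

lemma tower_B:
  assumes "0 \<le> K" "\<And>k. k < N \<Longrightarrow> controlled d r K (0, 1) (Wk k) (Bk k)"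
  shows "contraction_tower S.W Wk Bk H (\<lambda>k e. snd (orbit k e)) N (0, 1) c K d r"
proof
  show "open S.W"
    by (rule S.open_W)
  show "((0, 1)::plane) \<bullet> (0, 1) = 1"
    by (simp add: inner_prod_def)
  show "snd (orbit 0 e) = snd e \<bullet> (0, 1)" if "e \<in> S.W" for e
    by (cases e) (auto simp: inner_prod_def orbit_0)
  fix k assume k: "k < N"
  interpret K: hyp_piece cv ch r P f "Yk k" "nk k"
    by (rule hp[OF k])
  have cK: "K.c = c"
    by (simp add: K.c_def c_def)
  show "open K.W"
    by (rule K.open_W)
  show "C_on r S.W (H k)"
    by (rule C_on_H)
  show "lifts S.W K.W (0, 1) (H k) (\<lambda>e. snd (orbit k e))"
    by (rule H_lifts(2)[OF k])
  show "controlled d r K (0, 1) K.W K.B"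
    by (rule assms(2)[OF k])
  show "snd (orbit (Suc k) e) = K.B (H k e)" if "e \<in> S.W" for e
    by (rule H_piece(3)[OF that k, symmetric])
  show "\<bar>dir_deriv (0, (0, 1)) K.B e\<bar> \<le> c" "dir_deriv (0, (0, 1)) K.B e \<noteq> 0" if "e \<in> K.W" for e
    using K.contraction_B[OF that] by (simp_all add: cK)
qed (use c r assms in auto)

lemma orbit_0_A: "(\<lambda>e. fst (orbit (N - N) e)) = S.A"
  by (simp add: orbit_0)

lemma iter_deriv_orbit_N: "e \<in> S.W \<Longrightarrow> iter_deriv us (\<lambda>e. snd (orbit N e)) e = iter_deriv us S.B e"
  by (rule iter_deriv_cong_open[OF S.open_W]) (simp_all add: orbit_N)

lemma controlled_pieces:
  assumes "d \<le> r" "0 \<le> K" and "\<And>k. k < N \<Longrightarrow> distortion_0 d r P f (D (Suc k)) \<le> ennreal K" and "k < N"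
  shows "controlled d r K (1, 0) (Wk k) (Ak k)" "controlled d r K (0, 1) (Wk k) (Bk k)"
  using hyp_piece.distortion_0_controlled[OF hp[OF assms(4)] assms(1,2)] assms(3)[OF assms(4)]
  by (simp_all add: D_eq)

theorem distortion_0_product:
  assumes "d \<le> r" "0 \<le> K" "\<And>k. k < N \<Longrightarrow> distortion_0 d r P f (D (Suc k)) \<le> ennreal K"
  shows "distortion_0 d r P f (star_seq f D N) \<le> ennreal (2 * comp_const r K (tower_const c K r))"
  unfolding star_seq_eq
proof (rule S.distortion_0_leI[OF assms(1)])
  note ctl = controlled_pieces[OF assms]
  interpret TA: contraction_tower S.W "\<lambda>k. Wk (N - Suc k)" "\<lambda>k. Ak (N - Suc k)" "\<lambda>k. H (N - Suc k)"
    "\<lambda>k e. fst (orbit (N - k) e)" N "(1, 0)" c K d r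
    by (rule tower_A[OF assms(2) ctl(1)])
  interpret TB: contraction_tower S.W Wk Bk H "\<lambda>k e. snd (orbit k e)" N "(0, 1)" c K d r
    by (rule tower_B[OF assms(2) ctl(2)])
  show "0 \<le> comp_const r K (tower_const c K r)"
    by (rule comp_const_nonneg[OF assms(2) TA.M_nonneg])
  fix us :: "('p \<times> plane) list" and e
  assume "admissible d r us" "e \<in> S.W"
  then show "\<bar>iter_deriv us S.A e\<bar> \<le> comp_const r K (tower_const c K r) \<and>
      \<bar>iter_deriv us S.B e\<bar> \<le> comp_const r K (tower_const c K r)"
    using TA.tower_bound[OF N] TB.tower_bound[OF N] by (simp add: orbit_0_A iter_deriv_orbit_N orbit_0)
qed

lemma sum_reverse: "(\<Sum>k<N. g (N - Suc k)) = (\<Sum>k<N. g k)"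
  by (rule sum.nat_diff_reindex)

lemma lA_product:
  assumes "0 \<le> K" "\<And>k. k < N \<Longrightarrow> controlled d r K (1, 0) (Wk k) (Ak k)" "e \<in> S.W"
  shows "S.lA e = (\<Sum>k<N. lAk (N - Suc k) (H (N - Suc k) e))"
proof -
  interpret TA: contraction_tower S.W "\<lambda>k. Wk (N - Suc k)" "\<lambda>k. Ak (N - Suc k)" "\<lambda>k. H (N - Suc k)"
    "\<lambda>k e. fst (orbit (N - k) e)" N "(1, 0)" c K d r
    by (rule tower_A[OF assms(1,2)])
  have "S.lA e = (\<Sum>k<N. ln \<bar>dir_deriv (0, (1, 0)) (Ak (N - Suc k)) (H (N - Suc k) e)\<bar>)"
    unfolding S.lA_def orbit_0_A[symmetric] by (rule TA.ln_dir_deriv_T[OF assms(3)])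
  also have "\<dots> = (\<Sum>k<N. lAk (N - Suc k) (H (N - Suc k) e))"
    by (intro sum.cong refl) (simp add: hyp_piece.lA_def[OF hp])
  finally show ?thesis .
qed

lemma lB_product:
  assumes "0 \<le> K" "\<And>k. k < N \<Longrightarrow> controlled d r K (0, 1) (Wk k) (Bk k)" "e \<in> S.W"
  shows "S.lB e = (\<Sum>k<N. lBk k (H k e))"
proof -
  interpret TB: contraction_tower S.W Wk Bk H "\<lambda>k e. snd (orbit k e)" N "(0, 1)" c K d r
    by (rule tower_B[OF assms(1,2)])
  have "dir_deriv (0, (0, 1)) S.B e = dir_deriv (0, (0, 1)) (\<lambda>e. snd (orbit N e)) e"
    by (rule dir_deriv_cong_open[OF S.open_W assms(3)]) (simp add: orbit_N)
  then have "S.lB e = (\<Sum>k<N. ln \<bar>dir_deriv (0, (0, 1)) (Bk k) (H k e)\<bar>)"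
    unfolding S.lB_def by (simp only: TB.ln_dir_deriv_T[OF assms(3)])
  also have "\<dots> = (\<Sum>k<N. lBk k (H k e))"
    by (intro sum.cong refl) (simp add: hyp_piece.lB_def[OF hp])
  finally show ?thesis .
qed

definition log_const :: "real \<Rightarrow> real" where
  "log_const K = 2 ^ r * (comp_const (r - 2) K (tower_const c K r) * tower_const c K r) * (2 / (1 - c))"

lemma log_const_nonneg: "0 \<le> K \<Longrightarrow> 0 \<le> log_const K"
  using tower_const_ge_1[of c K r] comp_const_nonneg[of K "tower_const c K r" "r - 2"] c
  unfolding log_const_def by (intro mult_nonneg_nonneg divide_nonneg_nonneg) auto

lemma controlled_logs:
  assumes "2 \<le> r" "0 \<le> K" "\<And>k. k < N \<Longrightarrow> distortion_1 d r P f (D (Suc k)) \<le> ennreal K" "k < N"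
  shows "controlled d (r - 2) K (1, 0) (Wk k) (dir_deriv (0, (1, 0)) (lAk k))"
    "controlled d (r - 2) K (0, 1) (Wk k) (dir_deriv (0, (0, 1)) (lBk k))"
  using hyp_piece.distortion_1_controlled[OF hp[OF assms(4)] assms(1,2)] assms(3)[OF assms(4)]
  by (simp_all add: D_eq)

theorem distortion_1_product:
  assumes "d \<le> r" "0 \<le> K" "\<And>k. k < N \<Longrightarrow> distortion_0 d r P f (D (Suc k)) \<le> ennreal K"
    and d1: "\<And>k. k < N \<Longrightarrow> distortion_1 d r P f (D (Suc k)) \<le> ennreal K"
  shows "distortion_1 d r P f (star_seq f D N) \<le> ennreal (4 * log_const K)"
proof (cases "2 \<le> r")
  case False
  then show ?thesis
    using log_const_nonneg[OF assms(2)] by (simp add: star_seq_eq S.distortion_1_trivial)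
next
  case True
  note ctl = controlled_pieces[OF assms(1-3)]
  note logs = controlled_logs[OF True assms(2) d1]
  interpret TA: contraction_tower S.W "\<lambda>k. Wk (N - Suc k)" "\<lambda>k. Ak (N - Suc k)" "\<lambda>k. H (N - Suc k)"
    "\<lambda>k e. fst (orbit (N - k) e)" N "(1, 0)" c K d r
    by (rule tower_A[OF assms(2) ctl(1)])
  interpret TB: contraction_tower S.W Wk Bk H "\<lambda>k e. snd (orbit k e)" N "(0, 1)" c K d r
    by (rule tower_B[OF assms(2) ctl(2)])
  show ?thesis
    unfolding star_seq_eq
  proof (rule S.distortion_1_leI[OF True log_const_nonneg[OF assms(2)]], intro conjI)
    fix us :: "('p \<times> plane) list" and e and w :: plane
    assume us: "admissible d (r - 2) us" and e: "e \<in> S.W" and w: "norm w \<le> 1"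
    show "\<bar>iter_deriv us (dir_deriv (0, w) S.lA) e\<bar> \<le> log_const K"
      unfolding log_const_def
      by (rule TA.tower_log_bound[OF hyp_piece.depends_lA[OF hp] lA_product[OF assms(2) ctl(1)] True logs(1) w us e])
        auto
    show "\<bar>iter_deriv us (dir_deriv (0, w) S.lB) e\<bar> \<le> log_const K"
      unfolding log_const_def
      by (rule TB.tower_log_bound[OF hyp_piece.depends_lB[OF hp] lB_product[OF assms(2) ctl(2)] True logs(2) w us e])
  qed
qed

end

section \<open>Products with the vertical derivative normalised by powers of b\<close>

locale hyp_chain_b = hyp_chain cv ch r P f D N
  for cv ch r and P :: "('a::euclidean_space \<times> real) set" and f D N +
  fixes m :: nat
  assumes b: "\<And>p. p \<in> P \<Longrightarrow> snd p \<noteq> 0"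
begin

sublocale Sb: hyp_piece_b cv ch r P f YS "s N" m
  by unfold_locales (rule b)

lemma hpb: "k < N \<Longrightarrow> hyp_piece_b cv ch r P f (Yk k) (nk k)"
  using hp b by (simp add: hyp_piece_b_def hyp_piece_b_axioms_def)

abbreviation lBmk :: "nat \<Rightarrow> ('a \<times> real) \<times> plane \<Rightarrow> real" where
  "lBmk k \<equiv> hyp_piece_b.lBm f (Yk k) (nk k) m"

text \<open>The lengths \<open>nk k\<close> add up to \<open>s N\<close>, so the power of b for the
  product splits among the pieces and the normalised logarithm is again a sum along the
  tower.\<close>

lemma lBm_product:
  assumes "0 \<le> K" "\<And>k. k < N \<Longrightarrow> controlled d r K (0, 1) (Wk k) (Bk k)" "e \<in> S.W"
  shows "Sb.lBm e = (\<Sum>k<N. lBmk k (H k e))"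
proof -
  have "(\<Sum>k<N. lBmk k (H k e)) = (\<Sum>k<N. lBk k (H k e) + - real (m * nk k) * ln \<bar>snd (fst e)\<bar>)"
  proof (rule sum.cong[OF refl])
    fix k assume "k \<in> {..<N}"
    then have k: "k < N"
      by simp
    have "H k e \<in> Wk k"
      using H_in_Wk[OF k] assms(3) by blast
    from hyp_piece_b.lBm_eq[OF hpb[OF k] this]
    show "lBmk k (H k e) = lBk k (H k e) + - real (m * nk k) * ln \<bar>snd (fst e)\<bar>"
      by simp
  qed
  also have "\<dots> = S.lB e + - real (m * s N) * ln \<bar>snd (fst e)\<bar>"
  proof -
    have "(\<Sum>k<N. - real (m * nk k) * ln \<bar>snd (fst e)\<bar>) = - real (m * s N) * ln \<bar>snd (fst e)\<bar>"
      by (simp add: s_def sum_distrib_left sum_distrib_right sum_negf)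
    then show ?thesis
      by (simp only: lB_product[OF assms] sum.distrib)
  qed
  finally show ?thesis
    using Sb.lBm_eq[OF assms(3)] by simp
qed

lemma word_params: "\<forall>v\<in>set vs. norm v \<le> 1 \<Longrightarrow> \<forall>v\<in>set (word vs ([]::plane list)). norm v \<le> 1 \<and> snd v = 0"
  by (auto simp: word_def)

text \<open>Each piece contributes at most \<open>K * nk k\<close> plus a constant. As
  \<open>1 \<le> nk k\<close>, there are at most \<open>s N\<close> constants, and division by
  \<open>s N\<close> leaves a bound independent of N. The factor 2 adds up the two
  components.\<close>

theorem distortion_m_product:
  assumes d: "d \<le> r" "0 \<le> K" "\<And>k. k < N \<Longrightarrow> distortion_0 d r P f (D (Suc k)) \<le> ennreal K"
    and d1: "\<And>k. k < N \<Longrightarrow> distortion_1 d r P f (D (Suc k)) \<le> ennreal K"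
    and dm: "\<And>k. k < N \<Longrightarrow> distortion_m m d r P f (D (Suc k)) \<le> ennreal K"
  shows "distortion_m m d r P f (star_seq f D N) \<le> ennreal (2 * (K + param_const r K (tower_const c K r)))"
proof (cases "P = {}")
  \<comment> \<open>Without parameters the lengths \<open>nk k\<close> are not known to be positive;
    the domain is then empty and the distortion is 0.\<close>
  case True
  then have "rep_domain P f (YS, s N) = {}"
    by (simp add: rep_domain_def)
  moreover have "(SUP k\<in>A. 0 :: ennreal) = 0" for A :: "nat set"
    by (cases "A = {}") (simp_all add: bot_ennreal)
  ultimately show ?thesis
    by (simp add: star_seq_eq distortion_m_def bot_ennreal)
next
  case False
  let ?C = "param_const r K (tower_const c K r)"
  have C0: "0 \<le> ?C"
    using tower_const_ge_1[of c K r] by (intro param_const_nonneg d) simp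
  have nk: "0 < nk k" if "k < N" for k
    using hyp_piece.is_piece[OF hp[OF that]] False by (auto simp: is_piece_def)
  have sN: "0 < s N" "real N \<le> real (s N)"
  proof -
    have "(\<Sum>k<N. 1) \<le> (\<Sum>k<N. nk k)"
      using nk by (intro sum_mono) (simp add: Suc_leI)
    then have "N \<le> s N"
      by (simp add: s_def)
    then show "0 < s N" "real N \<le> real (s N)"
      using N by simp_all
  qed
  have total: "(\<Sum>k<N. K * real (nk k) + ?C) \<le> (K + ?C) * real (s N)"
  proof -
    have "(\<Sum>k<N. K * real (nk k) + ?C) = K * real (s N) + ?C * real N"
      by (simp add: sum.distrib s_def sum_distrib_left mult.commute)
    also have "\<dots> \<le> K * real (s N) + ?C * real (s N)"
      using C0 sN by (intro add_left_mono mult_left_mono) auto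
    finally show ?thesis
      by (simp add: algebra_simps)
  qed
  note ctl = controlled_pieces[OF d]
  interpret TA: contraction_tower S.W "\<lambda>k. Wk (N - Suc k)" "\<lambda>k. Ak (N - Suc k)" "\<lambda>k. H (N - Suc k)"
    "\<lambda>k e. fst (orbit (N - k) e)" N "(1, 0)" c K d r
    by (rule tower_A[OF d(2) ctl(1)])
  interpret TB: contraction_tower S.W Wk Bk H "\<lambda>k e. snd (orbit k e)" N "(0, 1)" c K d r
    by (rule tower_B[OF d(2) ctl(2)])
  have KC: "0 \<le> 2 * (K + ?C)"
    using C0 d(2) by simp
  show ?thesis
    unfolding star_seq_eq Sb.distortion_m_le_iff[OF KC sN(1)]
  proof (intro allI impI)
    fix vs :: "('a \<times> real) list" and e
    assume len: "1 \<le> length vs" "length vs \<le> min d (r - 1)" and vs: "\<forall>v\<in>set vs. norm v \<le> 1" and e: "e \<in> S.W"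
    \<comment> \<open>A nonempty word of length at most r - 1 forces \<open>2 \<le> r\<close>, which
      makes the bounds on the logarithms available.\<close>
    have r2: "2 \<le> r" and len': "length vs \<le> d" "length vs \<le> r - 1" "length vs - 1 \<le> d" "length vs - 1 \<le> r - 2"
      using len by auto
    note logs = controlled_logs[OF r2 d(2) d1]
    have pw: "\<bar>iter_deriv (word vs []) (lAk k) y\<bar> \<le> K * real (nk k)"
      "\<bar>iter_deriv (word vs []) (lBmk k) y\<bar> \<le> K * real (nk k)" if k: "k < N" and y: "y \<in> Wk k" for k y
    proof -
      have "norm (iter_deriv (word vs []) (lAk k) y, iter_deriv (word vs []) (lBmk k) y) \<le> K * real (nk k)"
        using dm[OF k] len vs y unfolding D_eq hyp_piece_b.distortion_m_le_iff[OF hpb[OF k] d(2) nk[OF k]] by blast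
      from order_trans[OF norm_fst_le this] order_trans[OF norm_snd_le this]
      show "\<bar>iter_deriv (word vs []) (lAk k) y\<bar> \<le> K * real (nk k)"
        "\<bar>iter_deriv (word vs []) (lBmk k) y\<bar> \<le> K * real (nk k)"
        by simp_all
    qed
    have lw: "length (word vs ([]::plane list)) = length vs"
      by (simp add: word_def)
    have "\<bar>iter_deriv (word vs []) S.lA e\<bar> \<le> (\<Sum>k<N. K * real (nk (N - Suc k)) + ?C)"
    proof (rule TA.tower_param_bound[OF hyp_piece.depends_lA[OF hp] lA_product[OF d(2) ctl(1)] len'(1,2) _ pw(1) lw word_params[OF vs] e])
      show "controlled (length vs - 1) (length vs - 1) K (1, 0) (Wk (N - Suc k)) (dir_deriv (0, (1, 0)) (lAk (N - Suc k)))"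
        if "k < N" for k
        using that by (intro controlled_mono[OF logs(1)] len') auto
    qed auto
    also have "\<dots> \<le> (K + ?C) * real (s N)"
      using total sum_reverse[of "\<lambda>k. K * real (nk k) + ?C"] by simp
    finally have A: "\<bar>iter_deriv (word vs []) S.lA e\<bar> \<le> (K + ?C) * real (s N)" .
    have "\<bar>iter_deriv (word vs []) Sb.lBm e\<bar> \<le> (\<Sum>k<N. K * real (nk k) + ?C)"
    proof (rule TB.tower_param_bound[OF hyp_piece_b.depends_lBm[OF hpb] lBm_product[OF d(2) ctl(2)] len'(1,2) _ pw(2) lw word_params[OF vs] e])
      show "controlled (length vs - 1) (length vs - 1) K (0, 1) (Wk k) (dir_deriv (0, (0, 1)) (lBmk k))"
        if "k < N" for k
        by (rule controlled_mono[OF hyp_piece_b.controlled_dir_deriv_lBm[OF hpb[OF that] r2 logs(2)[OF _ that] order_refl] len'(3,4)])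
          simp
    qed
    also note total
    finally have B: "\<bar>iter_deriv (word vs []) Sb.lBm e\<bar> \<le> (K + ?C) * real (s N)" .
    have "norm (iter_deriv (word vs []) S.lA e, iter_deriv (word vs []) Sb.lBm e)
        \<le> \<bar>iter_deriv (word vs []) S.lA e\<bar> + \<bar>iter_deriv (word vs []) Sb.lBm e\<bar>"
      using norm_Pair_le[of "iter_deriv (word vs []) S.lA e" "iter_deriv (word vs []) Sb.lBm e"] by simp
    also have "\<dots> \<le> 2 * (K + ?C) * real (s N)"
      using add_mono[OF A B] by (simp add: algebra_simps)
    finally show "norm (iter_deriv (word vs []) S.lA e, iter_deriv (word vs []) Sb.lBm e) \<le> 2 * (K + ?C) * real (s N)" .
  qed
qed

end


theorem proposition2p26:
  fixes c\<^sub>v c\<^sub>h K\<^sub>0 :: real and d r :: nat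
  assumes "0 < c\<^sub>v" and "0 < c\<^sub>h" and "c\<^sub>v * c\<^sub>h < 1"
    and "1 \<le> d" and "d \<le> r" and "0 < K\<^sub>0"
  shows "\<exists>K\<^sub>1::real. 1 \<le> K\<^sub>1 \<and>
    (\<forall>(P :: ('a::euclidean_space \<times> real) set) f (m::nat) (N::nat) D.
       open P \<and> diffeo_family r P f \<and> 1 \<le> m \<and> 1 \<le> N \<and>
       (\<forall>j\<in>{1..N}. hyperbolic_piece c\<^sub>v c\<^sub>h r P f (D j)) \<and>
       persistent_piece c\<^sub>v c\<^sub>h r P f (star_seq f D N) \<longrightarrow>
       ((\<forall>j\<in>{1..N}. distortion_0 d r P f (D j) \<le> ennreal K\<^sub>0) \<longrightarrow>
          distortion_0 d r P f (star_seq f D N) \<le> ennreal K\<^sub>1) \<and>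
       ((\<forall>j\<in>{1..N}. distortion_0 d r P f (D j) \<le> ennreal K\<^sub>0 \<and>
                     distortion_1 d r P f (D j) \<le> ennreal K\<^sub>0) \<longrightarrow>
          distortion_1 d r P f (star_seq f D N) \<le> ennreal K\<^sub>1) \<and>
       ((\<forall>p\<in>P. snd p \<noteq> 0) \<and>
        (\<forall>j\<in>{1..N}. distortion_0 d r P f (D j) \<le> ennreal K\<^sub>0 \<and>
                     distortion_1 d r P f (D j) \<le> ennreal K\<^sub>0 \<and>
                     distortion_m m d r P f (D j) \<le> ennreal K\<^sub>0) \<longrightarrow>
          distortion_m m d r P f (star_seq f D N) \<le> ennreal K\<^sub>1))"
proof -
  let ?c = "sqrt (c\<^sub>v * c\<^sub>h)"
  \<comment> \<open>The constants of the three product bounds are spelled out here because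
    \<open>K\<^sub>1\<close> has to be fixed before the family, m, N and the pieces.\<close>
  define M where "M = tower_const ?c K\<^sub>0 r"
  define C0 where "C0 = 2 * comp_const r K\<^sub>0 M"
  define C1 where "C1 = 4 * (2 ^ r * (comp_const (r - 2) K\<^sub>0 M * M) * (2 / (1 - ?c)))"
  define Cm where "Cm = 2 * (K\<^sub>0 + param_const r K\<^sub>0 M)"
  define K\<^sub>1 where "K\<^sub>1 = max 1 (max C0 (max C1 Cm))"
  have K1: "ennreal C0 \<le> ennreal K\<^sub>1" "ennreal C1 \<le> ennreal K\<^sub>1" "ennreal Cm \<le> ennreal K\<^sub>1" "1 \<le> K\<^sub>1"
    by (auto simp: K\<^sub>1_def intro!: ennreal_leI)
  have K0: "0 \<le> K\<^sub>0"
    using assms(6) by simp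
  show ?thesis
  proof (intro exI[of _ K\<^sub>1] conjI allI impI, goal_cases)
    case 1
    show ?case
      by (rule K1)
  next
    case (2 P f m N D)
    then interpret hyp_chain c\<^sub>v c\<^sub>h r P f D N
      using assms by unfold_locales auto
    have "distortion_0 d r P f (star_seq f D N) \<le> ennreal C0"
      unfolding C0_def M_def c_def[symmetric] using 2 by (intro distortion_0_product assms K0) auto
    then show ?case
      by (rule order_trans[OF _ K1(1)])
  next
    case (3 P f m N D)
    then interpret hyp_chain c\<^sub>v c\<^sub>h r P f D N
      using assms by unfold_locales auto
    have "distortion_1 d r P f (star_seq f D N) \<le> ennreal C1"
      unfolding C1_def M_def c_def[symmetric] log_const_def[symmetric]
      using 3 by (intro distortion_1_product assms K0) auto
    then show ?case
      by (rule order_trans[OF _ K1(2)])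
  next
    case (4 P f m N D)
    then interpret hyp_chain_b c\<^sub>v c\<^sub>h r P f D N m
      using assms by unfold_locales auto
    have "distortion_m m d r P f (star_seq f D N) \<le> ennreal Cm"
      unfolding Cm_def M_def c_def[symmetric] using 4 by (intro distortion_m_product assms K0) auto
    then show ?case
      by (rule order_trans[OF _ K1(3)])
  qed
qed

end
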